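(* Let $\Delta$ be a simplicial complex on $\mathcal V=\{1,\dots,n\}$ with stratification indexed by $\Omega$ and essential simplicial complex $\tilde\Delta$. Let $r=|\Omega|$, let $\tilde f_l$ be the face numbers of $\tilde\Delta$ and $f_l$ the face numbers of $\Delta$ (numbers of faces of dimension $l$). Then $$H_{Lie}(t)=\sum_{n\ge 0}\ell_{T_B(I_\Delta)}\big(G_{J_m}(k[\Delta])^n\big)t^n=\sum_{n\ge 0}\ell_{\mathfrak g_k}\big(k\otimes_Rk[\Delta]_n\big)t^n=\frac{1}{(1-t)^r}\sum_{i=0}^r\tilde f_{i-1}\,t^i(1-t)^{r-i}.$$ Moreover $\tilde f_i\le f_i$ for all $i$.
   Context: $k$ is an algebraically closed field of characteristic $0$. $\Delta\subset 2^{\mathcal V}$ is an abstract simplicial complex with set of facets (maximal faces) $\Delta_{fc}$; $\dim\sigma=|\sigma|-1$. $B=k[x_1,\dots,x_n]$; with $x^\sigma=\prod_{i\in\sigma}x_i$, $I_\Delta=(x^\sigma\mid\sigma\notin\Delta)$ and $k[\Delta]=B/I_\Delta$. $T_B$ is the module of $k$-linear derivations of $B$ and $T_B(I_\Delta)=\{\delta\in T_B\mid\delta(I_\Delta)\subset I_\Delta\}$, a Lie algebroid acting on $k[\Delta]$. Let $N=\{i\mid\partial_{x_i}\notin T_B(I_\Delta)\}$, $J_m=(x_i\mid i\in N)$ (the maximal defining ideal of the $T_B(I_\Delta)$-module $B$), $R=B/J_m$, $\mathfrak g=\ker(R\otimes_BT_B(I_\Delta)\to T_R)$ and $\mathfrak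 g_k=k\otimes_R\mathfrak g$ the fibre Lie algebra (where $k=B/(x_1,\dots,x_n)$). Put $G_{J_m}(k[\Delta])^n=J_m^nk[\Delta]/J_m^{n+1}k[\Delta]$; the graded ring $G_{J_m}(k[\Delta])$ is identified with $k[\Delta]$ graded by total degree in the variables $x_i$, $i\in N$, and $k[\Delta]_n$ denotes its degree $n$ component $G_{J_m}(k[\Delta])^n$ (an $R$-module). $\ell$ denotes length as module over the indicated Lie algebroid or Lie algebra. Stratification: for $\lambda\subset\Delta_{fc}$ put $$\mathcal V_\lambda=\bigcap_{F\in\lambda}F\ \setminus\bigcup_{G\in\Delta_{fc},\ \bigcap_{F\in\lambda}F\not\subset G}\Big(G\cap\bigcap_{F\in\lambda}F\Big).$$ If $\mathcal V_\lambda\cap\mathcal V_{\lambda'}\neq\emptyset$ then $\mathcal V_\lambda=\mathcal V_{\lambda'}$; $\Omega$ indexes the distinct nonempty sets $\mathcal V_\omega$ so obtained, which partition $\mathcal V$ (two vertices lie in the same stratum iff they lie in exactly the same facets). For $\sigma\in\Delta$ put $\tilde\sigma=\{\omega\in\Omega\mid\sigma\cap\mathcal V_\omega\ne\emptyset\}$. The essential simplicial complex is $\tilde\Delta=\{\tilde\sigma\mid\sigma\in\Delta\}\subset 2^\Omega$. The empty face has dimension $-1$, so $\tilde f_{-1}=1$.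
   Formalization: The closed formula is proved only when no vertex lies in all facets; otherwise it is false (for the full simplex H_Lie = 1 but the right side is 1/(1-t)). The equality of the two length series and f̃_i ≤ f_i are proved for every Δ. *)

theory Defs
  imports
    "HOL-Algebra.Algebra"
    "HOL-Algebra.Algebraic_Closure_Type"
    "HOL-Computational_Algebra.Computational_Algebra"
    "HOL-Library.Extended_Nat"
    "HOL-Library.Poly_Mapping"
begin

section \<open>Simplicial complexes, strata, the essential complex\<close>

text \<open>
  The vertex set is the finite type \<open>'v\<close>.  A complex contains the empty face; a vertex is
  not required to be a face.
\<close>

definition simplicial_complex :: "'v set set \<Rightarrow> bool" where
  "simplicial_complex \<Delta> \<longleftrightarrow> {} \<in> \<Delta> \<and> (\<forall>\<sigma>\<in>\<Delta>. \<forall>\<tau>. \<tau> \<subseteq> \<sigma> \<longrightarrow> \<tau> \<in> \<Delta>)"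

definition facets :: "'v set set \<Rightarrow> 'v set set" where
  "facets \<Delta> = {F \<in> \<Delta>. \<forall>G\<in>\<Delta>. F \<subseteq> G \<longrightarrow> G = F}"

definition face_number :: "'v set set \<Rightarrow> int \<Rightarrow> nat" where
  "face_number \<Delta> i = card {\<sigma> \<in> \<Delta>. int (card \<sigma>) - 1 = i}"

text \<open>For \<open>L = {}\<close> the intersection is the whole vertex set \<open>UNIV\<close>.\<close>

definition stratum :: "'v set set \<Rightarrow> 'v set set \<Rightarrow> 'v set" where
  "stratum \<Delta> L = \<Inter>L - (\<Union>G\<in>{G \<in> facets \<Delta>. \<not> \<Inter>L \<subseteq> G}. G \<inter> \<Inter>L)"

text \<open>The index set \<open>\<Omega>\<close> is the set of distinct nonempty strata itself.\<close>

definition strata :: "'v set set \<Rightarrow> 'v set set" where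
  "strata \<Delta> = {stratum \<Delta> L | L. L \<subseteq> facets \<Delta>} - {{}}"

definition essential_face :: "'v set set \<Rightarrow> 'v set \<Rightarrow> 'v set set" where
  "essential_face \<Delta> \<sigma> = {\<omega> \<in> strata \<Delta>. \<sigma> \<inter> \<omega> \<noteq> {}}"

text \<open>
  If some vertex lies in every facet, the set of all such vertices is one of the strata.  These
  vertices are not in \<open>Nset\<close> below, so they carry degree 0 and the ring \<open>R\<close> in these variables is
  simple over its derivations: for a simplex the length series is 1, whereas the \<open>h\<close>-type
  expression of the essential complex (a point) is \<open>1 / (1 - t)\<close>.  Hence the condition
  \<open>\<Inter>(facets \<Delta>) = {}\<close> wherever that expression is used.
\<close>

definition essential_complex :: "'v set set \<Rightarrow> 'v set set set" where
  "essential_complex \<Delta> = essential_face \<Delta> ` \<Delta>"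


section \<open>Modules: quotients, extension of scalars, length\<close>

text \<open>
  The library record \<open>module\<close> extends \<open>ring\<close>; the fields \<open>mult\<close> and \<open>one\<close> play no role for a
  module and are left unspecified.
\<close>

definition mk_module ::
    "'b set \<Rightarrow> ('b \<Rightarrow> 'b \<Rightarrow> 'b) \<Rightarrow> 'b \<Rightarrow> ('a \<Rightarrow> 'b \<Rightarrow> 'b) \<Rightarrow> ('a, 'b) module" where
  "mk_module C pl z sm =
    \<lparr>carrier = C, monoid.mult = undefined, monoid.one = undefined,
     ring.zero = z, ring.add = pl, module.smult = sm\<rparr>"

definition self_module :: "'a ring \<Rightarrow> ('a, 'a) module" where
  "self_module A = mk_module (carrier A) (ring.add A) \<zero>\<^bsub>A\<^esub> (monoid.mult A)"

definition quot_module :: "('a, 'b) module \<Rightarrow> 'b set \<Rightarrow> ('a, 'b set) module" where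
  "quot_module M W = mk_module (a_rcosets\<^bsub>M\<^esub> W) (set_add M) W
     (\<lambda>a U. \<Union>x\<in>U. W +>\<^bsub>M\<^esub> (a \<odot>\<^bsub>M\<^esub> x))"

text \<open>The map of cosets \<open>W + x \<mapsto> W + f x\<close> induced by a map \<open>f\<close> that preserves \<open>W\<close>.\<close>

definition induced :: "('b, 'c) ring_scheme \<Rightarrow> 'b set \<Rightarrow> ('b \<Rightarrow> 'b) \<Rightarrow> 'b set \<Rightarrow> 'b set" where
  "induced M W f U = (\<Union>x\<in>U. W +>\<^bsub>M\<^esub> f x)"

text \<open>The submodule \<open>\<aa> M\<close> generated by all products.\<close>

definition ideal_smult :: "'a ring \<Rightarrow> ('a, 'b) module \<Rightarrow> 'a set \<Rightarrow> 'b set" where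
  "ideal_smult A M \<aa> =
    \<Inter>{W. submodule W A M \<and> (\<forall>a\<in>\<aa>. \<forall>x\<in>carrier M. a \<odot>\<^bsub>M\<^esub> x \<in> W)}"

text \<open>An \<open>A\<close>-module annihilated by an ideal \<open>J\<close>, as a module over \<open>A Quot J\<close>.\<close>

definition over_quotient :: "('a, 'b) module \<Rightarrow> ('a set, 'b) module" where
  "over_quotient M = mk_module (carrier M) (ring.add M) \<zero>\<^bsub>M\<^esub>
     (\<lambda>U m. THE p. \<exists>a\<in>U. p = a \<odot>\<^bsub>M\<^esub> m)"

text \<open>
  The tensor product \<open>S \<otimes>\<^sub>A M\<close> along a ring homomorphism \<open>\<phi>: A \<rightarrow> S\<close>, as an \<open>S\<close>-module: the free
  abelian group on \<open>S \<times> M\<close> modulo the subgroup generated by the bilinearity relations.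
\<close>

definition tensor_free :: "'s ring \<Rightarrow> ('a, 'b) module \<Rightarrow> (('s \<times> 'b) \<Rightarrow>\<^sub>0 int) monoid" where
  "tensor_free S M = free_Abelian_group (carrier S \<times> carrier M)"

definition tensor_rels ::
    "('a \<Rightarrow> 's) \<Rightarrow> 'a ring \<Rightarrow> 's ring \<Rightarrow> ('a, 'b) module \<Rightarrow> (('s \<times> 'b) \<Rightarrow>\<^sub>0 int) set" where
  "tensor_rels \<phi> A S M = generate (tensor_free S M)
    ({frag_of (s \<oplus>\<^bsub>S\<^esub> s', x) - frag_of (s, x) - frag_of (s', x) | s s' x.
        s \<in> carrier S \<and> s' \<in> carrier S \<and> x \<in> carrier M} \<union>
     {frag_of (s, x \<oplus>\<^bsub>M\<^esub> x') - frag_of (s, x) - frag_of (s, x') | s x x'.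
        s \<in> carrier S \<and> x \<in> carrier M \<and> x' \<in> carrier M} \<union>
     {frag_of (s \<otimes>\<^bsub>S\<^esub> \<phi> a, x) - frag_of (s, a \<odot>\<^bsub>M\<^esub> x) | s a x.
        s \<in> carrier S \<and> a \<in> carrier A \<and> x \<in> carrier M})"

definition base_change ::
    "('a \<Rightarrow> 's) \<Rightarrow> 'a ring \<Rightarrow> 's ring \<Rightarrow> ('a, 'b) module \<Rightarrow> ('s, (('s \<times> 'b) \<Rightarrow>\<^sub>0 int) set) module"
  where
  "base_change \<phi> A S M = (let F = tensor_free S M; K = tensor_rels \<phi> A S M in
     mk_module (carrier (F Mod K)) (monoid.mult (F Mod K)) (monoid.one (F Mod K))
       (\<lambda>t U. \<Union>c\<in>U. K #>\<^bsub>F\<^esub> frag_extend (\<lambda>(s, x). frag_of (t \<otimes>\<^bsub>S\<^esub> s, x)) c))"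

definition pure_tensor ::
    "('a \<Rightarrow> 's) \<Rightarrow> 'a ring \<Rightarrow> 's ring \<Rightarrow> ('a, 'b) module \<Rightarrow> 's \<Rightarrow> 'b \<Rightarrow> (('s \<times> 'b) \<Rightarrow>\<^sub>0 int) set"
  where
  "pure_tensor \<phi> A S M s x = tensor_rels \<phi> A S M #>\<^bsub>tensor_free S M\<^esub> frag_of (s, x)"

text \<open>
  For a balanced biadditive \<open>f: S \<times> M \<rightarrow> P\<close>, the additive map \<open>S \<otimes>\<^sub>A M \<rightarrow> P\<close> with
  \<open>s \<otimes> x \<mapsto> f (s, x)\<close>, evaluated on a class \<open>U\<close> of formal sums.
\<close>

definition tensor_lift ::
    "('p, 'c) ring_scheme \<Rightarrow> ('s \<times> 'b \<Rightarrow> 'p) \<Rightarrow> (('s \<times> 'b) \<Rightarrow>\<^sub>0 int) set \<Rightarrow> 'p" where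
  "tensor_lift P f U = (THE p. \<exists>c\<in>U.
     p = (\<Oplus>\<^bsub>P\<^esub>q\<in>Poly_Mapping.keys c. add_pow P (Poly_Mapping.lookup c q) (f q)))"

text \<open>
  A module over a Lie algebroid or Lie algebra enters through its underlying \<open>A\<close>-module \<open>M\<close> and
  the action \<open>act\<close> of the set \<open>L\<close>; its submodules are the \<open>A\<close>-submodules stable under \<open>L\<close>.
\<close>

definition stable_submodules ::
    "'a ring \<Rightarrow> ('a, 'b) module \<Rightarrow> 'l set \<Rightarrow> ('l \<Rightarrow> 'b \<Rightarrow> 'b) \<Rightarrow> 'b set set" where
  "stable_submodules A M L act =
    {W. submodule W A M \<and> (\<forall>\<delta>\<in>L. \<forall>w\<in>W. act \<delta> w \<in> W)}"

text \<open>The supremum of the lengths \<open>r\<close> of strict chains \<open>W\<^sub>0 \<subset> \<dots> \<subset> W\<^sub>r\<close> of submodules.\<close>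

definition lie_length ::
    "'a ring \<Rightarrow> ('a, 'b) module \<Rightarrow> 'l set \<Rightarrow> ('l \<Rightarrow> 'b \<Rightarrow> 'b) \<Rightarrow> enat" where
  "lie_length A M L act = (SUP C \<in> {C. C \<subseteq> stable_submodules A M L act \<and> finite C \<and> C \<noteq> {} \<and>
     (\<forall>U\<in>C. \<forall>Y\<in>C. U \<subseteq> Y \<or> Y \<subseteq> U)}. enat (card C - 1))"


section \<open>Derivations\<close>

text \<open>
  \<open>K\<close> is the image in \<open>A\<close> of the base field.  Derivations are extensional functions, so that each
  of them is represented once.
\<close>

definition derivations :: "'a set \<Rightarrow> 'a ring \<Rightarrow> ('a \<Rightarrow> 'a) set" where
  "derivations K A = {D \<in> carrier A \<rightarrow>\<^sub>E carrier A.
     (\<forall>a\<in>carrier A. \<forall>b\<in>carrier A. D (a \<oplus>\<^bsub>A\<^esub> b) = D a \<oplus>\<^bsub>A\<^esub> D b) \<and>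
     (\<forall>c\<in>K. \<forall>a\<in>carrier A. D (c \<otimes>\<^bsub>A\<^esub> a) = c \<otimes>\<^bsub>A\<^esub> D a) \<and>
     (\<forall>a\<in>carrier A. \<forall>b\<in>carrier A. D (a \<otimes>\<^bsub>A\<^esub> b) = (D a \<otimes>\<^bsub>A\<^esub> b) \<oplus>\<^bsub>A\<^esub> (a \<otimes>\<^bsub>A\<^esub> D b))}"

definition der_module :: "'a set \<Rightarrow> 'a ring \<Rightarrow> ('a, 'a \<Rightarrow> 'a) module" where
  "der_module K A = mk_module (derivations K A)
     (\<lambda>D E. \<lambda>a\<in>carrier A. D a \<oplus>\<^bsub>A\<^esub> E a) (\<lambda>a\<in>carrier A. \<zero>\<^bsub>A\<^esub>)
     (\<lambda>b D. \<lambda>a\<in>carrier A. b \<otimes>\<^bsub>A\<^esub> D a)"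


section \<open>The polynomial ring and the Stanley-Reisner ideal\<close>

type_synonym ('v, 'k) mpoly = "('v \<Rightarrow>\<^sub>0 nat) \<Rightarrow>\<^sub>0 'k"

abbreviation poly_ring :: "('v, 'k::field) mpoly ring" where
  "poly_ring \<equiv> ring_of_type_algebra"

definition const :: "'k::field \<Rightarrow> ('v, 'k) mpoly" where
  "const c = Poly_Mapping.single 0 c"

definition var :: "'v \<Rightarrow> ('v, 'k::field) mpoly" where
  "var i = Poly_Mapping.single (Poly_Mapping.single i 1) 1"

definition partial :: "'v \<Rightarrow> ('v, 'k::field) mpoly \<Rightarrow> ('v, 'k) mpoly" where
  "partial i p = (\<Sum>m\<in>Poly_Mapping.keys p.
     Poly_Mapping.single (m - Poly_Mapping.single i 1)
       (of_nat (Poly_Mapping.lookup m i) * Poly_Mapping.lookup p m))"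

definition sr_ideal :: "'v::finite set set \<Rightarrow> ('v, 'k::field) mpoly set" where
  "sr_ideal \<Delta> = Idl\<^bsub>poly_ring\<^esub> {\<Prod>i\<in>\<sigma>. var i | \<sigma>. \<sigma> \<notin> \<Delta>}"


section \<open>The Lie algebroid of an ideal, its fibre Lie algebra, and their actions\<close>

text \<open>In this section \<open>I\<close> is an ideal of the polynomial ring, e.g. a Stanley-Reisner ideal.\<close>

definition TBI :: "('v, 'k::field) mpoly set \<Rightarrow> (('v, 'k) mpoly, ('v, 'k) mpoly \<Rightarrow> ('v, 'k) mpoly) module"
  where
  "TBI I = (der_module (range const) poly_ring)
     \<lparr>carrier := {\<delta> \<in> derivations (range const) poly_ring. \<delta> ` I \<subseteq> I}\<rparr>"

definition Nset :: "('v, 'k::field) mpoly set \<Rightarrow> 'v set" where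
  "Nset I = {i. partial i \<notin> carrier (TBI I)}"

definition Jm :: "('v, 'k::field) mpoly set \<Rightarrow> ('v, 'k) mpoly set" where
  "Jm I = Idl\<^bsub>poly_ring\<^esub> (var ` Nset I)"

definition Rring :: "('v, 'k::field) mpoly set \<Rightarrow> ('v, 'k) mpoly set ring" where
  "Rring I = poly_ring Quot Jm I"

definition to_R :: "('v, 'k::field) mpoly set \<Rightarrow> ('v, 'k) mpoly \<Rightarrow> ('v, 'k) mpoly set" where
  "to_R I b = Jm I +>\<^bsub>poly_ring\<^esub> b"

definition TR :: "('v, 'k::field) mpoly set \<Rightarrow>
    (('v, 'k) mpoly set, ('v, 'k) mpoly set \<Rightarrow> ('v, 'k) mpoly set) module" where
  "TR I = der_module (to_R I ` range const) (Rring I)"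

text \<open>The field \<open>k\<close> as the residue ring \<open>B / (x\<^sub>1, \<dots>, x\<^sub>n)\<close>, and the projection \<open>R \<rightarrow> k\<close>.\<close>

definition max_ideal :: "('v, 'k::field) mpoly set" where
  "max_ideal = Idl\<^bsub>poly_ring\<^esub> (range var)"

definition kring :: "('v, 'k::field) mpoly set ring" where
  "kring = poly_ring Quot max_ideal"

definition R_to_k :: "('v, 'k::field) mpoly set \<Rightarrow> ('v, 'k) mpoly set" where
  "R_to_k U = max_ideal <+>\<^bsub>poly_ring\<^esub> U"

definition sr_module :: "('v, 'k::field) mpoly set \<Rightarrow> (('v, 'k) mpoly, ('v, 'k) mpoly set) module"
  where
  "sr_module I = quot_module (self_module poly_ring) I"

definition JnM :: "('v, 'k::field) mpoly set \<Rightarrow> nat \<Rightarrow> ('v, 'k) mpoly set set" where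
  "JnM I n = ideal_smult poly_ring (sr_module I) (Jm I [^]\<^bsub>ideals_set poly_ring\<^esub> n)"

definition Gr :: "('v, 'k::field) mpoly set \<Rightarrow> nat \<Rightarrow> (('v, 'k) mpoly, ('v, 'k) mpoly set set) module"
  where
  "Gr I n = quot_module ((sr_module I)\<lparr>carrier := JnM I n\<rparr>) (JnM I (Suc n))"

definition act_Gr :: "('v, 'k::field) mpoly set \<Rightarrow> nat \<Rightarrow> (('v, 'k) mpoly \<Rightarrow> ('v, 'k) mpoly) \<Rightarrow>
    ('v, 'k) mpoly set set \<Rightarrow> ('v, 'k) mpoly set set" where
  "act_Gr I n \<delta> = induced (sr_module I) (JnM I (Suc n)) (induced poly_ring I \<delta>)"

definition length_T :: "('v, 'k::field) mpoly set \<Rightarrow> nat \<Rightarrow> enat" where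
  "length_T I n = lie_length poly_ring (Gr I n) (carrier (TBI I)) (act_Gr I n)"

type_synonym ('v, 'k) g_elt =
  "((('v, 'k) mpoly set \<times> (('v, 'k) mpoly \<Rightarrow> ('v, 'k) mpoly)) \<Rightarrow>\<^sub>0 int) set"

definition RT :: "('v, 'k::field) mpoly set \<Rightarrow> (('v, 'k) mpoly set, ('v, 'k) g_elt) module" where
  "RT I = base_change (to_R I) poly_ring (Rring I) (TBI I)"

text \<open>The canonical map \<open>R \<otimes>\<^sub>B T\<^sub>B(I) \<rightarrow> T\<^sub>R\<close>, \<open>r \<otimes> \<delta> \<mapsto> r \<delta>'\<close> with \<open>\<delta>'\<close> induced by \<open>\<delta>\<close> on \<open>R\<close>.\<close>

definition RT_to_TR :: "('v, 'k::field) mpoly set \<Rightarrow> ('v, 'k) g_elt \<Rightarrow>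
    ('v, 'k) mpoly set \<Rightarrow> ('v, 'k) mpoly set" where
  "RT_to_TR I = tensor_lift (TR I)
     (\<lambda>(r, \<delta>). r \<odot>\<^bsub>TR I\<^esub> (\<lambda>U\<in>carrier (Rring I). induced poly_ring (Jm I) \<delta> U))"

definition gLie :: "('v, 'k::field) mpoly set \<Rightarrow> (('v, 'k) mpoly set, ('v, 'k) g_elt) module" where
  "gLie I = (RT I)\<lparr>carrier := {\<gamma> \<in> carrier (RT I). RT_to_TR I \<gamma> = \<zero>\<^bsub>TR I\<^esub>}\<rparr>"

definition Gr_R :: "('v, 'k::field) mpoly set \<Rightarrow> nat \<Rightarrow>
    (('v, 'k) mpoly set, ('v, 'k) mpoly set set) module" where
  "Gr_R I n = over_quotient (Gr I n)"

text \<open>\<open>(\<Sum> r \<otimes> \<delta>) \<cdot> y = \<Sum> r (\<delta> \<cdot> y)\<close>\<close>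

definition act_g :: "('v, 'k::field) mpoly set \<Rightarrow> nat \<Rightarrow> ('v, 'k) g_elt \<Rightarrow>
    ('v, 'k) mpoly set set \<Rightarrow> ('v, 'k) mpoly set set" where
  "act_g I n \<gamma> y = tensor_lift (Gr_R I n) (\<lambda>(r, \<delta>). r \<odot>\<^bsub>Gr_R I n\<^esub> act_Gr I n \<delta> y) \<gamma>"

definition gk :: "('v, 'k::field) mpoly set \<Rightarrow>
    (('v, 'k) mpoly set, ((('v, 'k) mpoly set \<times> ('v, 'k) g_elt) \<Rightarrow>\<^sub>0 int) set) module" where
  "gk I = base_change R_to_k (Rring I) kring (gLie I)"

definition Gr_k :: "('v, 'k::field) mpoly set \<Rightarrow> nat \<Rightarrow>
    (('v, 'k) mpoly set, ((('v, 'k) mpoly set \<times> ('v, 'k) mpoly set set) \<Rightarrow>\<^sub>0 int) set) module"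
  where
  "Gr_k I n = base_change R_to_k (Rring I) kring (Gr_R I n)"

text \<open>\<open>(c \<otimes> \<gamma>) \<cdot> (d \<otimes> y) = c d \<otimes> \<gamma> \<cdot> y\<close>, extended biadditively\<close>

definition act_gk :: "('v, 'k::field) mpoly set \<Rightarrow> nat \<Rightarrow>
    ((('v, 'k) mpoly set \<times> ('v, 'k) g_elt) \<Rightarrow>\<^sub>0 int) set \<Rightarrow>
    ((('v, 'k) mpoly set \<times> ('v, 'k) mpoly set set) \<Rightarrow>\<^sub>0 int) set \<Rightarrow>
    ((('v, 'k) mpoly set \<times> ('v, 'k) mpoly set set) \<Rightarrow>\<^sub>0 int) set" where
  "act_gk I n \<xi> w = tensor_lift (Gr_k I n) (\<lambda>(c, \<gamma>).
     tensor_lift (Gr_k I n) (\<lambda>(d, y).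
       pure_tensor R_to_k (Rring I) kring (Gr_R I n) (c \<otimes>\<^bsub>kring\<^esub> d) (act_g I n \<gamma> y)) w) \<xi>"

definition length_gk :: "('v, 'k::field) mpoly set \<Rightarrow> nat \<Rightarrow> enat" where
  "length_gk I n = lie_length kring (Gr_k I n) (carrier (gk I)) (act_gk I n)"

definition length_series :: "(nat \<Rightarrow> enat) \<Rightarrow> rat fps" where
  "length_series l = Abs_fps (\<lambda>n. of_nat (the_enat (l n)))"

abbreviation H_Lie :: "('v, 'k::field) mpoly set \<Rightarrow> rat fps" where
  "H_Lie I \<equiv> length_series (length_T I)"

end

theory Submission imports Defs
begin

text \<open>
  Write \<open>x\<^sup>m\<close> for the monomial with exponent vector \<open>m\<close>, and let the degree of \<open>m\<close> be its total
  degree in the variables \<open>x\<^sub>i\<close> with \<open>i\<close> outside some facet; these \<open>i\<close> form the set \<open>N\<close>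
  (\<open>Nset_eq\<close>), \<open>J\<close> is the ideal generated by these \<open>x\<^sub>i\<close>, and the remaining vertices are cone
  points.  The classes of the monomials of degree
  \<open>n\<close> whose support is a face form a \<open>k\<close>-basis of the graded piece of degree \<open>n\<close>; those of them that
  involve no cone point form a basis of its fibre over \<open>k\<close>.  The claim is that both lengths equal the
  number of strata multidegrees (\<open>sdeg\<close>: one partial degree for each stratum) of such monomials.

  A derivation \<open>\<delta>\<close> that preserves the ideal preserves every prime \<open>(x\<^sub>i | i \<notin> F)\<close>, \<open>F\<close> a facet: for
  \<open>j \<notin> F\<close>, every monomial of \<open>\<delta> (x\<^sub>j)\<close> involves a variable outside \<open>F\<close> (\<open>TBI_facet\<close>).  Conversely
  \<open>x\<^sub>i \<partial>\<^sub>j\<close> preserves the ideal if every facet through \<open>i\<close> contains \<open>j\<close> (\<open>euler_partial_TBI\<close>).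
  Hence on the part of degree \<open>n\<close> a derivation can, apart from changing the cone variables, only
  exchange an \<open>x\<^sub>j\<close>, \<open>j \<in> N\<close>, for an \<open>x\<^sub>i\<close> such that the facets through \<open>i\<close> are among those through
  \<open>j\<close>.  Such an exchange either stays inside a stratum, and then the multidegree does not change,
  or it strictly lowers the weight \<open>\<Sum> m\<^sub>i |{F | i \<in> F}|\<close> (sum over \<open>i \<in> N\<close>), which is a function of the multidegree
  (\<open>TBI_step\<close>).

  In characteristic 0 the operators \<open>x\<^sub>i \<partial>\<^sub>i\<close> split every stable submodule into monomials
  (\<open>separate\<close>), the exchanges inside strata connect all monomials of the same multidegree
  (\<open>exchange_connected\<close>), and differentiation and multiplication by cone variables do the rest.  So a
  stable submodule is the span of all monomials with multidegree in some set
  (\<open>preim_eq_mspan\<close>), which bounds the length from above.  Listing the multidegrees by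
  increasing weight gives stable submodules that increase by one multidegree at a time
  (\<open>mspan_stable\<close>), which bounds the length from below.

  To run this argument for both modules at once, each of them is presented as the image of the
  polynomials that lie in \<open>J\<^sup>n + I\<close> under an additive map.  Since \<open>B \<rightarrow> R \<rightarrow> k\<close> is surjective, every
  element of the fibre Lie algebra is \<open>1 \<otimes> (1 \<otimes> \<delta>)\<close> with \<open>\<delta>\<close> in the Lie algebroid and
  \<open>\<delta> (B) \<subseteq> J\<close> (\<open>carrier_gk\<close>), and it acts on the class of \<open>f\<close> by \<open>f \<mapsto> \<delta> f\<close>
  (\<open>act_gk_fibre_lie_class\<close>).

  If there are no cone points, the multidegrees of degree \<open>n\<close> are the functions on the strata with
  sum \<open>n\<close> whose support is an essential face (\<open>sdegs_eq_compositions\<close>); the functions with a given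
  support of size \<open>i\<close> have generating series \<open>(t / (1 - t))\<^sup>i\<close>.  Finally, choosing one vertex in each
  stratum that a face meets gives a face with the same essential face and as many vertices as that
  has strata, whence the inequality between the face numbers.
\<close>

section \<open>Strata and the essential complex\<close>

text \<open>The facets through a vertex.\<close>

definition facets_at :: "'v set set \<Rightarrow> 'v \<Rightarrow> 'v set set" where
  "facets_at \<Delta> v = {F \<in> facets \<Delta>. v \<in> F}"

text \<open>The stratum of a vertex: the vertices that lie in exactly the same facets.\<close>

definition stratum_of :: "'v set set \<Rightarrow> 'v \<Rightarrow> 'v set" where
  "stratum_of \<Delta> v = {u. facets_at \<Delta> u = facets_at \<Delta> v}"

lemma self_in_stratum_of [simp]: "v \<in> stratum_of \<Delta> v"
  by (simp add: stratum_of_def)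

lemma stratum_of_eq_iff: "stratum_of \<Delta> u = stratum_of \<Delta> v \<longleftrightarrow> facets_at \<Delta> u = facets_at \<Delta> v"
  by (auto simp: stratum_of_def)

lemma in_stratum_of_iff: "u \<in> stratum_of \<Delta> v \<longleftrightarrow> stratum_of \<Delta> u = stratum_of \<Delta> v"
  by (auto simp: stratum_of_def)

lemma stratum_eq_stratum_of:
  assumes "L \<subseteq> facets \<Delta>" "v \<in> stratum \<Delta> L"
  shows "stratum \<Delta> L = stratum_of \<Delta> v"
proof -
  have *: "u \<in> stratum \<Delta> L \<longleftrightarrow> facets_at \<Delta> u = {G \<in> facets \<Delta>. \<Inter>L \<subseteq> G}" for u
    using assms(1) unfolding stratum_def facets_at_def by blast
  then have v: "facets_at \<Delta> v = {G \<in> facets \<Delta>. \<Inter>L \<subseteq> G}" using assms(2) by blast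
  show ?thesis
    unfolding stratum_of_def v using * by blast
qed

lemma strata_eq: "strata \<Delta> = range (stratum_of \<Delta>)"
proof
  show "strata \<Delta> \<subseteq> range (stratum_of \<Delta>)"
  proof
    fix \<omega> assume "\<omega> \<in> strata \<Delta>"
    then obtain L v where "L \<subseteq> facets \<Delta>" "\<omega> = stratum \<Delta> L" "v \<in> \<omega>"
      by (auto simp: strata_def)
    then show "\<omega> \<in> range (stratum_of \<Delta>)"
      using stratum_eq_stratum_of by (metis rangeI)
  qed
  have "stratum_of \<Delta> v \<in> strata \<Delta>" for v
  proof -
    have L: "facets_at \<Delta> v \<subseteq> facets \<Delta>" "v \<in> stratum \<Delta> (facets_at \<Delta> v)"
      by (auto simp: facets_at_def stratum_def)
    moreover have "stratum \<Delta> (facets_at \<Delta> v) = stratum_of \<Delta> v"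
      by (rule stratum_eq_stratum_of[OF L])
    moreover have "stratum_of \<Delta> v \<noteq> {}" using self_in_stratum_of[of v \<Delta>] by (rule_tac notI) simp
    ultimately show ?thesis
      unfolding strata_def by auto
  qed
  then show "range (stratum_of \<Delta>) \<subseteq> strata \<Delta>" by auto
qed

lemma strata_disjoint:
  assumes "\<omega> \<in> strata \<Delta>" "\<omega>' \<in> strata \<Delta>" "v \<in> \<omega>" "v \<in> \<omega>'"
  shows "\<omega> = \<omega>'"
  using assms by (auto simp: strata_eq in_stratum_of_iff)

lemma essential_face_eq: "essential_face \<Delta> \<sigma> = stratum_of \<Delta> ` \<sigma>"
proof -
  have "\<sigma> \<inter> stratum_of \<Delta> v \<noteq> {} \<longleftrightarrow> stratum_of \<Delta> v \<in> stratum_of \<Delta> ` \<sigma>" for v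
    by (auto simp: in_stratum_of_iff image_iff disjoint_iff)
  then show ?thesis
    unfolding essential_face_def strata_eq by blast
qed

lemma face_iff_facet:
  fixes \<Delta> :: "'v::finite set set"
  assumes "simplicial_complex \<Delta>"
  shows "\<sigma> \<in> \<Delta> \<longleftrightarrow> (\<exists>F\<in>facets \<Delta>. \<sigma> \<subseteq> F)"
proof
  assume "\<sigma> \<in> \<Delta>"
  define A where "A = {\<tau>\<in>\<Delta>. \<sigma> \<subseteq> \<tau>}"
  have "finite A" "A \<noteq> {}" using \<open>\<sigma> \<in> \<Delta>\<close> by (auto simp: A_def)
  then obtain F where F: "F \<in> A" "\<And>G. G \<in> A \<Longrightarrow> F \<subseteq> G \<Longrightarrow> G = F"
    using finite_has_maximal[of A] by metis
  then have "F \<in> facets \<Delta>"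
    unfolding facets_def A_def by auto
  then show "\<exists>F\<in>facets \<Delta>. \<sigma> \<subseteq> F" using F by (auto simp: A_def)
next
  show "\<exists>F\<in>facets \<Delta>. \<sigma> \<subseteq> F \<Longrightarrow> \<sigma> \<in> \<Delta>"
    using assms unfolding simplicial_complex_def facets_def by blast
qed

lemma subface: "simplicial_complex \<Delta> \<Longrightarrow> \<sigma> \<in> \<Delta> \<Longrightarrow> \<tau> \<subseteq> \<sigma> \<Longrightarrow> \<tau> \<in> \<Delta>"
  by (auto simp: simplicial_complex_def)

lemma essential_face_transversal:
  assumes "simplicial_complex \<Delta>" "\<sigma> \<in> \<Delta>"
  obtains \<tau> where "\<tau> \<in> \<Delta>" "\<tau> \<subseteq> \<sigma>" "inj_on (stratum_of \<Delta>) \<tau>"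
    "essential_face \<Delta> \<tau> = essential_face \<Delta> \<sigma>"
proof -
  obtain \<tau> where "\<tau> \<subseteq> \<sigma>" "inj_on (stratum_of \<Delta>) \<tau>" "stratum_of \<Delta> ` \<sigma> = stratum_of \<Delta> ` \<tau>"
    using subset_image_inj[of "stratum_of \<Delta> ` \<sigma>" "stratum_of \<Delta>" \<sigma>] by auto
  with assms that subface[OF assms] show thesis
    unfolding essential_face_eq by metis
qed

lemma face_number_essential_le:
  fixes \<Delta> :: "'v::finite set set"
  assumes "simplicial_complex \<Delta>"
  shows "face_number (essential_complex \<Delta>) i \<le> face_number \<Delta> i"
proof -
  have "{S \<in> essential_complex \<Delta>. int (card S) - 1 = i}
      \<subseteq> essential_face \<Delta> ` {\<sigma> \<in> \<Delta>. int (card \<sigma>) - 1 = i}"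
  proof clarify
    fix S assume "S \<in> essential_complex \<Delta>" "i = int (card S) - 1"
    then obtain \<sigma> where \<sigma>: "\<sigma> \<in> \<Delta>" "S = essential_face \<Delta> \<sigma>"
      by (auto simp: essential_complex_def)
    obtain \<tau> where \<tau>: "\<tau> \<in> \<Delta>" "inj_on (stratum_of \<Delta>) \<tau>" "essential_face \<Delta> \<tau> = S"
      using essential_face_transversal[OF assms \<sigma>(1)] \<sigma>(2) by metis
    then have "card \<tau> = card S"
      by (metis essential_face_eq card_image)
    with \<tau> show "S \<in> essential_face \<Delta> ` {\<sigma> \<in> \<Delta>. int (card \<sigma>) - 1 = int (card S) - 1}"
      by auto
  qed
  then have "card {S \<in> essential_complex \<Delta>. int (card S) - 1 = i}
      \<le> card (essential_face \<Delta> ` {\<sigma> \<in> \<Delta>. int (card \<sigma>) - 1 = i})"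
    by (intro card_mono) auto
  also have "\<dots> \<le> card {\<sigma> \<in> \<Delta>. int (card \<sigma>) - 1 = i}"
    by (intro card_image_le) auto
  finally show ?thesis by (simp add: face_number_def)
qed

section \<open>Multidegrees by strata\<close>

text \<open>
  The vertices that are not cone points, i.e. that lie outside some facet.  They turn out to be the
  indices in \<^const>\<open>Nset\<close>.
\<close>

definition noncone :: "'v set set \<Rightarrow> 'v set" where
  "noncone \<Delta> = {i. \<exists>F\<in>facets \<Delta>. i \<notin> F}"

text \<open>The degree of an exponent vector in the variables of the vertices that are not cone points.\<close>

definition mdeg :: "'v::finite set set \<Rightarrow> ('v \<Rightarrow>\<^sub>0 nat) \<Rightarrow> nat" where
  "mdeg \<Delta> m = (\<Sum>i\<in>noncone \<Delta>. Poly_Mapping.lookup m i)"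

text \<open>
  The multidegree of an exponent vector: its partial degree on each stratum.  The cone points, which
  form a single stratum if there are any, do not count; the value on sets that are not strata is 0.
\<close>

definition sdeg :: "'v::finite set set \<Rightarrow> ('v \<Rightarrow>\<^sub>0 nat) \<Rightarrow> 'v set \<Rightarrow> nat" where
  "sdeg \<Delta> m \<omega> = (if \<omega> \<in> strata \<Delta> then \<Sum>i\<in>\<omega> \<inter> noncone \<Delta>. Poly_Mapping.lookup m i else 0)"

text \<open>The multidegrees of the monomials of degree \<open>n\<close> supported on faces.\<close>

definition sdegs :: "'v::finite set set \<Rightarrow> nat \<Rightarrow> ('v set \<Rightarrow> nat) set" where
  "sdegs \<Delta> n = sdeg \<Delta> ` {m. mdeg \<Delta> m = n \<and> Poly_Mapping.keys m \<in> \<Delta>}"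

lemma sum_strata:
  fixes \<Delta> :: "'v::finite set set"
  shows "(\<Sum>\<omega>\<in>strata \<Delta>. \<Sum>i\<in>\<omega> \<inter> A. f i) = (\<Sum>i\<in>A. f i)"
proof -
  have "(\<Sum>i\<in>A. f i) = sum f (\<Union>\<omega>\<in>strata \<Delta>. \<omega> \<inter> A)"
    using self_in_stratum_of by (intro sum.cong) (fastforce simp: strata_eq)+
  also have "\<dots> = (\<Sum>\<omega>\<in>strata \<Delta>. \<Sum>i\<in>\<omega> \<inter> A. f i)"
    by (rule sum.UNION_disjoint) (auto dest: strata_disjoint)
  finally show ?thesis by simp
qed

lemma sum_sdeg: "(\<Sum>\<omega>\<in>UNIV. sdeg \<Delta> m \<omega>) = mdeg \<Delta> m"
proof -
  have "(\<Sum>\<omega>\<in>UNIV. sdeg \<Delta> m \<omega>) = (\<Sum>\<omega>\<in>strata \<Delta>. \<Sum>i\<in>\<omega> \<inter> noncone \<Delta>. Poly_Mapping.lookup m i)"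
    by (simp add: sdeg_def sum.If_cases)
  then show ?thesis by (simp add: sum_strata mdeg_def)
qed

lemma finite_sdegs: "finite (sdegs \<Delta> n)"
proof -
  have "sdegs \<Delta> n \<subseteq> PiE UNIV (\<lambda>_. {..n})"
  proof
    fix q assume "q \<in> sdegs \<Delta> n"
    then have "(\<Sum>\<omega>\<in>UNIV. q \<omega>) = n"
      by (auto simp: sdegs_def sum_sdeg)
    then have "q \<omega> \<le> n" for \<omega>
      using member_le_sum[of \<omega> UNIV q] by simp
    then show "q \<in> PiE UNIV (\<lambda>_. {..n})" by auto
  qed
  then show ?thesis
    by (rule finite_subset) (intro finite_PiE; simp)
qed

text \<open>The functions with support exactly \<open>S\<close> and sum \<open>n\<close>.\<close>

definition exact_compositions :: "'a set \<Rightarrow> nat \<Rightarrow> ('a \<Rightarrow> nat) set" where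
  "exact_compositions S n = {q. {a. q a \<noteq> 0} = S \<and> sum q S = n}"

lemma sum_supp: fixes q :: "'a::finite \<Rightarrow> nat" shows "sum q {a. 0 < q a} = sum q UNIV"
  by (rule sum.mono_neutral_left) auto

lemma finite_exact_compositions: "finite S \<Longrightarrow> finite (exact_compositions S n)"
proof -
  assume S: "finite S"
  have "exact_compositions S n \<subseteq> {q. \<forall>a. (a \<in> S \<longrightarrow> q a \<in> {..n}) \<and> (a \<notin> S \<longrightarrow> q a = 0)}"
    using S by (auto simp: exact_compositions_def intro!: member_le_sum)
  then show ?thesis
    by (rule finite_subset) (rule finite_set_of_finite_funs[OF S finite_atMost])
qed

lemma card_exact_compositions_insert:
  assumes "finite S" "s \<notin> S"
  shows "card (exact_compositions (insert s S) n) = (\<Sum>k=1..n. card (exact_compositions S (n - k)))"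
proof -
  let ?f = "\<lambda>k q. q(s := k)"
  have eq: "exact_compositions (insert s S) n = (\<Union>k\<in>{1..n}. ?f k ` exact_compositions S (n - k))"
  proof (intro equalityI subsetI)
    fix q assume q: "q \<in> exact_compositions (insert s S) n"
    then have supp: "{a. q a \<noteq> 0} = insert s S" and n: "q s + sum q S = n"
      using assms by (auto simp: exact_compositions_def)
    have "sum (q(s := 0)) S = sum q S" using assms(2) by (intro sum.cong) auto
    moreover have "{a. (q(s := 0)) a \<noteq> 0} = S" using supp assms(2) by auto
    ultimately have "q(s := 0) \<in> exact_compositions S (n - q s)"
      using n by (simp add: exact_compositions_def)
    moreover have "q s \<noteq> 0" using supp by blast
    then have "q s \<in> {1..n}" using n by simp
    moreover have "q = ?f (q s) (q(s := 0))" by auto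
    ultimately show "q \<in> (\<Union>k\<in>{1..n}. ?f k ` exact_compositions S (n - k))" by blast
  next
    fix q assume "q \<in> (\<Union>k\<in>{1..n}. ?f k ` exact_compositions S (n - k))"
    then obtain k p where k: "1 \<le> k" "k \<le> n" and p: "{a. p a \<noteq> 0} = S" "sum p S = n - k"
      and q: "q = p(s := k)"
      by (auto simp: exact_compositions_def)
    have "sum q S = sum p S" using assms(2) q by (intro sum.cong) auto
    then show "q \<in> exact_compositions (insert s S) n"
      using k p q assms by (auto simp: exact_compositions_def)
  qed
  have inj: "inj_on (?f k) (exact_compositions S j)" for k j
  proof (rule inj_onI)
    fix p q assume pq: "p \<in> exact_compositions S j" "q \<in> exact_compositions S j" "p(s := k) = q(s := k)"
    then have "p s = 0" "q s = 0" using assms(2) by (auto simp: exact_compositions_def)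
    then show "p = q" using pq(3) by (metis fun_upd_triv fun_upd_upd)
  qed
  have "card (exact_compositions (insert s S) n)
      = (\<Sum>k\<in>{1..n}. card (?f k ` exact_compositions S (n - k)))"
    unfolding eq
    by (rule card_UN_disjoint) (auto simp: finite_exact_compositions assms dest!: fun_cong[where x = s])
  then show ?thesis by (simp add: card_image inj)
qed

lemma fps_X_div_nth: "(fps_X / (1 - fps_X) :: rat fps) $ k = (if k = 0 then 0 else 1)"
proof -
  have "inverse (1 - fps_X :: rat fps) = Abs_fps (\<lambda>n. 1)"
    by (subst fps_inverse_gp'[symmetric], rule fps_inverse_idempotent) simp
  then have "(fps_X / (1 - fps_X) :: rat fps) = fps_X * Abs_fps (\<lambda>n. 1)"
    by (simp add: fps_divide_unit)
  then show ?thesis by simp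
qed

lemma series_exact_compositions:
  assumes "finite S"
  shows "Abs_fps (\<lambda>n. of_nat (card (exact_compositions S n))) = (fps_X / (1 - fps_X) :: rat fps) ^ card S"
  using assms
proof (induction S)
  case empty
  have "{q :: 'a \<Rightarrow> nat. {a. q a \<noteq> 0} = {} \<and> n = 0} = (if n = 0 then {\<lambda>_. 0} else {})" for n :: nat
    by auto
  then have "exact_compositions ({} :: 'a set) n = (if n = 0 then {\<lambda>_. 0} else {})" for n
    by (simp add: exact_compositions_def eq_commute[of 0])
  then show ?case by (intro fps_ext) simp
next
  case (insert s S)
  have "Abs_fps (\<lambda>n. of_nat (card (exact_compositions (insert s S) n))) $ n
      = (fps_X / (1 - fps_X) * (fps_X / (1 - fps_X)) ^ card S :: rat fps) $ n" for n
  proof -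
    have "(fps_X / (1 - fps_X) * (fps_X / (1 - fps_X)) ^ card S :: rat fps) $ n
      = (\<Sum>k=0..n. (if k = 0 then 0 else 1) * of_nat (card (exact_compositions S (n - k))))"
      unfolding insert.IH[symmetric] by (simp add: fps_mult_nth fps_X_div_nth)
    also have "\<dots> = (\<Sum>k=1..n. of_nat (card (exact_compositions S (n - k))))"
      by (rule sum.mono_neutral_cong_right) auto
    finally show ?thesis
      using insert.hyps by (simp add: card_exact_compositions_insert)
  qed
  then show ?case using insert.hyps by (simp add: fps_ext)
qed

text \<open>A vertex chosen in each stratum lifts a function on an essential face to an exponent vector.\<close>

lemma sdegs_eq_compositions:
  fixes \<Delta> :: "'v::finite set set"
  assumes \<Delta>: "simplicial_complex \<Delta>" and "\<Inter>(facets \<Delta>) = {}"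
  shows "sdegs \<Delta> n = (\<Union>S\<in>essential_complex \<Delta>. exact_compositions S n)"
proof -
  have mv: "noncone \<Delta> = UNIV" using assms(2) by (auto simp: noncone_def)
  have supp: "{\<omega>. sdeg \<Delta> m \<omega> \<noteq> 0} = essential_face \<Delta> (Poly_Mapping.keys m)" for m
  proof -
    have "sdeg \<Delta> m \<omega> \<noteq> 0 \<longleftrightarrow> \<omega> \<in> strata \<Delta> \<and> Poly_Mapping.keys m \<inter> \<omega> \<noteq> {}" for \<omega>
      by (simp add: sdeg_def mv del: neq0_conv) (auto simp: in_keys_iff simp del: neq0_conv)
    then show ?thesis by (simp add: essential_face_def del: neq0_conv)
  qed
  show ?thesis
  proof (intro equalityI subsetI)
    fix q assume "q \<in> sdegs \<Delta> n"
    then obtain m where m: "q = sdeg \<Delta> m" "mdeg \<Delta> m = n" "Poly_Mapping.keys m \<in> \<Delta>"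
      by (auto simp: sdegs_def)
    then have "{\<omega>. q \<omega> \<noteq> 0} \<in> essential_complex \<Delta>"
      unfolding m(1) supp by (auto simp: essential_complex_def)
    moreover have "sum q {\<omega>. q \<omega> \<noteq> 0} = n"
      using m sum_sdeg[of \<Delta> m] by (simp add: sum_supp)
    ultimately show "q \<in> (\<Union>S\<in>essential_complex \<Delta>. exact_compositions S n)"
      by (auto simp: exact_compositions_def)
  next
    fix q assume "q \<in> (\<Union>S\<in>essential_complex \<Delta>. exact_compositions S n)"
    then obtain \<sigma> where \<sigma>: "\<sigma> \<in> \<Delta>" "{\<omega>. q \<omega> \<noteq> 0} = essential_face \<Delta> \<sigma>"
      and n: "sum q {\<omega>. q \<omega> \<noteq> 0} = n"
      by (auto simp: exact_compositions_def essential_complex_def)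
    obtain \<tau> where \<tau>: "\<tau> \<in> \<Delta>" "inj_on (stratum_of \<Delta>) \<tau>" "{\<omega>. q \<omega> \<noteq> 0} = stratum_of \<Delta> ` \<tau>"
      using essential_face_transversal[OF \<Delta> \<sigma>(1)] \<sigma>(2) essential_face_eq by metis
    define m where "m = Abs_poly_mapping (\<lambda>v. if v \<in> \<tau> then q (stratum_of \<Delta> v) else 0)"
    have m: "Poly_Mapping.lookup m v = (if v \<in> \<tau> then q (stratum_of \<Delta> v) else 0)" for v
      by (simp add: m_def)
    have "q (stratum_of \<Delta> v) \<noteq> 0" if "v \<in> \<tau>" for v using \<tau>(3) that by blast
    then have keys: "Poly_Mapping.keys m = \<tau>" by (auto simp: in_keys_iff m split: if_splits)
    have "sdeg \<Delta> m \<omega> = q \<omega>" for \<omega>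
    proof (cases "\<omega> \<in> stratum_of \<Delta> ` \<tau>")
      case True
      then obtain v where v: "v \<in> \<tau>" "\<omega> = stratum_of \<Delta> v" by auto
      have "(\<Sum>i\<in>\<omega>. Poly_Mapping.lookup m i) = (\<Sum>i\<in>{v}. Poly_Mapping.lookup m i)"
        using v \<tau>(2) by (intro sum.mono_neutral_right) (auto simp: m in_stratum_of_iff inj_on_def)
      then show ?thesis using v by (simp add: sdeg_def mv m strata_eq)
    next
      case False
      then have "\<omega> \<notin> {\<omega>. q \<omega> \<noteq> 0}" unfolding \<tau>(3) .
      then have "q \<omega> = 0" by simp
      moreover have "\<omega> \<notin> {\<omega>. sdeg \<Delta> m \<omega> \<noteq> 0}"
        using False unfolding supp essential_face_eq keys .
      then have "sdeg \<Delta> m \<omega> = 0" by simp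
      ultimately show ?thesis by simp
    qed
    then have "sdeg \<Delta> m = q" by auto
    moreover have "mdeg \<Delta> m = n"
      using sum_sdeg[of \<Delta> m] n calculation by (simp add: sum_supp)
    ultimately show "q \<in> sdegs \<Delta> n"
      using keys \<tau>(1) by (auto simp: sdegs_def)
  qed
qed

lemma length_series_sdegs:
  fixes \<Delta> :: "'v::finite set set"
  assumes \<Delta>: "simplicial_complex \<Delta>" and "\<Inter>(facets \<Delta>) = {}"
  defines "r \<equiv> card (strata \<Delta>)"
  shows "Abs_fps (\<lambda>n. of_nat (card (sdegs \<Delta> n))) = (1 / (1 - fps_X) ^ r *
      (\<Sum>i\<le>r. of_nat (face_number (essential_complex \<Delta>) (int i - 1)) *
            fps_X ^ i * (1 - fps_X) ^ (r - i)) :: rat fps)"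
proof -
  let ?E = "essential_complex \<Delta>" and ?y = "fps_X / (1 - fps_X) :: rat fps"
  let ?u = "1 - fps_X :: rat fps"
  have u1: "?u $ 0 \<noteq> 0" by simp
  moreover have "?u \<noteq> 0" using u1 by (metis fps_zero_nth)
  ultimately have u: "?u $ 0 \<noteq> 0" "?u \<noteq> 0" by blast+
  have card: "card (sdegs \<Delta> n) = (\<Sum>S\<in>?E. card (exact_compositions S n))" for n
    unfolding sdegs_eq_compositions[OF assms(1,2)]
  proof (rule card_UN_disjoint)
    show "\<forall>S\<in>?E. finite (exact_compositions S n)" by (simp add: finite_exact_compositions)
    show "\<forall>S\<in>?E. \<forall>T\<in>?E. S \<noteq> T \<longrightarrow> exact_compositions S n \<inter> exact_compositions T n = {}"
      by (auto simp: exact_compositions_def simp del: neq0_conv)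
  qed simp
  have "Abs_fps (\<lambda>n. of_nat (card (sdegs \<Delta> n))) = (\<Sum>S\<in>?E. ?y ^ card S)"
    by (simp add: series_exact_compositions[symmetric] card fps_sum_nth fps_eq_iff)
  also have "\<dots> = (\<Sum>i\<le>r. \<Sum>S\<in>{S\<in>?E. card S = i}. ?y ^ card S)"
  proof (rule sum.group[symmetric])
    show "card ` ?E \<subseteq> {..r}"
      by (auto simp: essential_complex_def essential_face_def r_def intro!: card_mono)
  qed auto
  also have "\<dots> = (\<Sum>i\<le>r. of_nat (face_number ?E (int i - 1)) * ?y ^ i)"
    by (simp add: face_number_def)
  also have "\<dots> = (\<Sum>i\<le>r. 1 / ?u ^ r * (of_nat (face_number ?E (int i - 1)) * fps_X ^ i * ?u ^ (r - i)))"
  proof (rule sum.cong, goal_cases)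
    case (2 i)
    have inv: "inverse ?u * ?u = 1" using u(1) by (simp add: inverse_mult_eq_1)
    have "inverse ?u ^ r * ?u ^ (r - i) = inverse ?u ^ i * (inverse ?u * ?u) ^ (r - i)"
      using 2 by (simp add: power_mult_distrib power_add[symmetric] mult.assoc[symmetric])
    then have "inverse ?u ^ r * ?u ^ (r - i) = inverse ?u ^ i" by (simp add: inv)
    moreover have "1 / ?u ^ r = inverse ?u ^ r"
      using u by (simp add: fps_divide_unit fps_inverse_power)
    moreover have "?y = fps_X * inverse ?u" using u by (simp add: fps_divide_unit)
    ultimately show ?case
      by (simp add: power_mult_distrib mult.assoc mult.left_commute[of "inverse ?u ^ r"])
  qed auto
  finally show ?thesis by (simp add: sum_distrib_left)
qed

section \<open>Polynomials as finite sums of monomials\<close>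

abbreviation lookup :: "('a \<Rightarrow>\<^sub>0 'b::zero) \<Rightarrow> 'a \<Rightarrow> 'b" where "lookup \<equiv> Poly_Mapping.lookup"
abbreviation keys :: "('a \<Rightarrow>\<^sub>0 'b::zero) \<Rightarrow> 'a set" where "keys \<equiv> Poly_Mapping.keys"
abbreviation single :: "'a \<Rightarrow> 'b::zero \<Rightarrow> 'a \<Rightarrow>\<^sub>0 'b" where "single \<equiv> Poly_Mapping.single"
abbreviation unit_exp :: "'v \<Rightarrow> 'v \<Rightarrow>\<^sub>0 nat" where "unit_exp i \<equiv> single i 1"

text \<open>Keeps the unit vectors in the form \<open>single i 1\<close>.\<close>

declare One_nat_def [simp del]

lemma lookup_single_mult:
  fixes f :: "'a::cancel_comm_monoid_add \<Rightarrow>\<^sub>0 'b::comm_semiring_1"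
  shows "lookup (single a c * f) (a + m) = c * lookup f m"
proof -
  have "lookup (single a c * f) (a + m)
      = (\<Sum>l. c * (\<Sum>q. lookup f q when a + m = l + q) when a = l)"
    by (simp add: lookup_mult lookup_single when_mult)
  also have "\<dots> = c * (\<Sum>q. lookup f q when m = q)" by simp
  finally show ?thesis by simp
qed

lemma lookup_single_mult_0:
  fixes f :: "'a::cancel_comm_monoid_add \<Rightarrow>\<^sub>0 'b::comm_semiring_1"
  assumes "\<And>t. m \<noteq> a + t"
  shows "lookup (single a c * f) m = 0"
proof (rule ccontr)
  assume "lookup (single a c * f) m \<noteq> 0"
  then have "m \<in> keys (single a c * f)" by (simp add: in_keys_iff)
  then obtain x t where "x \<in> keys (single a c)" "m = x + t" using keys_mult by blast
  then show False using assms by (auto split: if_splits)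
qed

lemma lookup_const_mult [simp]:
  fixes f :: "('v, 'k::field) mpoly"
  shows "lookup (const c * f) m = c * lookup f m"
  using lookup_single_mult[of 0 c f m] by (simp add: const_def)

lemma const_mult_single: "const c * single m d = (single m (c * d) :: ('v, 'k::field) mpoly)"
  by (simp add: const_def mult_single)

lemma var_mult_single: "var i * single m d = (single (unit_exp i + m) d :: ('v, 'k::field) mpoly)"
  by (simp add: var_def mult_single)

text \<open>The part of a finitely supported function on a set: for a polynomial, its terms with exponents in \<open>A\<close>.\<close>

definition restr :: "'a set \<Rightarrow> ('a \<Rightarrow>\<^sub>0 'b::comm_monoid_add) \<Rightarrow> 'a \<Rightarrow>\<^sub>0 'b" where
  "restr A f = (\<Sum>m\<in>keys f \<inter> A. single m (lookup f m))"

lemma lookup_restr: "lookup (restr A f) m = (if m \<in> A then lookup f m else 0)"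
proof -
  have "lookup (restr A f) m = (\<Sum>x\<in>keys f \<inter> A. if x = m then lookup f x else 0)"
    unfolding restr_def lookup_sum by (intro sum.cong) (auto simp: lookup_single when_def)
  then show ?thesis by (auto simp: in_keys_iff)
qed

lemma keys_restr: "keys (restr A f) = keys f \<inter> A"
  by (auto simp: in_keys_iff lookup_restr split: if_splits)

lemma restr_UNIV [simp]: "restr UNIV f = f"
  by (rule poly_mapping_eqI) (simp add: lookup_restr)

lemma restr_decomp: "f = restr A f + restr (- A) f"
  by (rule poly_mapping_eqI) (simp add: lookup_restr lookup_add)

lemma poly_sum_induct:
  fixes f :: "'a \<Rightarrow>\<^sub>0 'b::comm_monoid_add"
  assumes "P 0" "\<And>f g. P f \<Longrightarrow> P g \<Longrightarrow> P (f + g)" "\<And>m. m \<in> keys f \<Longrightarrow> P (single m (lookup f m))"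
  shows "P f"
proof -
  have "P (\<Sum>m\<in>A. single m (lookup f m))" if "A \<subseteq> keys f" for A
    using finite_subset[OF that finite_keys] that
    by (induction A rule: finite_induct) (auto intro: assms)
  from this[of "keys f"] show ?thesis
    using restr_UNIV[of f] by (simp add: restr_def)
qed

lemma monomial_induct [case_names single add]:
  fixes f :: "'a \<Rightarrow>\<^sub>0 'b::comm_monoid_add"
  assumes "\<And>m c. P (single m c)" "\<And>f g. P f \<Longrightarrow> P g \<Longrightarrow> P (f + g)"
  shows "P f"
proof (rule poly_sum_induct[of P])
  show "P 0" using assms(1)[of undefined 0] by simp
qed (use assms in blast)+

lemma unit_exp_le: "lookup m i > 0 \<Longrightarrow> unit_exp i + (m - unit_exp i) = m"
  by (rule poly_mapping_eqI) (auto simp: lookup_add lookup_minus lookup_single when_def)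

lemma keys_add_nat: "keys ((a::'v \<Rightarrow>\<^sub>0 nat) + b) = keys a \<union> keys b"
  by (auto simp: in_keys_iff lookup_add)

text \<open>Induction on monomials: every exponent vector is reached from 0 by adding unit vectors.\<close>

lemma mpoly_exp_induct [case_names zero step]:
  fixes m :: "'v \<Rightarrow>\<^sub>0 nat"
  assumes "P 0" "\<And>j m. P m \<Longrightarrow> P (unit_exp j + m)"
  shows "P m"
proof (induction "\<Sum>i\<in>keys m. lookup m i" arbitrary: m rule: less_induct)
  case less
  show ?case
  proof (cases "m = 0")
    case False
    then obtain j where j: "j \<in> keys m" by fastforce
    then have pos: "lookup m j > 0" by (auto simp: in_keys_iff)
    have "keys (m - unit_exp j) \<subseteq> keys m" by (auto simp: in_keys_iff lookup_minus)
    then have "(\<Sum>i\<in>keys (m - unit_exp j). lookup (m - unit_exp j) i) \<le> (\<Sum>i\<in>keys m. lookup (m - unit_exp j) i)"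
      by (intro sum_mono2) auto
    also have "\<dots> < (\<Sum>i\<in>keys m. lookup m i)"
      using pos j by (intro sum_strict_mono_ex1) (auto simp: lookup_minus lookup_single when_def intro!: bexI[of _ j])
    finally show ?thesis
      using less assms(2)[of "m - unit_exp j" j] unit_exp_le[OF pos] by simp
  qed (use assms in simp)
qed

section \<open>Derivations of the polynomial ring\<close>

lemma poly_ring_sel [simp]:
  "carrier (ring_of_type_algebra :: 'a::ring_1 ring) = UNIV"
  "monoid.mult (ring_of_type_algebra :: 'a::ring_1 ring) = (*)"
  "monoid.one (ring_of_type_algebra :: 'a::ring_1 ring) = 1"
  "ring.zero (ring_of_type_algebra :: 'a::ring_1 ring) = 0"
  "ring.add (ring_of_type_algebra :: 'a::ring_1 ring) = (+)"
  by (auto simp: ring_of_type_algebra_def)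

abbreviation ders :: "(('v, 'k::field) mpoly \<Rightarrow> ('v, 'k) mpoly) set" where
  "ders \<equiv> derivations (range const) poly_ring"

lemma ders_iff:
  "D \<in> ders \<longleftrightarrow> (\<forall>a b. D (a + b) = D a + D b) \<and> (\<forall>c a. D (const c * a) = const c * D a) \<and>
     (\<forall>a b. D (a * b) = D a * b + a * D b)"
  by (auto simp: derivations_def)

lemma
  assumes "D \<in> ders"
  shows der_add: "D (a + b) = D a + D b"
    and der_const_mult: "D (const c * a) = const c * D a"
    and der_mult: "D (a * b) = D a * b + a * D b"
  using assms by (auto simp: ders_iff)

lemma der_zero: "D \<in> ders \<Longrightarrow> D 0 = 0"
  using der_add[of D 0 0] by simp

lemma der_diff: "D \<in> ders \<Longrightarrow> D (a - b) = D a - D b"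
  using der_add[of D "a - b" b] by simp

lemma der_one: "D \<in> ders \<Longrightarrow> D 1 = 0"
  using der_mult[of D 1 1] by simp

lemma der_const: "D \<in> ders \<Longrightarrow> D (const c) = 0"
  using der_const_mult[of D c 1] by (simp add: der_one)

lemma keys_der_single:
  fixes D :: "('v, 'k::field) mpoly \<Rightarrow> ('v, 'k) mpoly"
  assumes D: "D \<in> ders" and "m' \<in> keys (D (single m c))"
  shows "\<exists>j d. lookup m j > 0 \<and> d \<in> keys (D (var j)) \<and> m' + unit_exp j = d + m"
proof -
  have "D (single m c) = const c * D (single m 1)"
    using der_const_mult[OF D, of c "single m 1"] by (simp add: const_mult_single)
  with assms(2) have "m' \<in> keys (D (single m 1))" by (auto simp: in_keys_iff)
  then show ?thesis
  proof (induction m arbitrary: m' rule: mpoly_exp_induct)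
    case zero
    then show ?case using der_one[OF D] by (simp flip: single_one)
  next
    case (step j m)
    have "D (single (unit_exp j + m) 1) = D (var j) * single m 1 + var j * D (single m 1)"
      unfolding var_mult_single[symmetric] der_mult[OF D] ..
    with step.prems consider "m' \<in> keys (D (var j) * single m 1)" | "m' \<in> keys (var j * D (single m 1))"
      using keys_add by fastforce
    then show ?case
    proof cases
      case 1
      then obtain d where "d \<in> keys (D (var j))" "m' = d + m"
        using keys_mult[of "D (var j)" "single m 1"] by (auto split: if_splits)
      then show ?thesis
        by (intro exI[of _ j] exI[of _ d]) (auto simp: lookup_add ac_simps)
    next
      case 2
      then obtain m'' where m'': "m'' \<in> keys (D (single m 1))" "m' = unit_exp j + m''"
        using keys_mult[of "var j" "D (single m 1)"] by (auto simp: var_def split: if_splits)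
      from step.IH[OF m''(1)] obtain l d
        where l: "lookup m l > 0" "d \<in> keys (D (var l))" "m'' + unit_exp l = d + m" by blast
      have "m' + unit_exp l = unit_exp j + (m'' + unit_exp l)"
        unfolding m''(2) by (rule add.assoc)
      then have "m' + unit_exp l = d + (unit_exp j + m)"
        unfolding l(3) by (simp only: add.left_commute)
      with l show ?thesis
        by (intro exI[of _ l] exI[of _ d]) (auto simp: lookup_add)
    qed
  qed
qed

text \<open>
  The monomials of \<open>D f\<close> arise from monomials of \<open>f\<close> by replacing one factor \<open>x\<^sub>j\<close> by a monomial of
  \<open>D x\<^sub>j\<close>, as in \<open>D = \<Sum>\<^sub>j D (x\<^sub>j) \<partial>\<^sub>j\<close>.
\<close>

lemma keys_der:
  fixes D :: "('v, 'k::field) mpoly \<Rightarrow> ('v, 'k) mpoly"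
  assumes D: "D \<in> ders" and "m' \<in> keys (D f)"
  shows "\<exists>m\<in>keys f. \<exists>j d. lookup m j > 0 \<and> d \<in> keys (D (var j)) \<and> m' + unit_exp j = d + m"
proof -
  let ?P = "\<lambda>g. keys (D g) \<subseteq> {m'. \<exists>m\<in>keys f. \<exists>j d. lookup m j > 0 \<and> d \<in> keys (D (var j)) \<and> m' + unit_exp j = d + m}"
  have "?P f"
  proof (rule poly_sum_induct[of ?P])
    show "?P (g + h)" if "?P g" "?P h" for g h
      using that keys_add[of "D g" "D h"] by (simp add: der_add[OF D]) blast
    show "?P (single m (lookup f m))" if "m \<in> keys f" for m
      using that keys_der_single[OF D] by blast
  qed (simp add: der_zero[OF D])
  then show ?thesis using assms(2) by blast
qed

lemma lookup_partial:
  "lookup (partial i p) m = of_nat (lookup m i + 1) * lookup p (m + unit_exp i)"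
proof -
  have "lookup (partial i p) m
      = (\<Sum>k\<in>keys p. if k = m + unit_exp i then of_nat (lookup m i + 1) * lookup p (m + unit_exp i) else 0)"
    unfolding partial_def lookup_sum
  proof (rule sum.cong)
    fix k assume "k \<in> keys p"
    show "lookup (single (k - unit_exp i) (of_nat (lookup k i) * lookup p k)) m =
         (if k = m + unit_exp i then of_nat (lookup m i + 1) * lookup p (m + unit_exp i) else 0)"
    proof (cases "lookup k i = 0")
      case True
      then have "k \<noteq> m + unit_exp i" by (auto simp: lookup_add)
      with True show ?thesis by simp
    next
      case False
      then have "k - unit_exp i = m \<longleftrightarrow> k = m + unit_exp i"
        using unit_exp_le[of k i] by (auto simp: add.commute)
      then show ?thesis by (auto simp: lookup_single when_def lookup_add)
    qed
  qed simp
  then show ?thesis by (auto simp: in_keys_iff)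
qed

lemma partial_add: "partial i (p + q) = partial i p + partial i q"
  by (rule poly_mapping_eqI) (simp add: lookup_partial lookup_add algebra_simps)

lemma partial_single:
  "partial i (single m c) = single (m - unit_exp i) (of_nat (lookup m i) * c)"
  by (cases "c = 0") (simp_all add: partial_def)

lemma partial_der: "partial i \<in> (ders :: (('v, 'k::field) mpoly \<Rightarrow> ('v, 'k) mpoly) set)"
  unfolding ders_iff
proof (intro conjI allI)
  show "partial i (a + b) = partial i a + partial i b" for a b :: "('v, 'k) mpoly"
    by (rule partial_add)
  show "partial i (const c * a) = const c * partial i a" for c and a :: "('v, 'k) mpoly"
    by (rule poly_mapping_eqI) (simp add: lookup_partial)
  show "partial i (a * b) = partial i a * b + a * partial i b" for a b :: "('v, 'k) mpoly"
  proof (induction a rule: monomial_induct)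
    case (add f g)
    then show ?case by (simp add: partial_add algebra_simps)
  next
    case (single m c)
    show ?case
    proof (induction b rule: monomial_induct)
      case (add f g)
      then show ?case by (simp add: partial_add algebra_simps)
    next
      case (single m' c')
      have 1: "single (m - unit_exp i + m') (of_nat (lookup m i) * c * c')
          = single (m + m' - unit_exp i) (of_nat (lookup m i) * c * c')"
        using unit_exp_le[of m i] by (cases "lookup m i = 0") (auto, metis add.assoc add_diff_cancel_left')
      have 2: "single (m + (m' - unit_exp i)) (c * (of_nat (lookup m' i) * c'))
          = single (m + m' - unit_exp i) (c * (of_nat (lookup m' i) * c'))"
        using unit_exp_le[of m' i] by (cases "lookup m' i = 0") (auto, metis add.left_commute add_diff_cancel_left')
      show ?case
        unfolding mult_single partial_single 1 2 single_add[symmetric]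
        by (simp add: lookup_add algebra_simps)
    qed
  qed
qed

lemma mult_der: "D \<in> ders \<Longrightarrow> (\<lambda>f. b * D f) \<in> ders"
  by (auto simp: ders_iff algebra_simps)

lemma add_der: "D \<in> ders \<Longrightarrow> E \<in> ders \<Longrightarrow> (\<lambda>f. D f + E f) \<in> ders"
  by (auto simp: ders_iff algebra_simps)

section \<open>Monomial ideals\<close>

lemma cring_poly: "cring (ring_of_type_algebra :: 'a::comm_ring_1 ring)"
  by (rule cring_from_type_algebra)

lemma ring_poly: "ring (ring_of_type_algebra :: 'a::comm_ring_1 ring)"
  by (rule ring_from_type_algebra)

lemma subgroup_poly_iff:
  "subgroup H (add_monoid (ring_of_type_algebra :: 'a::comm_ring_1 ring)) \<longleftrightarrow>
     0 \<in> H \<and> (\<forall>x\<in>H. \<forall>y\<in>H. x - y \<in> H)"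
proof -
  interpret A: abelian_group "ring_of_type_algebra :: 'a ring"
    using ring_poly by (rule ring.is_abelian_group)
  have inv: "m_inv (add_monoid (ring_of_type_algebra :: 'a ring)) x = - x" for x
    using A.minus_equality[of "- x" x] by (simp add: a_inv_def)
  show ?thesis
  proof
    assume "subgroup H (add_monoid (ring_of_type_algebra :: 'a ring))"
    then interpret subgroup H "add_monoid (ring_of_type_algebra :: 'a ring)" .
    show "0 \<in> H \<and> (\<forall>x\<in>H. \<forall>y\<in>H. x - y \<in> H)"
      using one_closed m_closed m_inv_closed inv by fastforce
  next
    assume *: "0 \<in> H \<and> (\<forall>x\<in>H. \<forall>y\<in>H. x - y \<in> H)"
    then have "- x \<in> H" if "x \<in> H" for x using that by (metis diff_0)
    moreover have "x + y \<in> H" if "x \<in> H" "y \<in> H" for x y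
      using that * calculation by (metis diff_minus_eq_add)
    ultimately show "subgroup H (add_monoid (ring_of_type_algebra :: 'a ring))"
      using * unfolding subgroup_def inv by simp
  qed
qed

lemma ideal_poly_iff:
  "ideal H (ring_of_type_algebra :: 'a::comm_ring_1 ring) \<longleftrightarrow>
     0 \<in> H \<and> (\<forall>x\<in>H. \<forall>y\<in>H. x + y \<in> H) \<and> (\<forall>a. \<forall>x\<in>H. a * x \<in> H)"
proof
  assume "ideal H (ring_of_type_algebra :: 'a ring)"
  then interpret ideal H "ring_of_type_algebra :: 'a ring" .
  show "0 \<in> H \<and> (\<forall>x\<in>H. \<forall>y\<in>H. x + y \<in> H) \<and> (\<forall>a. \<forall>x\<in>H. a * x \<in> H)"
    using additive_subgroup.zero_closed[OF additive_subgroup_axioms]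
      additive_subgroup.a_closed[OF additive_subgroup_axioms] I_l_closed by simp
next
  assume *: "0 \<in> H \<and> (\<forall>x\<in>H. \<forall>y\<in>H. x + y \<in> H) \<and> (\<forall>a. \<forall>x\<in>H. a * x \<in> H)"
  have minus: "x - y \<in> H" if "x \<in> H" "y \<in> H" for x y
  proof -
    have "x + (- 1) * y \<in> H" using * that by blast
    then show ?thesis by simp
  qed
  show "ideal H (ring_of_type_algebra :: 'a ring)"
  proof (rule idealI[OF ring_poly])
    show "subgroup H (add_monoid (ring_of_type_algebra :: 'a ring))"
      unfolding subgroup_poly_iff using * minus by blast
    fix a x :: 'a
    assume "a \<in> H"
    then have "x * a \<in> H" using * by blast
    moreover from this have "a * x \<in> H" by (subst mult.commute)
    ultimately show "x \<otimes>\<^bsub>ring_of_type_algebra\<^esub> a \<in> H" "a \<otimes>\<^bsub>ring_of_type_algebra\<^esub> x \<in> H"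
      by simp_all
  qed
qed

text \<open>A polynomial is in a monomial ideal iff each of its monomials is divisible by a generator.\<close>

lemma monomial_ideal:
  fixes S :: "('v \<Rightarrow>\<^sub>0 nat) set"
  shows "Idl\<^bsub>poly_ring\<^esub> ((\<lambda>s. single s 1) ` S)
    = {f :: ('v, 'k::field) mpoly. \<forall>m\<in>keys f. \<exists>s\<in>S. \<exists>t. m = s + t}" (is "?L = ?R")
proof
  interpret ring "poly_ring :: ('v, 'k) mpoly ring" by (rule ring_poly)
  have "ideal ?R poly_ring"
    unfolding ideal_poly_iff
  proof (intro conjI ballI allI)
    show "x + y \<in> ?R" if "x \<in> ?R" "y \<in> ?R" for x y
      using that keys_add[of x y] by blast
    show "a * x \<in> ?R" if "x \<in> ?R" for a x
    proof clarify
      fix m assume "m \<in> keys (a * x)"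
      then obtain u v where "m = u + v" "v \<in> keys x" using keys_mult by blast
      moreover then obtain s t where "s \<in> S" "v = s + t" using \<open>x \<in> ?R\<close> by blast
      ultimately show "\<exists>s\<in>S. \<exists>t. m = s + t"
        by (intro bexI[of _ s] exI[of _ "u + t"]) (auto simp: ac_simps)
    qed
  qed simp
  then show "?L \<subseteq> ?R"
    by (rule genideal_minimal) (auto split: if_splits, metis add.right_neutral)
  have L: "ideal ?L (poly_ring :: ('v, 'k) mpoly ring)"
    by (rule genideal_ideal) simp
  show "?R \<subseteq> ?L"
  proof
    fix f assume f: "f \<in> ?R"
    show "f \<in> ?L"
    proof (rule poly_sum_induct[of "\<lambda>g. g \<in> ?L"])
      fix m assume "m \<in> keys f"
      with f obtain s t where "s \<in> S" "m = s + t" by blast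
      then have "single m (lookup f m) = single t (lookup f m) * single s 1"
        by (simp add: mult_single add.commute)
      moreover have "single s 1 \<in> ?L" using \<open>s \<in> S\<close> genideal_self[of "(\<lambda>s. single s 1) ` S"] by auto
      ultimately show "single m (lookup f m) \<in> ?L" using L unfolding ideal_poly_iff by simp
    qed (use L in \<open>auto simp: ideal_poly_iff\<close>)
  qed
qed

lemma var_ideal:
  "Idl\<^bsub>poly_ring\<^esub> (var ` A) = {f :: ('v, 'k::field) mpoly. \<forall>m\<in>keys f. keys m \<inter> A \<noteq> {}}"
proof -
  have "(\<exists>s\<in>unit_exp ` A. \<exists>t. m = s + t) \<longleftrightarrow> keys m \<inter> A \<noteq> {}" for m :: "'v \<Rightarrow>\<^sub>0 nat"
  proof
    assume "keys m \<inter> A \<noteq> {}"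
    then obtain i where "i \<in> A" "lookup m i > 0" by (auto simp: in_keys_iff)
    then show "\<exists>s\<in>unit_exp ` A. \<exists>t. m = s + t"
      using unit_exp_le[of m i, symmetric] by blast
  qed (auto simp: keys_add_nat)
  then show ?thesis
    using monomial_ideal[of "unit_exp ` A", where 'k = 'k] by (simp add: image_image var_def)
qed

text \<open>The exponent vector of the squarefree monomial \<open>x\<^sup>\<sigma>\<close>.\<close>

definition exp_of_set :: "'v set \<Rightarrow> 'v \<Rightarrow>\<^sub>0 nat" where
  "exp_of_set \<sigma> = (\<Sum>i\<in>\<sigma>. unit_exp i)"

lemma lookup_exp_of_set: "finite \<sigma> \<Longrightarrow> lookup (exp_of_set \<sigma>) i = (if i \<in> \<sigma> then 1 else 0)"
  unfolding exp_of_set_def lookup_sum by (simp add: lookup_single when_def)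

lemma keys_exp_of_set: "finite \<sigma> \<Longrightarrow> keys (exp_of_set \<sigma>) = \<sigma>"
  by (simp add: set_eq_iff in_keys_iff lookup_exp_of_set)

lemma prod_var: "finite \<sigma> \<Longrightarrow> (\<Prod>i\<in>\<sigma>. var i) = (single (exp_of_set \<sigma>) 1 :: ('v, 'k::field) mpoly)"
  by (induction \<sigma> rule: finite_induct) (auto simp: exp_of_set_def var_mult_single)

lemma sr_ideal_iff:
  fixes f :: "('v::finite, 'k::field) mpoly"
  assumes "simplicial_complex \<Delta>"
  shows "f \<in> sr_ideal \<Delta> \<longleftrightarrow> (\<forall>m\<in>keys f. keys m \<notin> \<Delta>)"
proof -
  have gen: "{\<Prod>i\<in>\<sigma>. var i | \<sigma>. \<sigma> \<notin> \<Delta>} = (\<lambda>s. single s 1 :: ('v, 'k) mpoly) ` exp_of_set ` (- \<Delta>)"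
    by (auto simp: prod_var)
  have "(\<exists>s\<in>exp_of_set ` (- \<Delta>). \<exists>t. m = s + t) \<longleftrightarrow> keys m \<notin> \<Delta>" for m :: "'v \<Rightarrow>\<^sub>0 nat"
  proof
    assume "keys m \<notin> \<Delta>"
    moreover have "m = exp_of_set (keys m) + (m - exp_of_set (keys m))"
      by (rule poly_mapping_eqI) (auto simp: lookup_add lookup_minus lookup_exp_of_set in_keys_iff)
    ultimately show "\<exists>s\<in>exp_of_set ` (- \<Delta>). \<exists>t. m = s + t" by blast
  next
    assume "\<exists>s\<in>exp_of_set ` (- \<Delta>). \<exists>t. m = s + t"
    then obtain \<sigma> t where "\<sigma> \<notin> \<Delta>" "m = exp_of_set \<sigma> + t" by blast
    then show "keys m \<notin> \<Delta>"
      using subface[OF assms, of "keys m" \<sigma>] by (auto simp: keys_add_nat keys_exp_of_set)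
  qed
  then show ?thesis by (simp add: sr_ideal_def gen monomial_ideal)
qed

section \<open>Exchanging variables\<close>

lemma mdeg_add: "mdeg \<Delta> (a + b) = mdeg \<Delta> a + mdeg \<Delta> b"
  by (simp add: mdeg_def lookup_add sum.distrib)

lemma sdeg_add: "sdeg \<Delta> (a + b) \<omega> = sdeg \<Delta> a \<omega> + sdeg \<Delta> b \<omega>"
  by (simp add: sdeg_def lookup_add sum.distrib)

lemma mdeg_unit_exp: "mdeg \<Delta> (unit_exp i) = (if i \<in> noncone \<Delta> then 1 else 0)"
  by (simp add: mdeg_def lookup_single when_def)

lemma sdeg_unit_exp:
  "sdeg \<Delta> (unit_exp i) \<omega> = (if i \<in> noncone \<Delta> \<and> \<omega> = stratum_of \<Delta> i then 1 else 0)"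
  by (auto simp: sdeg_def lookup_single when_def strata_eq in_stratum_of_iff)

lemma mdeg_pos_iff: "mdeg \<Delta> m > 0 \<longleftrightarrow> keys m \<inter> noncone \<Delta> \<noteq> {}"
proof -
  have "mdeg \<Delta> m = 0 \<longleftrightarrow> keys m \<inter> noncone \<Delta> = {}"
    unfolding mdeg_def by (auto simp: in_keys_iff)
  then show ?thesis by (metis gr0I less_irrefl)
qed

lemma sdeg_eq_0: "mdeg \<Delta> m = 0 \<Longrightarrow> sdeg \<Delta> m \<omega> = 0"
  by (simp add: mdeg_def sdeg_def)

lemma mdeg_one_obtain:
  assumes "mdeg \<Delta> m = 1"
  obtains i m0 where "i \<in> noncone \<Delta>" "m = unit_exp i + m0" "mdeg \<Delta> m0 = 0"
proof -
  obtain i where i: "i \<in> keys m" "i \<in> noncone \<Delta>"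
    using mdeg_pos_iff[of \<Delta> m] assms by auto
  then have m: "m = unit_exp i + (m - unit_exp i)"
    using unit_exp_le[of m i] by (simp add: in_keys_iff)
  have "mdeg \<Delta> m = mdeg \<Delta> (unit_exp i) + mdeg \<Delta> (m - unit_exp i)"
    using mdeg_add[of \<Delta> "unit_exp i" "m - unit_exp i"] m by simp
  then show thesis using that[OF i(2) m] assms i by (simp add: mdeg_unit_exp)
qed

text \<open>
  The weight of a multidegree: a vertex counts as many times as there are facets through it.  All
  vertices of a stratum lie in the same facets, so the facets that contain the stratum can be counted
  instead.
\<close>

definition weight :: "'v::finite set set \<Rightarrow> ('v set \<Rightarrow> nat) \<Rightarrow> nat" where
  "weight \<Delta> q = (\<Sum>\<omega>\<in>UNIV. q \<omega> * card {F \<in> facets \<Delta>. \<omega> \<subseteq> F})"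

lemma weight_add: "weight \<Delta> (sdeg \<Delta> (a + b)) = weight \<Delta> (sdeg \<Delta> a) + weight \<Delta> (sdeg \<Delta> b)"
  by (simp add: weight_def sdeg_add sum.distrib distrib_right)

lemma weight_unit_exp:
  assumes "i \<in> noncone \<Delta>"
  shows "weight \<Delta> (sdeg \<Delta> (unit_exp i)) = card (facets_at \<Delta> i)"
proof -
  have "{F \<in> facets \<Delta>. stratum_of \<Delta> i \<subseteq> F} = facets_at \<Delta> i"
    by (auto simp: facets_at_def stratum_of_def)
  moreover have "weight \<Delta> (sdeg \<Delta> (unit_exp i))
      = (\<Sum>\<omega>\<in>UNIV. if \<omega> = stratum_of \<Delta> i then card {F \<in> facets \<Delta>. \<omega> \<subseteq> F} else 0)"
    unfolding weight_def by (rule sum.cong) (simp_all add: sdeg_unit_exp assms)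
  ultimately show ?thesis by simp
qed

text \<open>
  Two exponent vectors without cone points and with the same multidegree are connected by exchanges of
  variables inside strata; each exchange reduces the truncated distance \<open>\<Sum>\<^sub>i max 0 (m\<^sub>i - m'\<^sub>i)\<close>.
\<close>

lemma exchange_connected:
  fixes S :: "('v::finite \<Rightarrow>\<^sub>0 nat) set"
  assumes closed: "\<And>m i j. unit_exp j + m \<in> S \<Longrightarrow> i \<in> noncone \<Delta> \<Longrightarrow> j \<in> noncone \<Delta> \<Longrightarrow>
      stratum_of \<Delta> i = stratum_of \<Delta> j \<Longrightarrow> unit_exp i + m \<in> S"
    and "m \<in> S" "keys m \<subseteq> noncone \<Delta>" "keys m' \<subseteq> noncone \<Delta>" "sdeg \<Delta> m = sdeg \<Delta> m'"
  shows "m' \<in> S"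
  using assms(2-)
proof (induction "\<Sum>i\<in>UNIV. lookup m i - lookup m' i" arbitrary: m rule: less_induct)
  case less
  show ?case
  proof (cases "\<exists>i. lookup m i < lookup m' i")
    case True
    then obtain i where i: "lookup m i < lookup m' i" by blast
    then have "i \<in> keys m'" by (auto simp: in_keys_iff)
    then have im: "i \<in> noncone \<Delta>" using less.prems by blast
    let ?A = "stratum_of \<Delta> i \<inter> noncone \<Delta>"
    have eq: "(\<Sum>l\<in>?A. lookup m l) = (\<Sum>l\<in>?A. lookup m' l)"
      using fun_cong[OF less.prems(4), of "stratum_of \<Delta> i"] by (simp add: sdeg_def strata_eq)
    have "\<exists>j\<in>?A. lookup m' j < lookup m j"
    proof (rule ccontr)
      assume "\<not> ?thesis"
      then have "(\<Sum>l\<in>?A. lookup m l) < (\<Sum>l\<in>?A. lookup m' l)"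
        using i im by (intro sum_strict_mono_ex1) (auto simp: not_less intro!: bexI[of _ i])
      then show False using eq by simp
    qed
    then obtain j where j: "j \<in> noncone \<Delta>" "stratum_of \<Delta> i = stratum_of \<Delta> j" "lookup m' j < lookup m j"
      by (auto simp: in_stratum_of_iff)
    define m0 where "m0 = m - unit_exp j"
    have m: "m = unit_exp j + m0" using j(3) unit_exp_le[of m j] by (simp add: m0_def)
    have ij: "i \<noteq> j" using i j(3) by auto
    have "unit_exp i + m0 \<in> S"
      using closed[of j m0 i] less.prems(1) m im j by simp
    moreover have "keys (unit_exp i + m0) \<subseteq> noncone \<Delta>"
      using less.prems(2) im by (auto simp: m keys_add_nat)
    moreover have "sdeg \<Delta> (unit_exp i + m0) = sdeg \<Delta> m"
      using im j(1,2) by (auto simp: m sdeg_add sdeg_unit_exp)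
    moreover have "(\<Sum>l\<in>UNIV. lookup (unit_exp i + m0) l - lookup m' l) < (\<Sum>l\<in>UNIV. lookup m l - lookup m' l)"
    proof (rule sum_strict_mono_ex1)
      have "lookup (unit_exp i + m0) l - lookup m' l \<le> lookup m l - lookup m' l" for l
        using i ij by (cases "l = i"; cases "l = j") (simp_all add: m lookup_add lookup_single)
      then show "\<forall>l\<in>UNIV. lookup (unit_exp i + m0) l - lookup m' l \<le> lookup m l - lookup m' l"
        by blast
      have "lookup (unit_exp i + m0) j - lookup m' j < lookup m j - lookup m' j"
        using j(3) ij by (simp add: m lookup_add lookup_single)
      then show "\<exists>l\<in>UNIV. lookup (unit_exp i + m0) l - lookup m' l < lookup m l - lookup m' l"
        by blast
    qed simp
    ultimately show ?thesis
      using less.prems(3,4) by (intro less.hyps[of "unit_exp i + m0"]) simp_all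
  next
    case False
    then have le: "lookup m' i \<le> lookup m i" for i by (simp add: not_less)
    have "lookup m i = lookup m' i" for i
    proof (cases "i \<in> noncone \<Delta>")
      case True
      let ?A = "stratum_of \<Delta> i \<inter> noncone \<Delta>"
      have "(\<Sum>l\<in>?A. lookup m l) = (\<Sum>l\<in>?A. lookup m' l)"
        using fun_cong[OF less.prems(4), of "stratum_of \<Delta> i"] by (simp add: sdeg_def strata_eq)
      then have "\<not> (\<Sum>l\<in>?A. lookup m' l) < (\<Sum>l\<in>?A. lookup m l)" by simp
      moreover have "i \<in> ?A" using True by simp
      ultimately have "\<not> lookup m' i < lookup m i"
        using le sum_strict_mono_ex1[of ?A "lookup m'" "lookup m"] by (meson finite)
      then show ?thesis using le[of i] by simp
    next
      case False
      then have "i \<notin> keys m" "i \<notin> keys m'" using less.prems by auto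
      then show ?thesis by (simp add: in_keys_iff)
    qed
    then show ?thesis using less.prems(1) by (metis poly_mapping_eqI)
  qed
qed

section \<open>The Lie algebroid of a Stanley-Reisner ideal\<close>

locale stanley_reisner =
  fixes \<Delta> :: "'v::finite set set" and I :: "('v, 'k::field_char_0) mpoly set"
  assumes complex: "simplicial_complex \<Delta>" and I_def: "I = sr_ideal \<Delta>"
begin

lemma I_iff: "f \<in> I \<longleftrightarrow> (\<forall>m\<in>keys f. keys m \<notin> \<Delta>)"
  using sr_ideal_iff[OF complex] by (simp add: I_def)

lemma face_facet: "\<sigma> \<in> \<Delta> \<longleftrightarrow> (\<exists>F\<in>facets \<Delta>. \<sigma> \<subseteq> F)"
  by (rule face_iff_facet[OF complex])

lemma TBI_iff: "D \<in> carrier (TBI I) \<longleftrightarrow> D \<in> ders \<and> D ` I \<subseteq> I"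
  by (simp add: TBI_def)

text \<open>
  A derivation that preserves the ideal preserves the prime \<open>(x\<^sub>j | j \<notin> F)\<close> of each facet \<open>F\<close>.  Indeed,
  \<open>x\<^sub>j x\<^sup>F\<close> is in the ideal, and the terms of \<open>D (x\<^sub>j x\<^sup>F) = D (x\<^sub>j) x\<^sup>F + x\<^sub>j D (x\<^sup>F)\<close> supported on \<open>F\<close>
  can only come from the first summand.
\<close>

lemma TBI_facet:
  assumes D: "D \<in> carrier (TBI I)" and F: "F \<in> facets \<Delta>" "j \<notin> F" and d: "d \<in> keys (D (var j))"
  shows "\<not> keys d \<subseteq> F"
proof
  assume dF: "keys d \<subseteq> F"
  let ?h = "single (exp_of_set F) 1 :: ('v, 'k) mpoly"
  have der: "D \<in> ders" "D ` I \<subseteq> I" using D by (auto simp: TBI_iff)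
  have "insert j F \<notin> \<Delta>"
    using F by (auto simp: facets_def)
  then have "var j * ?h \<in> I"
    by (simp add: I_iff var_mult_single keys_add_nat keys_exp_of_set)
  then have I: "D (var j * ?h) \<in> I" using der(2) by blast
  have Dj: "D (var j * ?h) = ?h * D (var j) + var j * D ?h"
    by (simp add: der_mult[OF der(1)] mult.commute)
  have "lookup (var j * D ?h) (exp_of_set F + d) = 0"
    unfolding var_def
  proof (rule lookup_single_mult_0)
    fix t show "exp_of_set F + d \<noteq> unit_exp j + t"
    proof
      assume "exp_of_set F + d = unit_exp j + t"
      then have "lookup (exp_of_set F + d) j = lookup (unit_exp j + t) j" by (rule arg_cong)
      then have "lookup d j \<noteq> 0" using F by (simp add: lookup_add lookup_exp_of_set)
      then have "j \<in> keys d" by (simp add: in_keys_iff)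
      then show False using F dF by blast
    qed
  qed
  then have "lookup (D (var j * ?h)) (exp_of_set F + d) = lookup (D (var j)) d"
    by (simp add: Dj lookup_add lookup_single_mult)
  then have "exp_of_set F + d \<in> keys (D (var j * ?h))" using d by (simp add: in_keys_iff)
  then have "keys (exp_of_set F + d) \<notin> \<Delta>" using I unfolding I_iff by blast
  moreover have "keys (exp_of_set F + d) = F" using dF by (auto simp: keys_add_nat keys_exp_of_set)
  ultimately show False using F by (simp add: facets_def)
qed

lemma face_if_step_face:
  assumes d: "\<And>F. F \<in> facets \<Delta> \<Longrightarrow> j \<notin> F \<Longrightarrow> \<not> keys d \<subseteq> F"
    and eq: "m' + unit_exp j = d + m" and j: "lookup m j > 0" and m': "keys m' \<in> \<Delta>"
  shows "keys m \<in> \<Delta>"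
proof -
  have keys_eq: "keys m' \<union> {j} = keys d \<union> keys m"
    using arg_cong[OF eq, of keys] by (simp add: keys_add_nat)
  obtain F where F: "F \<in> facets \<Delta>" "keys m' \<subseteq> F" using m' by (auto simp: face_facet)
  have "j \<in> F"
  proof (rule ccontr)
    assume "j \<notin> F"
    moreover have "lookup m' j + 1 = lookup d j + lookup m j"
      using arg_cong[OF eq, of "\<lambda>x. lookup x j"] by (simp add: lookup_add)
    moreover have "j \<notin> keys m'" using \<open>j \<notin> F\<close> F(2) by blast
    ultimately have "j \<notin> keys d" using j by (simp add: in_keys_iff)
    then have "keys d \<subseteq> F" using keys_eq F(2) by blast
    then show False using d[OF F(1) \<open>j \<notin> F\<close>] by blast
  qed
  then have "keys m \<subseteq> F" using keys_eq F(2) by blast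
  then show ?thesis using F(1) by (auto simp: face_facet)
qed

text \<open>Conversely, a derivation that preserves these primes preserves the ideal.\<close>

lemma TBI_if_facet:
  assumes D: "D \<in> ders"
    and d: "\<And>F j d. F \<in> facets \<Delta> \<Longrightarrow> j \<notin> F \<Longrightarrow> d \<in> keys (D (var j)) \<Longrightarrow> \<not> keys d \<subseteq> F"
  shows "D \<in> carrier (TBI I)"
  unfolding TBI_iff
proof (intro conjI D subsetI, clarify)
  fix f assume f: "f \<in> I"
  show "D f \<in> I"
    unfolding I_iff
  proof (intro ballI notI)
    fix m' assume "m' \<in> keys (D f)" and m': "keys m' \<in> \<Delta>"
    then obtain m j e where m: "m \<in> keys f" "lookup m j > 0" "e \<in> keys (D (var j))"
        "m' + unit_exp j = e + m"
      using keys_der[OF D] by blast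
    then have "keys m \<in> \<Delta>" using face_if_step_face[OF d[OF _ _ m(3)] m(4,2) m'] by blast
    then show False using f m(1) unfolding I_iff by blast
  qed
qed

lemma partial_var: "partial j (var l) = (if l = j then 1 else 0)"
  by (auto simp: var_def partial_single lookup_single)

lemma keys_var: "keys (var i :: ('v, 'k) mpoly) = {unit_exp i}"
  by (simp add: var_def)

lemma euler_partial_TBI:
  assumes "facets_at \<Delta> i \<subseteq> facets_at \<Delta> j"
  shows "(\<lambda>f. var i * partial j f) \<in> carrier (TBI I)"
  using assms
  by (intro TBI_if_facet mult_der partial_der)
    (auto simp: partial_var keys_var facets_at_def split: if_splits)

lemma Nset_eq: "Nset I = noncone \<Delta>"
proof -
  have "partial j \<in> carrier (TBI I) \<longleftrightarrow> j \<notin> noncone \<Delta>" for j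
  proof
    assume D: "partial j \<in> carrier (TBI I)"
    show "j \<notin> noncone \<Delta>"
      using TBI_facet[OF D, of _ j 0] by (auto simp: partial_var noncone_def)
  next
    assume "j \<notin> noncone \<Delta>"
    then show "partial j \<in> carrier (TBI I)"
      by (intro TBI_if_facet partial_der) (auto simp: partial_var noncone_def split: if_splits)
  qed
  then show ?thesis by (auto simp: Nset_def)
qed

lemma partial_TBI: "j \<notin> noncone \<Delta> \<Longrightarrow> partial j \<in> carrier (TBI I)"
  using Nset_eq by (auto simp: Nset_def)

lemma Jm_iff: "f \<in> Jm I \<longleftrightarrow> (\<forall>m\<in>keys f. mdeg \<Delta> m > 0)"
  by (simp add: Jm_def var_ideal Nset_eq mdeg_pos_iff)

lemma max_ideal_iff: "f \<in> max_ideal \<longleftrightarrow> lookup f 0 = 0" for f :: "('v, 'k) mpoly"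
proof -
  have "f \<in> max_ideal \<longleftrightarrow> (\<forall>m\<in>keys f. m \<noteq> 0)"
    by (simp add: max_ideal_def var_ideal)
  then show ?thesis by (metis in_keys_iff)
qed

text \<open>
  One replacement of \<open>x\<^sub>j\<close> by a monomial \<open>x\<^sup>d\<close> of \<open>D x\<^sub>j\<close>: it does not turn a nonface into a face, does
  not lower the degree, and if it keeps the degree, it keeps the multidegree or lowers the weight.
\<close>

lemma TBI_step:
  assumes D: "D \<in> carrier (TBI I)" and d: "d \<in> keys (D (var j))"
    and eq: "m' + unit_exp j = d + m"
  shows "keys m' \<in> \<Delta> \<Longrightarrow> lookup m j > 0 \<Longrightarrow> keys m \<in> \<Delta>"
    and "mdeg \<Delta> m \<le> mdeg \<Delta> m'"
    and "mdeg \<Delta> m = mdeg \<Delta> m' \<Longrightarrow>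
      sdeg \<Delta> m' = sdeg \<Delta> m \<or> weight \<Delta> (sdeg \<Delta> m') < weight \<Delta> (sdeg \<Delta> m)"
proof -
  have md: "mdeg \<Delta> m' + mdeg \<Delta> (unit_exp j) = mdeg \<Delta> d + mdeg \<Delta> m"
    using arg_cong[OF eq, of "mdeg \<Delta>"] by (simp add: mdeg_add)
  have sd: "sdeg \<Delta> m' \<omega> + sdeg \<Delta> (unit_exp j) \<omega> = sdeg \<Delta> d \<omega> + sdeg \<Delta> m \<omega>" for \<omega>
    using arg_cong[OF eq, of "\<lambda>x. sdeg \<Delta> x \<omega>"] by (simp add: sdeg_add)
  have d_mdeg: "mdeg \<Delta> d > 0" if j: "j \<in> noncone \<Delta>"
  proof -
    obtain F where F: "F \<in> facets \<Delta>" "j \<notin> F" using j by (auto simp: noncone_def)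
    then show ?thesis using TBI_facet[OF D F d] by (auto simp: mdeg_pos_iff noncone_def)
  qed
  show "keys m' \<in> \<Delta> \<Longrightarrow> lookup m j > 0 \<Longrightarrow> keys m \<in> \<Delta>"
    using face_if_step_face[OF TBI_facet[OF D _ _ d] eq] by blast
  show "mdeg \<Delta> m \<le> mdeg \<Delta> m'"
    using md d_mdeg by (auto simp: mdeg_unit_exp split: if_splits)
  show "sdeg \<Delta> m' = sdeg \<Delta> m \<or> weight \<Delta> (sdeg \<Delta> m') < weight \<Delta> (sdeg \<Delta> m)"
    if same: "mdeg \<Delta> m = mdeg \<Delta> m'"
  proof (cases "j \<in> noncone \<Delta>")
    case False
    then have "mdeg \<Delta> d = 0" using md same by (simp add: mdeg_unit_exp)
    then have "sdeg \<Delta> m' \<omega> = sdeg \<Delta> m \<omega>" for \<omega>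
      using sd[of \<omega>] False by (simp add: sdeg_eq_0 sdeg_unit_exp)
    then show ?thesis by auto
  next
    case True
    then have "mdeg \<Delta> d = 1" using md same by (simp add: mdeg_unit_exp)
    then obtain i d0 where i: "i \<in> noncone \<Delta>" "d = unit_exp i + d0" "mdeg \<Delta> d0 = 0"
      by (rule mdeg_one_obtain)
    have d0: "keys d0 \<inter> noncone \<Delta> = {}" using i(3) mdeg_pos_iff[of \<Delta> d0] by simp
    have sub: "facets_at \<Delta> i \<subseteq> facets_at \<Delta> j"
    proof
      fix F assume F: "F \<in> facets_at \<Delta> i"
      then have "keys d \<subseteq> F" using d0 i(2) by (auto simp: facets_at_def keys_add_nat noncone_def)
      then show "F \<in> facets_at \<Delta> j" using TBI_facet[OF D, of F j d] d F by (auto simp: facets_at_def)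
    qed
    have sd': "sdeg \<Delta> m' \<omega> + sdeg \<Delta> (unit_exp j) \<omega> = sdeg \<Delta> (unit_exp i) \<omega> + sdeg \<Delta> m \<omega>" for \<omega>
      using sd[of \<omega>] i by (simp add: sdeg_add sdeg_eq_0)
    show ?thesis
    proof (cases "facets_at \<Delta> i = facets_at \<Delta> j")
      case True
      then have "stratum_of \<Delta> i = stratum_of \<Delta> j" by (simp add: stratum_of_eq_iff)
      then have "sdeg \<Delta> m' \<omega> = sdeg \<Delta> m \<omega>" for \<omega>
        using sd'[of \<omega>] i(1) \<open>j \<in> noncone \<Delta>\<close> by (simp add: sdeg_unit_exp split: if_splits)
      then show ?thesis by auto
    next
      case False
      then have lt: "card (facets_at \<Delta> i) < card (facets_at \<Delta> j)"
        using sub by (intro psubset_card_mono) auto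
      have "weight \<Delta> (sdeg \<Delta> d0) = 0" using i(3) by (simp add: weight_def sdeg_eq_0)
      moreover have "weight \<Delta> (sdeg \<Delta> (m' + unit_exp j)) = weight \<Delta> (sdeg \<Delta> (d + m))" by (simp add: eq)
      ultimately show ?thesis
        using lt i(1) True by (simp add: weight_add i(2) weight_unit_exp)
    qed
  qed
qed

lemma TBI_Jm:
  assumes D: "D \<in> carrier (TBI I)" and f: "f \<in> Jm I"
  shows "D f \<in> Jm I"
  unfolding Jm_iff
proof
  fix m' assume "m' \<in> keys (D f)"
  then obtain m j d where "m \<in> keys f" "d \<in> keys (D (var j))" "m' + unit_exp j = d + m"
    using keys_der[of D m' f] D TBI_iff by blast
  then show "mdeg \<Delta> m' > 0"
    using TBI_step(2)[OF D] f unfolding Jm_iff by (metis order_less_le_trans)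
qed

lemma Jm_pow: "Jm I [^]\<^bsub>ideals_set poly_ring\<^esub> n = {f. \<forall>m\<in>keys f. mdeg \<Delta> m \<ge> n}"
proof (induction n)
  case 0
  then show ?case by (simp add: ideals_set_def)
next
  case (Suc n)
  let ?A = "{f :: ('v, 'k) mpoly. \<forall>m\<in>keys f. mdeg \<Delta> m \<ge> n}"
  have "ideal_prod poly_ring ?A (Jm I) = {f. \<forall>m\<in>keys f. mdeg \<Delta> m \<ge> Suc n}"
  proof (intro equalityI subsetI)
    fix f assume "f \<in> ideal_prod poly_ring ?A (Jm I)"
    then show "f \<in> {f. \<forall>m\<in>keys f. mdeg \<Delta> m \<ge> Suc n}"
    proof (induction rule: ideal_prod.induct)
      case (prod a b)
      have "mdeg \<Delta> m \<ge> Suc n" if m: "m \<in> keys (a * b)" for m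
      proof -
        obtain x y where xy: "m = x + y" "x \<in> keys a" "y \<in> keys b"
          using keys_mult[of a b] m by blast
        then have "mdeg \<Delta> x \<ge> n" "mdeg \<Delta> y > 0" using prod by (auto simp: Jm_iff)
        then show ?thesis by (simp add: xy mdeg_add)
      qed
      then show ?case by simp
    next
      case (sum a b)
      then show ?case using keys_add[of a b] by auto
    qed
  next
    fix f :: "('v, 'k) mpoly" assume f: "f \<in> {f. \<forall>m\<in>keys f. mdeg \<Delta> m \<ge> Suc n}"
    let ?P = "\<lambda>g. g \<in> ideal_prod poly_ring ?A (Jm I)"
    show "?P f"
    proof (rule poly_sum_induct[of ?P])
      show "?P 0" using ideal_prod.prod[of 0 ?A 0 "Jm I" poly_ring] by (simp add: Jm_iff)
      show "?P (g + h)" if "?P g" "?P h" for g h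
        using ideal_prod.sum[OF that] by simp
    next
      fix m assume "m \<in> keys f"
      then have m: "mdeg \<Delta> m \<ge> Suc n" using f by blast
      then obtain i where i: "i \<in> keys m" "i \<in> noncone \<Delta>"
        using mdeg_pos_iff[of \<Delta> m] by auto
      define m0 where "m0 = m - unit_exp i"
      have m0: "m = unit_exp i + m0" using i unit_exp_le[of m i] by (simp add: m0_def in_keys_iff)
      then have "mdeg \<Delta> m0 \<ge> n" using m i by (simp add: mdeg_add mdeg_unit_exp)
      then have a: "single m0 (lookup f m) \<in> ?A" by simp
      have b: "var i \<in> Jm I" using i by (simp add: Jm_iff var_def mdeg_unit_exp)
      have "var i * single m0 (lookup f m) = single m (lookup f m)"
        by (subst m0) (rule var_mult_single)
      then show "?P (single m (lookup f m))"
        using ideal_prod.prod[OF a b, of poly_ring] by (simp add: mult.commute)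
    qed
  qed
  then show ?case using Suc by (simp add: ideals_set_def)
qed

end

section \<open>Modules presented by additive maps\<close>

text \<open>
  \<open>M\<close>, as an additive group, is the image under \<open>\<pi>\<close> of a subgroup \<open>P\<close> of an ambient abelian group.
  That \<open>M\<close> is an abelian group is a consequence and not assumed.
\<close>

locale presentation =
  fixes P :: "'c::ab_group_add set" and \<pi> :: "'c \<Rightarrow> 'b" and M :: "('b, 'm) ring_scheme"
  assumes zero_mem: "0 \<in> P"
    and diff_mem: "\<And>x y. x \<in> P \<Longrightarrow> y \<in> P \<Longrightarrow> x - y \<in> P"
    and carrier_eq: "carrier M = \<pi> ` P"
    and add_eq: "\<And>x y. x \<in> P \<Longrightarrow> y \<in> P \<Longrightarrow> \<pi> x \<oplus>\<^bsub>M\<^esub> \<pi> y = \<pi> (x + y)"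
    and zero_eq: "\<zero>\<^bsub>M\<^esub> = \<pi> 0"
begin

lemma minus_mem: "x \<in> P \<Longrightarrow> - x \<in> P"
  using diff_mem[OF zero_mem] by simp

lemma add_mem: "x \<in> P \<Longrightarrow> y \<in> P \<Longrightarrow> x + y \<in> P"
  using diff_mem[of x "- y"] minus_mem by simp

lemma pi_mem: "x \<in> P \<Longrightarrow> \<pi> x \<in> carrier M"
  by (simp add: carrier_eq)

lemma abelian_group: "abelian_group M"
proof (rule abelian_groupI)
  show "\<exists>y\<in>carrier M. y \<oplus>\<^bsub>M\<^esub> x = \<zero>\<^bsub>M\<^esub>" if "x \<in> carrier M" for x
  proof -
    from that obtain a where "a \<in> P" "x = \<pi> a" using carrier_eq by auto
    then have "\<pi> (- a) \<in> carrier M" "\<pi> (- a) \<oplus>\<^bsub>M\<^esub> x = \<zero>\<^bsub>M\<^esub>"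
      using minus_mem by (auto simp: carrier_eq add_eq zero_eq)
    then show ?thesis by blast
  qed
qed (use zero_mem add_mem in \<open>auto simp: carrier_eq add_eq zero_eq ac_simps\<close>)

lemma pi_minus: assumes "x \<in> P" shows "\<pi> (- x) = \<ominus>\<^bsub>M\<^esub> \<pi> x"
proof -
  interpret abelian_group M by (rule abelian_group)
  show ?thesis
    using assms minus_mem by (intro minus_equality[symmetric]) (auto simp: carrier_eq add_eq zero_eq)
qed

lemma pi_diff: assumes "x \<in> P" "y \<in> P" shows "\<pi> (x - y) = \<pi> x \<ominus>\<^bsub>M\<^esub> \<pi> y"
  using add_eq[OF assms(1) minus_mem[OF assms(2)]] pi_minus[OF assms(2)] by (simp add: a_minus_def)

lemma subgroup_image:
  assumes "A \<subseteq> P" "0 \<in> A" "\<And>x y. x \<in> A \<Longrightarrow> y \<in> A \<Longrightarrow> x - y \<in> A"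
  shows "subgroup (\<pi> ` A) (add_monoid M)"
proof -
  interpret abelian_group M by (rule abelian_group)
  have m: "- x \<in> A" if "x \<in> A" for x using assms(3)[OF assms(2) that] by simp
  have p: "x + y \<in> A" if "x \<in> A" "y \<in> A" for x y using assms(3)[OF that(1) m[OF that(2)]] by simp
  show ?thesis
  proof (rule subgroup.intro)
    show "\<pi> ` A \<subseteq> carrier (add_monoid M)" using assms(1) by (auto simp: carrier_eq)
    show "x \<otimes>\<^bsub>add_monoid M\<^esub> y \<in> \<pi> ` A" if "x \<in> \<pi> ` A" "y \<in> \<pi> ` A" for x y
    proof -
      from that obtain a b where "x = \<pi> a" "y = \<pi> b" "a \<in> A" "b \<in> A" by auto
      then show ?thesis using assms(1) p by (auto simp: add_eq subset_iff)
    qed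
    show "\<one>\<^bsub>add_monoid M\<^esub> \<in> \<pi> ` A" using assms(2) by (simp add: zero_eq)
    show "inv\<^bsub>add_monoid M\<^esub> x \<in> \<pi> ` A" if x: "x \<in> \<pi> ` A" for x
    proof -
      obtain a where a: "x = \<pi> a" "a \<in> A" using x by auto
      then have "inv\<^bsub>add_monoid M\<^esub> x = \<pi> (- a)" using assms(1) pi_minus[of a] by (auto simp: a_inv_def)
      then show ?thesis using a m by simp
    qed
  qed
qed

lemma subgroup_preimage:
  assumes "subgroup W (add_monoid M)"
  shows "\<pi> 0 \<in> W" and "\<And>x y. x \<in> P \<Longrightarrow> y \<in> P \<Longrightarrow> \<pi> x \<in> W \<Longrightarrow> \<pi> y \<in> W \<Longrightarrow> \<pi> (x - y) \<in> W"
proof -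
  interpret W: subgroup W "add_monoid M" by fact
  show "\<pi> 0 \<in> W" using W.one_closed by (simp add: zero_eq)
  fix x y assume "x \<in> P" "y \<in> P" "\<pi> x \<in> W" "\<pi> y \<in> W"
  then have "\<pi> x \<oplus>\<^bsub>M\<^esub> \<ominus>\<^bsub>M\<^esub> \<pi> y \<in> W"
    using W.m_closed W.m_inv_closed by (simp add: a_inv_def)
  then show "\<pi> (x - y) \<in> W" using \<open>x \<in> P\<close> \<open>y \<in> P\<close> by (simp add: pi_diff a_minus_def)
qed

end

text \<open>A presented module together with a submodule that is the image of a subgroup \<open>Q\<close> of \<open>P\<close>.\<close>

locale quotient_presentation = presentation P \<pi> M
  for P :: "'c::ab_group_add set" and \<pi> :: "'c \<Rightarrow> 'b" and M :: "('a, 'b) module" +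
  fixes Q :: "'c set" and W :: "'b set"
  assumes Q_sub: "Q \<subseteq> P" and Q_zero: "0 \<in> Q"
    and Q_diff: "\<And>x y. x \<in> Q \<Longrightarrow> y \<in> Q \<Longrightarrow> x - y \<in> Q"
    and W_eq: "W = \<pi> ` Q"
begin

abbreviation coset :: "'c \<Rightarrow> 'b set" where "coset x \<equiv> W +>\<^bsub>M\<^esub> \<pi> x"

lemma Q_minus: "x \<in> Q \<Longrightarrow> - x \<in> Q" using Q_diff[OF Q_zero] by simp
lemma Q_add: "x \<in> Q \<Longrightarrow> y \<in> Q \<Longrightarrow> x + y \<in> Q" using Q_diff[of x "- y"] Q_minus by simp

lemma coset_eq: assumes "x \<in> P" shows "coset x = \<pi> ` {y \<in> P. y - x \<in> Q}"
proof -
  have "coset x = {\<pi> (h + x) | h. h \<in> Q}"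
    using Q_sub assms by (auto simp: a_r_coset_def' W_eq add_eq subset_iff)
  also have "\<dots> = \<pi> ` {y \<in> P. y - x \<in> Q}"
  proof (intro equalityI subsetI)
    fix u assume "u \<in> {\<pi> (h + x) | h. h \<in> Q}"
    then obtain h where "h \<in> Q" "u = \<pi> (h + x)" by blast
    then show "u \<in> \<pi> ` {y \<in> P. y - x \<in> Q}" using Q_sub assms add_mem by (intro image_eqI[of _ _ "h + x"]) auto
  next
    fix u assume "u \<in> \<pi> ` {y \<in> P. y - x \<in> Q}"
    then obtain y where "y \<in> P" "y - x \<in> Q" "u = \<pi> y" by blast
    then show "u \<in> {\<pi> (h + x) | h. h \<in> Q}" by (intro CollectI exI[of _ "y - x"]) auto
  qed
  finally show ?thesis .
qed

lemma coset_cong: assumes "x \<in> P" "y \<in> P" "x - y \<in> Q" shows "coset x = coset y"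
proof -
  have "z - x \<in> Q \<longleftrightarrow> z - y \<in> Q" for z
    using Q_add[of "z - x" "x - y"] Q_diff[of "z - y" "x - y"] assms(3) by auto
  then show ?thesis using assms by (simp add: coset_eq)
qed

lemma coset_eq_iff:
  assumes ker: "\<And>x. x \<in> P \<Longrightarrow> \<pi> x \<in> W \<Longrightarrow> x \<in> Q" and "x \<in> P" "y \<in> P"
  shows "coset x = coset y \<longleftrightarrow> x - y \<in> Q"
proof
  assume "coset x = coset y"
  moreover have "\<pi> x \<in> coset x" using assms Q_zero by (auto simp: coset_eq)
  ultimately obtain z where z: "z \<in> P" "z - y \<in> Q" "\<pi> x = \<pi> z" using assms by (auto simp: coset_eq)
  have "\<pi> (x - y) = \<pi> (z - y)" using z assms by (simp add: pi_diff)
  then have "\<pi> (x - y) \<in> W" using z by (simp add: W_eq)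
  then show "x - y \<in> Q" using ker assms diff_mem by blast
qed (use coset_cong assms in blast)

lemma set_add_coset: assumes "x \<in> P" "y \<in> P" shows "set_add M (coset x) (coset y) = coset (x + y)"
proof -
  have "set_add M (coset x) (coset y) = {\<pi> (a + b) | a b. a \<in> P \<and> b \<in> P \<and> a - x \<in> Q \<and> b - y \<in> Q}"
    using assms by (auto simp: set_add_def' coset_eq add_eq)
  also have "\<dots> = coset (x + y)"
  proof (intro equalityI subsetI)
    fix u assume "u \<in> {\<pi> (a + b) | a b. a \<in> P \<and> b \<in> P \<and> a - x \<in> Q \<and> b - y \<in> Q}"
    then obtain a b where ab: "u = \<pi> (a + b)" "a \<in> P" "b \<in> P" "a - x \<in> Q" "b - y \<in> Q" by blast
    then have "(a + b) - (x + y) \<in> Q" using Q_add[of "a - x" "b - y"] by (simp add: algebra_simps)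
    then show "u \<in> coset (x + y)" using ab assms add_mem by (auto simp: coset_eq)
  next
    fix u assume "u \<in> coset (x + y)"
    then obtain z where z: "u = \<pi> z" "z \<in> P" "z - (x + y) \<in> Q" using assms add_mem by (auto simp: coset_eq)
    then have "z - y - x \<in> Q" by (simp add: algebra_simps)
    then show "u \<in> {\<pi> (a + b) | a b. a \<in> P \<and> b \<in> P \<and> a - x \<in> Q \<and> b - y \<in> Q}"
      using z assms diff_mem Q_zero by (intro CollectI exI[of _ "z - y"] exI[of _ y]) auto
  qed
  finally show ?thesis .
qed

lemma UN_coset:
  assumes "x \<in> P" "\<And>y. y \<in> P \<Longrightarrow> f (\<pi> y) = \<pi> (g y)" "\<And>y. y \<in> P \<Longrightarrow> g y \<in> P"
    and "\<And>y. y \<in> P \<Longrightarrow> y - x \<in> Q \<Longrightarrow> g y - g x \<in> Q"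
  shows "(\<Union>u\<in>coset x. W +>\<^bsub>M\<^esub> f u) = coset (g x)"
proof -
  have "W +>\<^bsub>M\<^esub> f u = coset (g x)" if "u \<in> coset x" for u
  proof -
    from that obtain y where y: "y \<in> P" "y - x \<in> Q" "u = \<pi> y" using assms(1) by (auto simp: coset_eq)
    then show ?thesis using assms coset_cong[of "g y" "g x"] by simp
  qed
  moreover have "\<pi> x \<in> coset x" using assms Q_zero by (auto simp: coset_eq)
  ultimately show ?thesis by blast
qed

lemma quot_presentation: "presentation P coset (quot_module M W)"
proof
  show "carrier (quot_module M W) = coset ` P"
    by (auto simp: quot_module_def mk_module_def A_RCOSETS_def' carrier_eq)
  show "coset x \<oplus>\<^bsub>quot_module M W\<^esub> coset y = coset (x + y)" if "x \<in> P" "y \<in> P" for x y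
    using that by (simp add: quot_module_def mk_module_def set_add_coset)
  have "{y \<in> P. y - 0 \<in> Q} = Q" using Q_sub by auto
  then have "coset 0 = W" unfolding coset_eq[OF zero_mem] by (simp add: W_eq)
  then show "\<zero>\<^bsub>quot_module M W\<^esub> = coset 0" by (simp add: quot_module_def mk_module_def)
qed (use zero_mem diff_mem in auto)

lemma quot_smult:
  assumes "x \<in> P" "\<And>y. y \<in> P \<Longrightarrow> a \<odot>\<^bsub>M\<^esub> \<pi> y = \<pi> (g y)" "\<And>y. y \<in> P \<Longrightarrow> g y \<in> P"
    and "\<And>y. y \<in> P \<Longrightarrow> y - x \<in> Q \<Longrightarrow> g y - g x \<in> Q"
  shows "a \<odot>\<^bsub>quot_module M W\<^esub> coset x = coset (g x)"
  using UN_coset[OF assms(1), of "\<lambda>u. a \<odot>\<^bsub>M\<^esub> u" g] assms by (simp add: quot_module_def mk_module_def)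

end

section \<open>Extension of scalars\<close>

text \<open>
  The extension of \<open>f\<close> from a basis to formal integer combinations, with values in a multiplicatively
  written commutative group.
\<close>

definition (in comm_group) frag_prod :: "('c \<Rightarrow> 'a) \<Rightarrow> ('c \<Rightarrow>\<^sub>0 int) \<Rightarrow> 'a" where
  "frag_prod f c = finprod G (\<lambda>q. f q [^] lookup c q) (keys c)"

context comm_group begin

lemma frag_prod_superset:
  assumes "finite A" "keys c \<subseteq> A" "f ` A \<subseteq> carrier G"
  shows "frag_prod f c = finprod G (\<lambda>q. f q [^] lookup c q) A"
  unfolding frag_prod_def using assms
  by (intro finprod_mono_neutral_cong_left) (auto simp: in_keys_iff)

lemma frag_prod_hom:
  assumes "f ` T \<subseteq> carrier G"
  shows "frag_prod f \<in> hom (free_Abelian_group T) G"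
proof (rule homI)
  fix c d assume cd: "c \<in> carrier (free_Abelian_group T)" "d \<in> carrier (free_Abelian_group T)"
  let ?A = "keys c \<union> keys d"
  have A: "finite ?A" "f ` ?A \<subseteq> carrier G" using cd assms by auto
  have fA: "f q \<in> carrier G" if "q \<in> ?A" for q using A that by blast
  have "frag_prod f (c + d) = finprod G (\<lambda>q. f q [^] lookup c q \<otimes> f q [^] lookup d q) ?A"
    using frag_prod_superset[of ?A "c + d" f] A keys_add[of c d] fA
    by (simp add: lookup_add int_pow_mult cong: finprod_cong)
  also have "\<dots> = frag_prod f c \<otimes> frag_prod f d"
    using A fA by (subst finprod_multf) (auto simp: frag_prod_superset[of ?A])
  finally show "frag_prod f (c \<otimes>\<^bsub>free_Abelian_group T\<^esub> d) = frag_prod f c \<otimes> frag_prod f d" by simp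
next
  fix c assume "c \<in> carrier (free_Abelian_group T)"
  then show "frag_prod f c \<in> carrier G" unfolding frag_prod_def using assms by (intro finprod_closed) auto
qed

lemma frag_prod_frag_of: "f q \<in> carrier G \<Longrightarrow> frag_prod f (frag_of q) = f q"
  by (simp add: frag_prod_def)

end

text \<open>
  The data that \<^const>\<open>base_change\<close> needs in order to be a well-behaved \<open>S\<close>-module: neither the
  module axioms of \<open>M\<close> nor multiplicativity of \<open>\<phi>\<close> play a role.
\<close>

locale scalar_extension = S: cring S + M: abelian_group M
  for \<phi> :: "'a \<Rightarrow> 's" and A :: "'a ring" and S :: "'s ring" and M :: "('a, 'b) module" +
  assumes phi_closed: "\<And>a. a \<in> carrier A \<Longrightarrow> \<phi> a \<in> carrier S"
    and scal_closed: "\<And>a x. a \<in> carrier A \<Longrightarrow> x \<in> carrier M \<Longrightarrow> a \<odot>\<^bsub>M\<^esub> x \<in> carrier M"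
begin

abbreviation "F \<equiv> tensor_free S M"
abbreviation "K \<equiv> tensor_rels \<phi> A S M"
abbreviation "T \<equiv> base_change \<phi> A S M"
abbreviation "tens \<equiv> pure_tensor \<phi> A S M"
text \<open>The formal integer combinations of pairs of a scalar and a module element, and their classes.\<close>

definition "fsums = {c :: ('s \<times> 'b) \<Rightarrow>\<^sub>0 int. keys c \<subseteq> carrier S \<times> carrier M}"
abbreviation cls :: "(('s \<times> 'b) \<Rightarrow>\<^sub>0 int) \<Rightarrow> (('s \<times> 'b) \<Rightarrow>\<^sub>0 int) set" where
  "cls c \<equiv> K #>\<^bsub>F\<^esub> c"

text \<open>The bilinearity relations that generate \<open>K\<close>.\<close>

definition "relators =
    ({frag_of (s \<oplus>\<^bsub>S\<^esub> s', x) - frag_of (s, x) - frag_of (s', x) | s s' x.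
        s \<in> carrier S \<and> s' \<in> carrier S \<and> x \<in> carrier M} \<union>
     {frag_of (s, x \<oplus>\<^bsub>M\<^esub> x') - frag_of (s, x) - frag_of (s, x') | s x x'.
        s \<in> carrier S \<and> x \<in> carrier M \<and> x' \<in> carrier M} \<union>
     {frag_of (s \<otimes>\<^bsub>S\<^esub> \<phi> a, x) - frag_of (s, a \<odot>\<^bsub>M\<^esub> x) | s a x.
        s \<in> carrier S \<and> a \<in> carrier A \<and> x \<in> carrier M})"

lemma F_eq: "F = free_Abelian_group (carrier S \<times> carrier M)"
  by (simp add: tensor_free_def)

lemma K_eq: "K = generate F relators"
  by (simp add: tensor_rels_def relators_def)

lemma carrier_F: "carrier F = fsums"
  by (auto simp: F_eq fsums_def)

lemma fsums_diff: "c \<in> fsums \<Longrightarrow> d \<in> fsums \<Longrightarrow> c - d \<in> fsums"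
  using keys_diff[of c d] by (auto simp: fsums_def)

lemma fsums_zero: "0 \<in> fsums" by (simp add: fsums_def)

lemma fsums_frag: "s \<in> carrier S \<Longrightarrow> x \<in> carrier M \<Longrightarrow> frag_of (s, x) \<in> fsums"
  by (simp add: fsums_def)

lemma relators_fsums: "relators \<subseteq> fsums"
  unfolding relators_def using phi_closed scal_closed
  by (auto intro!: fsums_diff fsums_frag)

lemma group_F: "group F" by (simp add: F_eq)

lemma K_subgroup: "subgroup K F"
  unfolding K_eq by (rule group.generate_is_subgroup[OF group_F]) (simp add: carrier_F relators_fsums)

lemma K_fsums: "K \<subseteq> fsums"
  using subgroup.subset[OF K_subgroup] carrier_F by simp

lemma K_zero: "0 \<in> K"
  using subgroup.one_closed[OF K_subgroup] by (simp add: F_eq)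

lemma K_diff: assumes "c \<in> K" "d \<in> K" shows "c - d \<in> K"
proof -
  have "d \<in> fsums" using assms K_fsums by blast
  then have "inv\<^bsub>F\<^esub> d = - d" unfolding F_eq fsums_def by simp
  then show ?thesis
    using subgroup.m_closed[OF K_subgroup assms(1) subgroup.m_inv_closed[OF K_subgroup assms(2)]]
    by (simp add: F_eq)
qed

lemma K_minimal:
  assumes "0 \<in> H" "\<And>c d. c \<in> H \<Longrightarrow> d \<in> H \<Longrightarrow> c - d \<in> H" "relators \<subseteq> H" "H \<subseteq> fsums"
  shows "K \<subseteq> H"
proof -
  have m: "- c \<in> H" if "c \<in> H" for c using assms(2)[OF assms(1) that] by simp
  have p: "c + d \<in> H" if "c \<in> H" "d \<in> H" for c d using assms(2)[OF that(1) m[OF that(2)]] by simp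
  have "inv\<^bsub>F\<^esub> d = - d" if "d \<in> H" for d
    using that assms(4) unfolding F_eq fsums_def by (intro inv_free_Abelian_group) auto
  then have "subgroup H F"
    using assms m p by (intro subgroup.intro) (auto simp: carrier_F, auto simp: F_eq)
  then show ?thesis unfolding K_eq using group.generate_subgroup_incl[OF group_F] assms(3) by blast
qed

lemma relators_K: "relators \<subseteq> K"
  unfolding K_eq by (auto intro: generate.incl)

lemma cls_eq: assumes "c \<in> fsums" shows "cls c = {d \<in> fsums. d - c \<in> K}"
proof -
  have "cls c = {k + c | k. k \<in> K}" by (auto simp: r_coset_def F_eq)
  moreover have "k + c \<in> fsums" if "k \<in> K" for k
    using that K_fsums assms fsums_diff[of k "- c"] fsums_diff[OF fsums_zero, of c] by auto
  ultimately show ?thesis by (auto intro: exI[of _ "_ - c"])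
qed

lemma cls_cong: assumes "c \<in> fsums" "d \<in> fsums" "c - d \<in> K" shows "cls c = cls d"
proof -
  have "z - c \<in> K \<longleftrightarrow> z - d \<in> K" for z
    using K_diff[of "z - d" "c - d"] K_diff[of "z - c" "d - c"] K_diff[OF K_zero assms(3)] assms(3)
    by auto
  then show ?thesis using assms by (simp add: cls_eq)
qed

lemma cls_self: "c \<in> fsums \<Longrightarrow> c \<in> cls c"
  using K_zero by (simp add: cls_eq)

lemma presentation_T: "presentation fsums cls T"
proof
  show "carrier T = cls ` fsums"
    by (auto simp: base_change_def Let_def mk_module_def FactGroup_def RCOSETS_def carrier_F)
  show "cls c \<oplus>\<^bsub>T\<^esub> cls d = cls (c + d)" if cd: "c \<in> fsums" "d \<in> fsums" for c d
  proof -
    have "comm_group F" by (simp add: F_eq abelian_free_Abelian_group)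
    then have "normal K F" using K_subgroup by (simp add: comm_group.subgroup_imp_normal)
    then have "set_mult F (cls c) (cls d) = cls (c \<otimes>\<^bsub>F\<^esub> d)"
      using cd by (intro normal.rcos_sum) (simp_all add: carrier_F)
    then show ?thesis by (simp add: base_change_def Let_def mk_module_def FactGroup_def F_eq)
  qed
  have "cls 0 = K" using K_fsums fsums_zero by (auto simp: cls_eq)
  then show "\<zero>\<^bsub>T\<^esub> = cls 0" by (simp add: base_change_def Let_def mk_module_def FactGroup_def)
qed (auto intro: fsums_diff fsums_zero)

lemma T_abelian_group: "abelian_group T"
  by (rule presentation.abelian_group[OF presentation_T])

lemma tens_eq: "tens s x = cls (frag_of (s, x))"
  by (simp add: pure_tensor_def)

lemma tens_closed: "s \<in> carrier S \<Longrightarrow> x \<in> carrier M \<Longrightarrow> tens s x \<in> carrier T"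
  unfolding tens_eq using presentation.pi_mem[OF presentation_T] fsums_frag by blast

lemma tens_add_right:
  assumes "s \<in> carrier S" "x \<in> carrier M" "x' \<in> carrier M"
  shows "tens s (x \<oplus>\<^bsub>M\<^esub> x') = tens s x \<oplus>\<^bsub>T\<^esub> tens s x'"
proof -
  have "frag_of (s, x \<oplus>\<^bsub>M\<^esub> x') - frag_of (s, x) - frag_of (s, x') \<in> K"
    by (rule subsetD[OF relators_K]) (use assms in \<open>auto simp: relators_def\<close>)
  then have "cls (frag_of (s, x \<oplus>\<^bsub>M\<^esub> x')) = cls (frag_of (s, x) + frag_of (s, x'))"
    using assms by (intro cls_cong fsums_frag presentation.add_mem[OF presentation_T]) (auto simp: algebra_simps)
  then show ?thesis using assms by (simp add: tens_eq presentation.add_eq[OF presentation_T] fsums_frag)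
qed

lemma tens_balanced:
  assumes "s \<in> carrier S" "a \<in> carrier A" "x \<in> carrier M"
  shows "tens (s \<otimes>\<^bsub>S\<^esub> \<phi> a) x = tens s (a \<odot>\<^bsub>M\<^esub> x)"
proof -
  have "frag_of (s \<otimes>\<^bsub>S\<^esub> \<phi> a, x) - frag_of (s, a \<odot>\<^bsub>M\<^esub> x) \<in> K"
    by (rule subsetD[OF relators_K]) (use assms in \<open>auto simp: relators_def\<close>)
  then show ?thesis
    using assms phi_closed scal_closed by (simp add: tens_eq cls_cong fsums_frag)
qed

lemma tens_phi:
  assumes "a \<in> carrier A" "x \<in> carrier M"
  shows "tens (\<phi> a) x = tens \<one>\<^bsub>S\<^esub> (a \<odot>\<^bsub>M\<^esub> x)"
  using tens_balanced[of "\<one>\<^bsub>S\<^esub>" a x] assms phi_closed by simp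

text \<open>
  Along a surjection, the relations \<open>\<phi> a \<otimes> x = 1 \<otimes> a x\<close> turn every element into a pure tensor with
  left factor 1.
\<close>

lemma carrier_T_eq:
  assumes surj: "\<phi> ` carrier A = carrier S"
  shows "carrier T = tens \<one>\<^bsub>S\<^esub> ` carrier M"
proof
  interpret T: presentation fsums cls T by (rule presentation_T)
  show "tens \<one>\<^bsub>S\<^esub> ` carrier M \<subseteq> carrier T" by (auto intro: tens_closed)
  have add: "tens \<one>\<^bsub>S\<^esub> x \<ominus>\<^bsub>T\<^esub> tens \<one>\<^bsub>S\<^esub> y = tens \<one>\<^bsub>S\<^esub> (x \<ominus>\<^bsub>M\<^esub> y)"
    if "x \<in> carrier M" "y \<in> carrier M" for x y
  proof -
    interpret TG: abelian_group T by (rule T_abelian_group)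
    have "tens \<one>\<^bsub>S\<^esub> (x \<ominus>\<^bsub>M\<^esub> y) \<oplus>\<^bsub>T\<^esub> tens \<one>\<^bsub>S\<^esub> y = tens \<one>\<^bsub>S\<^esub> (x \<ominus>\<^bsub>M\<^esub> y \<oplus>\<^bsub>M\<^esub> y)"
      using that by (simp add: tens_add_right)
    also have "x \<ominus>\<^bsub>M\<^esub> y \<oplus>\<^bsub>M\<^esub> y = x" using that by (simp add: a_minus_def M.a_assoc M.l_neg)
    finally show ?thesis
      using that tens_closed by (metis M.minus_closed S.one_closed TG.add.inv_solve_right a_minus_def)
  qed
  have "cls c \<in> tens \<one>\<^bsub>S\<^esub> ` carrier M" if c: "c \<in> fsums" for c
  proof -
    have "c \<in> fsums \<and> cls c \<in> tens \<one>\<^bsub>S\<^esub> ` carrier M"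
      using c[unfolded fsums_def mem_Collect_eq]
    proof (induction c rule: frag_induction)
      case zero
      interpret TG: abelian_group T by (rule T_abelian_group)
      have "tens \<one>\<^bsub>S\<^esub> (\<zero>\<^bsub>M\<^esub> \<ominus>\<^bsub>M\<^esub> \<zero>\<^bsub>M\<^esub>) = \<zero>\<^bsub>T\<^esub>"
        using add[of "\<zero>\<^bsub>M\<^esub>" "\<zero>\<^bsub>M\<^esub>"] tens_closed[of "\<one>\<^bsub>S\<^esub>" "\<zero>\<^bsub>M\<^esub>"] by (simp add: a_minus_def TG.r_neg)
      then show ?case using T.zero_eq fsums_zero M.minus_closed by (metis M.zero_closed image_iff)
    next
      case (one p)
      then obtain a x where "p = (\<phi> a, x)" "a \<in> carrier A" "x \<in> carrier M" using surj by force
      then show ?case using tens_phi[of a x] scal_closed phi_closed fsums_frag by (auto simp: tens_eq)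
    next
      case (diff c d)
      then obtain x y where xy: "cls c = tens \<one>\<^bsub>S\<^esub> x" "cls d = tens \<one>\<^bsub>S\<^esub> y" "x \<in> carrier M" "y \<in> carrier M"
        by auto
      then have "cls (c - d) = tens \<one>\<^bsub>S\<^esub> (x \<ominus>\<^bsub>M\<^esub> y)"
        using diff add by (simp add: T.pi_diff)
      then show ?case using diff fsums_diff xy M.minus_closed by blast
    qed
    then show ?thesis by blast
  qed
  then show "carrier T \<subseteq> tens \<one>\<^bsub>S\<^esub> ` carrier M" by (auto simp: T.carrier_eq)
qed

lemma tens_smult:
  assumes t: "t \<in> carrier S" and "s \<in> carrier S" "x \<in> carrier M"
  shows "t \<odot>\<^bsub>T\<^esub> tens s x = tens (t \<otimes>\<^bsub>S\<^esub> s) x"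
proof -
  let ?g = "frag_extend (\<lambda>(s, x). frag_of (t \<otimes>\<^bsub>S\<^esub> s, x)) :: (('s \<times> 'b) \<Rightarrow>\<^sub>0 int) \<Rightarrow> _"
  have g_fsums: "?g c \<in> fsums" if "c \<in> fsums" for c
  proof -
    have "keys (?g c) \<subseteq> (\<Union>p\<in>keys c. keys ((\<lambda>(s, x). frag_of (t \<otimes>\<^bsub>S\<^esub> s, x)) p :: ('s \<times> 'b) \<Rightarrow>\<^sub>0 int))"
      by (rule keys_frag_extend)
    also have "\<dots> \<subseteq> carrier S \<times> carrier M" using that t by (auto simp: fsums_def split: prod.splits)
    finally show ?thesis by (simp add: fsums_def)
  qed
  have "K \<subseteq> {c \<in> fsums. ?g c \<in> K}"
  proof (rule K_minimal)
    have r: "?g c \<in> relators" if "c \<in> relators" for c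
      using that unfolding relators_def
    proof (elim UnE CollectE exE conjE, goal_cases)
      case (1 s s' x)
      then show ?case
        using t by (intro UnI1 CollectI exI[of _ "t \<otimes>\<^bsub>S\<^esub> s"] exI[of _ "t \<otimes>\<^bsub>S\<^esub> s'"] exI[of _ x])
          (simp add: frag_extend_diff S.r_distr)
    next
      case (2 s x x')
      then show ?case
        using t by (intro UnI1 UnI2 CollectI exI[of _ "t \<otimes>\<^bsub>S\<^esub> s"] exI[of _ x] exI[of _ x'])
          (simp add: frag_extend_diff)
    next
      case (3 s a x)
      then show ?case
        using t phi_closed by (intro UnI2 CollectI exI[of _ "t \<otimes>\<^bsub>S\<^esub> s"] exI[of _ a] exI[of _ x])
          (simp add: frag_extend_diff S.m_assoc)
    qed
    show "relators \<subseteq> {c \<in> fsums. ?g c \<in> K}" using r relators_K relators_fsums by blast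
  qed (auto simp: frag_extend_diff fsums_zero K_zero intro: fsums_diff K_diff)
  then have gK: "?g c \<in> K" if "c \<in> K" for c using that by blast
  let ?c = "frag_of (s, x)"
  have c: "?c \<in> fsums" using assms fsums_frag by blast
  have "cls (?g d) = cls (?g ?c)" if "d \<in> cls ?c" for d
    using that c gK[of "d - ?c"] by (intro cls_cong g_fsums) (auto simp: cls_eq frag_extend_diff)
  then have "(\<Union>d\<in>cls ?c. cls (?g d)) = cls (?g ?c)" using cls_self[OF c] by blast
  then show ?thesis by (simp add: tens_eq base_change_def Let_def mk_module_def)
qed

text \<open>
  A balanced biadditive map vanishes on the relations, so that the description in the definition of
  \<^const>\<open>tensor_lift\<close> determines a unique value.
\<close>

lemma tensor_lift_tens:
  fixes P :: "('p, 'c) ring_scheme"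
  assumes P: "abelian_group P"
    and f: "\<And>s x. s \<in> carrier S \<Longrightarrow> x \<in> carrier M \<Longrightarrow> f (s, x) \<in> carrier P"
    and f_left: "\<And>s s' x. s \<in> carrier S \<Longrightarrow> s' \<in> carrier S \<Longrightarrow> x \<in> carrier M \<Longrightarrow>
      f (s \<oplus>\<^bsub>S\<^esub> s', x) = f (s, x) \<oplus>\<^bsub>P\<^esub> f (s', x)"
    and f_right: "\<And>s x x'. s \<in> carrier S \<Longrightarrow> x \<in> carrier M \<Longrightarrow> x' \<in> carrier M \<Longrightarrow>
      f (s, x \<oplus>\<^bsub>M\<^esub> x') = f (s, x) \<oplus>\<^bsub>P\<^esub> f (s, x')"
    and f_bal: "\<And>s a x. s \<in> carrier S \<Longrightarrow> a \<in> carrier A \<Longrightarrow> x \<in> carrier M \<Longrightarrow>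
      f (s \<otimes>\<^bsub>S\<^esub> \<phi> a, x) = f (s, a \<odot>\<^bsub>M\<^esub> x)"
    and s: "s \<in> carrier S" and x: "x \<in> carrier M"
  shows "tensor_lift P f (tens s x) = f (s, x)"
proof -
  interpret P: abelian_group P by (rule P)
  note C = P.a_comm_group
  let ?ev = "comm_group.frag_prod (add_monoid P) f"
  have ev_eq: "(\<Oplus>\<^bsub>P\<^esub>q\<in>keys c. add_pow P (lookup c q) (f q)) = ?ev c" for c
    by (simp add: comm_group.frag_prod_def[OF C] finsum_def add_pow_def)
  have hom: "?ev \<in> hom F (add_monoid P)"
    unfolding F_eq by (rule comm_group.frag_prod_hom[OF C]) (use f in auto)
  have ev_add: "?ev (c + d) = ?ev c \<oplus>\<^bsub>P\<^esub> ?ev d" if "c \<in> fsums" "d \<in> fsums" for c d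
    using hom_mult[OF hom, of c d] that by (simp add: carrier_F) (simp add: F_eq)
  have ev_closed: "?ev c \<in> carrier P" if "c \<in> fsums" for c
    using hom_in_carrier[OF hom, of c] that by (simp add: carrier_F)
  have ev_diff: "?ev (c - d) = ?ev c \<ominus>\<^bsub>P\<^esub> ?ev d" if "c \<in> fsums" "d \<in> fsums" for c d
  proof -
    have "?ev (c - d) \<oplus>\<^bsub>P\<^esub> ?ev d = ?ev c" using ev_add[OF fsums_diff[OF that] that(2)] by simp
    then show ?thesis
      using ev_closed[OF that(1)] ev_closed[OF that(2)] ev_closed[OF fsums_diff[OF that]]
      by (metis P.add.inv_solve_right a_minus_def)
  qed
  have ev_frag: "?ev (frag_of (s, x)) = f (s, x)" if "s \<in> carrier S" "x \<in> carrier M" for s x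
    using f[OF that] by (simp add: comm_group.frag_prod_frag_of[OF C])
  have "K \<subseteq> {c \<in> fsums. ?ev c = \<zero>\<^bsub>P\<^esub>}"
  proof (rule K_minimal)
    show "0 \<in> {c \<in> fsums. ?ev c = \<zero>\<^bsub>P\<^esub>}" by (simp add: fsums_zero flip: ev_eq)
    show "c - d \<in> {c \<in> fsums. ?ev c = \<zero>\<^bsub>P\<^esub>}"
      if "c \<in> {c \<in> fsums. ?ev c = \<zero>\<^bsub>P\<^esub>}" "d \<in> {c \<in> fsums. ?ev c = \<zero>\<^bsub>P\<^esub>}" for c d
      using that by (simp add: fsums_diff ev_diff a_minus_def)
    show "relators \<subseteq> {c \<in> fsums. ?ev c = \<zero>\<^bsub>P\<^esub>}"
    proof (intro subsetI CollectI conjI)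
      fix c assume c: "c \<in> relators"
      then show "c \<in> fsums" using relators_fsums by blast
      have sub: "p \<oplus>\<^bsub>P\<^esub> q \<ominus>\<^bsub>P\<^esub> p \<ominus>\<^bsub>P\<^esub> q = \<zero>\<^bsub>P\<^esub>" if "p \<in> carrier P" "q \<in> carrier P" for p q
        using that by (simp add: a_minus_def P.a_ac) (metis P.a_comm P.a_inv_closed P.add.m_closed P.add.inv_solve_right' P.l_zero P.r_neg P.r_neg2)
      show "?ev c = \<zero>\<^bsub>P\<^esub>"
        using c unfolding relators_def
      proof (elim UnE CollectE exE conjE, goal_cases)
        case (1 s s' x)
        then show ?case by (simp add: ev_diff fsums_diff fsums_frag ev_frag f_left f sub)
      next
        case (2 s x x')
        then show ?case by (simp add: ev_diff fsums_diff fsums_frag ev_frag f_right f sub)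
      next
        case (3 s a x)
        then show ?case
          using phi_closed scal_closed by (simp add: ev_diff fsums_frag ev_frag f_bal f a_minus_def P.r_neg)
      qed
    qed
  qed auto
  then have evK: "?ev k = \<zero>\<^bsub>P\<^esub>" if "k \<in> K" for k using that by blast
  let ?c = "frag_of (s, x)"
  have c: "?c \<in> fsums" using s x fsums_frag by blast
  have "?ev d = f (s, x)" if "d \<in> cls ?c" for d
  proof -
    have d: "d \<in> fsums" "d - ?c \<in> K" using that c by (auto simp: cls_eq)
    then have "?ev d = ?ev (d - ?c) \<oplus>\<^bsub>P\<^esub> ?ev ?c" using ev_add[OF fsums_diff[OF d(1) c] c] by simp
    then show ?thesis using d evK s x f by (simp add: ev_frag)
  qed
  then have "(THE p. \<exists>d\<in>cls ?c. p = ?ev d) = f (s, x)"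
    using cls_self[OF c] by (intro the_equality) auto
  then show ?thesis by (simp add: tensor_lift_def tens_eq ev_eq)
qed

end

lemma mk_module_sel [simp]:
  "carrier (mk_module C pl z sm) = C" "ring.add (mk_module C pl z sm) = pl"
  "ring.zero (mk_module C pl z sm) = z" "module.smult (mk_module C pl z sm) = sm"
  by (simp_all add: mk_module_def)

section \<open>Residue classes of polynomials\<close>

lemma ideal_quotient_presentation:
  fixes H :: "('v, 'k::field) mpoly set"
  assumes "ideal H poly_ring"
  shows "quotient_presentation UNIV (\<lambda>x. x) (self_module poly_ring) H H"
proof -
  have H: "0 \<in> H \<and> (\<forall>x\<in>H. \<forall>y\<in>H. x + y \<in> H) \<and> (\<forall>a. \<forall>x\<in>H. a * x \<in> H)"
    using assms unfolding ideal_poly_iff .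
  have "x - y \<in> H" if "x \<in> H" "y \<in> H" for x y
  proof -
    have "x + (- 1) * y \<in> H" using H that by blast
    then show ?thesis by simp
  qed
  with H show ?thesis by unfold_locales (auto simp: self_module_def)
qed

lemma self_module_coset: "W +>\<^bsub>self_module A\<^esub> x = W +>\<^bsub>A\<^esub> x"
  by (simp add: self_module_def a_r_coset_def')

lemma ideal_coset_eq_iff:
  fixes H :: "('v, 'k::field) mpoly set"
  assumes "ideal H poly_ring"
  shows "H +>\<^bsub>poly_ring\<^esub> f = H +>\<^bsub>poly_ring\<^esub> g \<longleftrightarrow> f - g \<in> H"
  using quotient_presentation.coset_eq_iff[OF ideal_quotient_presentation[OF assms]]
  by (simp add: self_module_coset)

lemma in_ideal_coset_iff:
  "g \<in> H +>\<^bsub>poly_ring\<^esub> f \<longleftrightarrow> g - f \<in> H" for f g :: "('v, 'k::field) mpoly"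
  by (auto simp: a_r_coset_def') (metis diff_add_cancel)

lemma induced_coset:
  fixes H :: "('v, 'k::field) mpoly set"
  assumes "ideal H poly_ring" "D \<in> ders" "D ` H \<subseteq> H"
  shows "induced poly_ring H D (H +>\<^bsub>poly_ring\<^esub> f) = H +>\<^bsub>poly_ring\<^esub> D f"
proof -
  have "D y - D f \<in> H" if "y - f \<in> H" for y
    using that assms(3) by (auto simp: der_diff[OF assms(2), symmetric])
  then show ?thesis
    using quotient_presentation.UN_coset[OF ideal_quotient_presentation[OF assms(1)], of f D D]
    by (simp add: induced_def self_module_coset)
qed

section \<open>Modules of derivations\<close>

lemma der_module_closed:
  fixes R :: "'a ring" (structure)
  assumes "cring R" "K \<subseteq> carrier R" "D \<in> derivations K R"
  shows "E \<in> derivations K R \<Longrightarrow> (\<lambda>a\<in>carrier R. D a \<oplus> E a) \<in> derivations K R"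
    and "b \<in> carrier R \<Longrightarrow> (\<lambda>a\<in>carrier R. b \<otimes> D a) \<in> derivations K R"
proof -
  interpret cring R by fact
  have cl: "D a \<in> carrier R" if "D \<in> derivations K R" "a \<in> carrier R" for D a
    using that by (auto simp: derivations_def)
  note D = cl[OF assms(3)]
  show "(\<lambda>a\<in>carrier R. D a \<oplus> E a) \<in> derivations K R" if E: "E \<in> derivations K R"
    using assms that D cl[OF E] unfolding derivations_def
    by (auto simp: subset_iff l_distr r_distr a_ac)
  show "(\<lambda>a\<in>carrier R. b \<otimes> D a) \<in> derivations K R" if "b \<in> carrier R"
    using assms that D unfolding derivations_def
    by (auto simp: subset_iff l_distr r_distr m_ac)
qed

lemma der_module_abelian_group:
  fixes R :: "'a ring" (structure)
  assumes "cring R" "K \<subseteq> carrier R"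
  shows "abelian_group (der_module K R)"
proof (rule abelian_groupI)
  interpret cring R by fact
  note cl = der_module_closed[OF assms]
  have val: "D a \<in> carrier R" if "D \<in> derivations K R" "a \<in> carrier R" for D a
    using that by (auto simp: derivations_def)
  have ext: "D = E" if "D \<in> derivations K R" "E \<in> derivations K R" "\<And>a. a \<in> carrier R \<Longrightarrow> D a = E a" for D E
  proof -
    have "D \<in> carrier R \<rightarrow>\<^sub>E carrier R" "E \<in> carrier R \<rightarrow>\<^sub>E carrier R"
      using that by (auto simp: derivations_def)
    then show ?thesis using that(3) by (rule PiE_ext)
  qed
  have zero: "(\<lambda>a\<in>carrier R. \<zero>) \<in> derivations K R"
    using assms by (auto simp: derivations_def subset_iff)
  show "x \<oplus>\<^bsub>der_module K R\<^esub> y \<in> carrier (der_module K R)"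
    if "x \<in> carrier (der_module K R)" "y \<in> carrier (der_module K R)" for x y
    using that by (simp add: der_module_def cl)
  show "\<zero>\<^bsub>der_module K R\<^esub> \<in> carrier (der_module K R)" by (simp add: der_module_def zero)
  show "x \<oplus>\<^bsub>der_module K R\<^esub> y \<oplus>\<^bsub>der_module K R\<^esub> z = x \<oplus>\<^bsub>der_module K R\<^esub> (y \<oplus>\<^bsub>der_module K R\<^esub> z)"
    if "x \<in> carrier (der_module K R)" "y \<in> carrier (der_module K R)" "z \<in> carrier (der_module K R)" for x y z
    using that by (auto simp: der_module_def a_assoc val intro!: restrict_ext)
  show "x \<oplus>\<^bsub>der_module K R\<^esub> y = y \<oplus>\<^bsub>der_module K R\<^esub> x"
    if "x \<in> carrier (der_module K R)" "y \<in> carrier (der_module K R)" for x y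
    using that by (auto simp: der_module_def a_comm val intro!: restrict_ext)
  show "\<zero>\<^bsub>der_module K R\<^esub> \<oplus>\<^bsub>der_module K R\<^esub> x = x" if "x \<in> carrier (der_module K R)" for x
  proof -
    have x: "x \<in> derivations K R" using that by (simp add: der_module_def)
    have "(\<lambda>a\<in>carrier R. (\<lambda>a\<in>carrier R. \<zero>) a \<oplus> x a) = x"
      by (rule ext[OF cl(1)[OF zero x] x]) (simp add: val[OF x])
    then show ?thesis by (simp only: der_module_def mk_module_sel)
  qed
  show "\<exists>y\<in>carrier (der_module K R). y \<oplus>\<^bsub>der_module K R\<^esub> x = \<zero>\<^bsub>der_module K R\<^esub>"
    if "x \<in> carrier (der_module K R)" for x
  proof (rule bexI)
    have x: "x \<in> derivations K R" using that by (simp add: der_module_def)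
    show "(\<lambda>a\<in>carrier R. \<ominus> \<one> \<otimes> x a) \<in> carrier (der_module K R)"
      using cl(2)[OF x, of "\<ominus> \<one>"] by (simp add: der_module_def)
    show "(\<lambda>a\<in>carrier R. \<ominus> \<one> \<otimes> x a) \<oplus>\<^bsub>der_module K R\<^esub> x = \<zero>\<^bsub>der_module K R\<^esub>"
      by (auto simp: der_module_def val[OF x] l_minus l_neg intro!: restrict_ext)
  qed
qed

section \<open>The graded pieces\<close>

context stanley_reisner begin

text \<open>
  The polynomials in \<open>J\<^sup>n + I\<close>: monomials not supported on a face are arbitrary, the others have degree
  at least \<open>n\<close>.
\<close>

definition deg_ge :: "nat \<Rightarrow> ('v, 'k) mpoly set" where
  "deg_ge n = {f. \<forall>m\<in>keys f. keys m \<in> \<Delta> \<longrightarrow> n \<le> mdeg \<Delta> m}"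

lemma I_ideal: "ideal I poly_ring"
  unfolding I_def sr_ideal_def by (rule ring.genideal_ideal[OF ring_poly]) simp

lemma Jm_ideal: "ideal (Jm I) poly_ring"
  unfolding Jm_def by (rule ring.genideal_ideal[OF ring_poly]) simp

lemma max_ideal_ideal: "ideal (max_ideal :: ('v, 'k) mpoly set) poly_ring"
  unfolding max_ideal_def by (rule ring.genideal_ideal[OF ring_poly]) simp

lemma deg_ge_zero: "0 \<in> deg_ge n" by (simp add: deg_ge_def)

lemma deg_ge_diff: "f \<in> deg_ge n \<Longrightarrow> g \<in> deg_ge n \<Longrightarrow> f - g \<in> deg_ge n"
  using keys_diff[of f g] by (auto simp: deg_ge_def)

lemma deg_ge_add: "f \<in> deg_ge n \<Longrightarrow> g \<in> deg_ge n \<Longrightarrow> f + g \<in> deg_ge n"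
  using keys_add[of f g] by (auto simp: deg_ge_def)

lemma deg_ge_mult: assumes f: "f \<in> deg_ge n" shows "b * f \<in> deg_ge n"
proof -
  have "n \<le> mdeg \<Delta> m'" if "m' \<in> keys (b * f)" "keys m' \<in> \<Delta>" for m'
  proof -
    obtain u m where um: "m' = u + m" "m \<in> keys f" using keys_mult[of b f] \<open>m' \<in> keys (b * f)\<close> by blast
    then have "keys m \<in> \<Delta>" using subface[OF complex \<open>keys m' \<in> \<Delta>\<close>] by (simp add: keys_add_nat)
    then show ?thesis using f um by (auto simp: deg_ge_def mdeg_add)
  qed
  then show ?thesis by (simp add: deg_ge_def)
qed

lemma deg_ge_der: assumes D: "D \<in> carrier (TBI I)" and f: "f \<in> deg_ge n" shows "D f \<in> deg_ge n"
proof -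
  have "n \<le> mdeg \<Delta> m'" if m': "m' \<in> keys (D f)" "keys m' \<in> \<Delta>" for m'
  proof -
    obtain m j d where md: "m \<in> keys f" "lookup m j > 0" "d \<in> keys (D (var j))" "m' + unit_exp j = d + m"
      using keys_der[of D m' f] D TBI_iff m'(1) by blast
    then have "keys m \<in> \<Delta>" "mdeg \<Delta> m \<le> mdeg \<Delta> m'"
      using TBI_step(1,2)[OF D md(3,4)] m'(2) by blast+
    then show ?thesis using f md by (auto simp: deg_ge_def)
  qed
  then show ?thesis by (simp add: deg_ge_def)
qed

lemma deg_ge_Jm_mult: assumes f: "f \<in> deg_ge n" and b: "b \<in> Jm I" shows "b * f \<in> deg_ge (Suc n)"
proof -
  have "Suc n \<le> mdeg \<Delta> m'" if m': "m' \<in> keys (b * f)" "keys m' \<in> \<Delta>" for m'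
  proof -
    obtain u m where um: "m' = u + m" "u \<in> keys b" "m \<in> keys f" using keys_mult[of b f] m'(1) by blast
    then have "keys m \<in> \<Delta>" using subface[OF complex m'(2)] by (simp add: keys_add_nat)
    then have "mdeg \<Delta> m \<ge> n" "mdeg \<Delta> u > 0" using f b um by (auto simp: deg_ge_def Jm_iff)
    then show ?thesis using um by (simp add: mdeg_add)
  qed
  then show ?thesis by (simp add: deg_ge_def)
qed

lemma deg_ge_Suc: "deg_ge (Suc n) \<subseteq> deg_ge n"
  by (auto simp: deg_ge_def)

lemma I_deg_ge: "I \<subseteq> deg_ge n"
  by (auto simp: deg_ge_def I_iff)

text \<open>The class of a polynomial in the Stanley-Reisner ring.\<close>

definition sr_class :: "('v, 'k) mpoly \<Rightarrow> ('v, 'k) mpoly set" where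
  "sr_class f = I +>\<^bsub>poly_ring\<^esub> f"

lemma sr_class_presentation: "presentation UNIV sr_class (sr_module I)"
  using quotient_presentation.quot_presentation[OF ideal_quotient_presentation[OF I_ideal]]
  by (simp add: sr_module_def self_module_coset sr_class_def[abs_def])

lemma sr_class_eq_iff: "sr_class f = sr_class g \<longleftrightarrow> f - g \<in> I"
  unfolding sr_class_def by (rule ideal_coset_eq_iff[OF I_ideal])

lemma sr_class_smult: "a \<odot>\<^bsub>sr_module I\<^esub> sr_class f = sr_class (a * f)"
proof -
  have "a * y - a * f \<in> I" if "y - f \<in> I" for y
    using that I_ideal unfolding ideal_poly_iff by (simp add: right_diff_distrib[symmetric])
  then show ?thesis
    using quotient_presentation.quot_smult[OF ideal_quotient_presentation[OF I_ideal], of f a "\<lambda>y. a * y"]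
    by (simp add: sr_module_def self_module_coset sr_class_def self_module_def)
      (simp add: a_r_coset_def')
qed

lemma JnM_eq: "JnM I n = sr_class ` deg_ge n"
proof
  interpret sr_class: presentation UNIV sr_class "sr_module I" by (rule sr_class_presentation)
  have "subgroup (sr_class ` deg_ge n) (add_monoid (sr_module I))"
    by (rule sr_class.subgroup_image) (auto intro: deg_ge_zero deg_ge_diff)
  then have "submodule (sr_class ` deg_ge n) poly_ring (sr_module I)"
    by (intro submodule.intro submodule_axioms.intro) (auto simp: sr_class_smult intro: deg_ge_mult)
  moreover have "a \<odot>\<^bsub>sr_module I\<^esub> x \<in> sr_class ` deg_ge n"
    if "a \<in> Jm I [^]\<^bsub>ideals_set poly_ring\<^esub> n" "x \<in> carrier (sr_module I)" for a x
  proof -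
    from that obtain f where "x = sr_class f" using sr_class.carrier_eq by auto
    moreover have "a \<in> deg_ge n" using that(1) by (auto simp: Jm_pow deg_ge_def)
    then have "f * a \<in> deg_ge n" by (rule deg_ge_mult)
    ultimately show ?thesis by (auto simp: sr_class_smult mult.commute)
  qed
  ultimately show "JnM I n \<subseteq> sr_class ` deg_ge n" unfolding JnM_def ideal_smult_def by blast
  show "sr_class ` deg_ge n \<subseteq> JnM I n"
    unfolding JnM_def ideal_smult_def
  proof clarify
    fix f W assume f: "f \<in> deg_ge n"
      and W: "\<forall>a\<in>Jm I [^]\<^bsub>ideals_set poly_ring\<^esub> n. \<forall>x\<in>carrier (sr_module I). a \<odot>\<^bsub>sr_module I\<^esub> x \<in> W"
    let ?f = "restr {m. keys m \<in> \<Delta>} f"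
    have "?f \<in> Jm I [^]\<^bsub>ideals_set poly_ring\<^esub> n" using f by (auto simp: Jm_pow keys_restr deg_ge_def)
    moreover have "sr_class 1 \<in> carrier (sr_module I)" by (rule sr_class.pi_mem) simp
    ultimately have "?f \<odot>\<^bsub>sr_module I\<^esub> sr_class 1 \<in> W" using W by blast
    then have "sr_class ?f \<in> W" by (simp add: sr_class_smult)
    moreover have "f - ?f \<in> I" by (auto simp: I_iff in_keys_iff lookup_minus lookup_restr)
    then have "sr_class f = sr_class ?f" by (simp add: sr_class_eq_iff)
    ultimately show "sr_class f \<in> W" by simp
  qed
qed

text \<open>The class in the graded piece of degree \<open>n\<close> of a polynomial in \<open>J\<^sup>n + I\<close>.\<close>

definition gr_class :: "nat \<Rightarrow> ('v, 'k) mpoly \<Rightarrow> ('v, 'k) mpoly set set" where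
  "gr_class n f = JnM I (Suc n) +>\<^bsub>sr_module I\<^esub> sr_class f"

lemma Gr_quotient_presentation:
  "quotient_presentation (deg_ge n) sr_class ((sr_module I)\<lparr>carrier := JnM I n\<rparr>) (deg_ge (Suc n)) (JnM I (Suc n))"
proof -
  interpret sr_class: presentation UNIV sr_class "sr_module I" by (rule sr_class_presentation)
  show ?thesis
    by unfold_locales (use deg_ge_zero deg_ge_diff deg_ge_Suc sr_class.add_eq sr_class.zero_eq in \<open>auto simp: JnM_eq\<close>)
qed

lemma gr_class_eq: "gr_class n f = JnM I (Suc n) +>\<^bsub>(sr_module I)\<lparr>carrier := JnM I n\<rparr>\<^esub> sr_class f"
  by (simp add: gr_class_def a_r_coset_def')

lemma Gr_presentation: "presentation (deg_ge n) (gr_class n) (Gr I n)"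
  using quotient_presentation.quot_presentation[OF Gr_quotient_presentation]
  unfolding gr_class_eq[symmetric] Gr_def[symmetric] .

lemma gr_class_eq_iff: assumes "f \<in> deg_ge n" "g \<in> deg_ge n" shows "gr_class n f = gr_class n g \<longleftrightarrow> f - g \<in> deg_ge (Suc n)"
  unfolding gr_class_eq
proof (rule quotient_presentation.coset_eq_iff[OF Gr_quotient_presentation])
  fix x assume "sr_class x \<in> JnM I (Suc n)"
  then obtain g where "g \<in> deg_ge (Suc n)" "x - g \<in> I" by (auto simp: JnM_eq sr_class_eq_iff)
  then have "(x - g) + g \<in> deg_ge (Suc n)" using I_deg_ge by (intro deg_ge_add) auto
  then show "x \<in> deg_ge (Suc n)" by simp
qed (use assms in auto)

lemma gr_class_smult: assumes "f \<in> deg_ge n" shows "a \<odot>\<^bsub>Gr I n\<^esub> gr_class n f = gr_class n (a * f)"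
proof -
  have "a * y - a * f \<in> deg_ge (Suc n)" if "y - f \<in> deg_ge (Suc n)" for y
    using deg_ge_mult[OF that, of a] by (simp add: right_diff_distrib)
  then show ?thesis
    unfolding gr_class_eq Gr_def
    using assms sr_class_smult deg_ge_mult
    by (intro quotient_presentation.quot_smult[OF Gr_quotient_presentation]) auto
qed

lemma act_Gr_class:
  assumes D: "D \<in> carrier (TBI I)" and f: "f \<in> deg_ge n"
  shows "act_Gr I n D (gr_class n f) = gr_class n (D f)"
proof -
  have der: "D \<in> ders" "D ` I \<subseteq> I" using D by (auto simp: TBI_iff)
  have "(\<Union>x\<in>gr_class n f. JnM I (Suc n) +>\<^bsub>(sr_module I)\<lparr>carrier := JnM I n\<rparr>\<^esub> induced poly_ring I D x) = gr_class n (D f)"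
    unfolding gr_class_eq
  proof (rule quotient_presentation.UN_coset[OF Gr_quotient_presentation f])
    show "induced poly_ring I D (sr_class y) = sr_class (D y)" for y
      unfolding sr_class_def by (rule induced_coset[OF I_ideal der])
    show "D y - D f \<in> deg_ge (Suc n)" if "y - f \<in> deg_ge (Suc n)" for y
      using deg_ge_der[OF D that] by (simp add: der_diff[OF der(1)])
  qed (rule deg_ge_der[OF D])
  then show ?thesis by (simp add: act_Gr_def induced_def a_r_coset_def')
qed

section \<open>The rings \<open>R\<close> and \<open>k\<close>\<close>

lemma Rring_cring: "cring (Rring I)"
  unfolding Rring_def by (rule ideal.quotient_is_cring[OF Jm_ideal cring_poly])

lemma kring_cring: "cring (kring :: ('v, 'k) mpoly set ring)"
  unfolding kring_def by (rule ideal.quotient_is_cring[OF max_ideal_ideal cring_poly])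

lemma to_R_hom: "to_R I \<in> ring_hom poly_ring (Rring I)"
  using ideal.rcos_ring_hom[OF Jm_ideal] by (simp add: Rring_def to_R_def[abs_def])

lemma to_R_simps:
  "to_R I a \<oplus>\<^bsub>Rring I\<^esub> to_R I b = to_R I (a + b)"
  "to_R I a \<otimes>\<^bsub>Rring I\<^esub> to_R I b = to_R I (a * b)"
  "\<one>\<^bsub>Rring I\<^esub> = to_R I 1" "\<zero>\<^bsub>Rring I\<^esub> = to_R I 0"
  using ring_hom_add[OF to_R_hom] ring_hom_mult[OF to_R_hom] ring_hom_one[OF to_R_hom]
    ring_hom_zero[OF to_R_hom ring_poly cring.axioms(1)[OF Rring_cring]] by simp_all

lemma carrier_Rring: "carrier (Rring I) = range (to_R I)"
  by (auto simp: Rring_def FactRing_def A_RCOSETS_def' to_R_def)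

lemma to_R_eq_iff: "to_R I a = to_R I b \<longleftrightarrow> a - b \<in> Jm I"
  unfolding to_R_def by (rule ideal_coset_eq_iff[OF Jm_ideal])

text \<open>The projection \<open>B \<rightarrow> k\<close>.\<close>

definition to_k :: "('v, 'k) mpoly \<Rightarrow> ('v, 'k) mpoly set" where
  "to_k b = max_ideal +>\<^bsub>poly_ring\<^esub> b"

lemma to_k_hom: "to_k \<in> ring_hom poly_ring kring"
  using ideal.rcos_ring_hom[OF max_ideal_ideal] by (simp add: kring_def to_k_def[abs_def])

lemma to_k_simps:
  "to_k a \<oplus>\<^bsub>kring\<^esub> to_k b = to_k (a + b)"
  "to_k a \<otimes>\<^bsub>kring\<^esub> to_k b = to_k (a * b)"
  "\<one>\<^bsub>kring\<^esub> = to_k 1" "\<zero>\<^bsub>kring\<^esub> = to_k 0"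
  using ring_hom_add[OF to_k_hom] ring_hom_mult[OF to_k_hom] ring_hom_one[OF to_k_hom]
    ring_hom_zero[OF to_k_hom ring_poly cring.axioms(1)[OF kring_cring]] by simp_all

lemma carrier_kring: "carrier kring = range to_k"
  by (auto simp: kring_def FactRing_def A_RCOSETS_def' to_k_def)

lemma to_k_eq_iff: "to_k a = to_k b \<longleftrightarrow> lookup a 0 = lookup b 0"
  unfolding to_k_def ideal_coset_eq_iff[OF max_ideal_ideal] by (simp add: max_ideal_iff lookup_minus)

lemma Jm_max: "Jm I \<subseteq> max_ideal"
proof
  fix f assume f: "f \<in> Jm I"
  have "0 \<notin> keys f"
  proof
    assume "0 \<in> keys f"
    then have "mdeg \<Delta> 0 > 0" using f unfolding Jm_iff by blast
    then show False by (simp add: mdeg_pos_iff)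
  qed
  then show "f \<in> max_ideal" by (simp add: max_ideal_iff in_keys_iff)
qed

lemma R_to_k_to_R: "R_to_k (to_R I b) = to_k b"
proof -
  have "R_to_k (to_R I b) = {m + (j + b) | m j. m \<in> max_ideal \<and> j \<in> Jm I}"
    by (auto simp: R_to_k_def to_R_def set_add_def' a_r_coset_def')
  also have "\<dots> = {m + b | m. m \<in> max_ideal}"
  proof (intro equalityI subsetI)
    fix x assume "x \<in> {m + (j + b) | m j. m \<in> max_ideal \<and> j \<in> Jm I}"
    then obtain m j where mj: "x = (m + j) + b" "m \<in> max_ideal" "j \<in> Jm I" by (auto simp: add.assoc)
    then have "m + j \<in> max_ideal" using Jm_max max_ideal_ideal unfolding ideal_poly_iff by blast
    then show "x \<in> {m + b | m. m \<in> max_ideal}" using mj by blast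
  next
    fix x assume "x \<in> {m + b | m. m \<in> max_ideal}"
    then obtain m where m: "x = m + b" "m \<in> max_ideal" by blast
    moreover have "0 \<in> Jm I" by (simp add: Jm_iff)
    ultimately show "x \<in> {m + (j + b) | m j. m \<in> max_ideal \<and> j \<in> Jm I}"
      by (intro CollectI exI[of _ m] exI[of _ 0]) simp
  qed
  finally show ?thesis by (auto simp: to_k_def a_r_coset_def')
qed

section \<open>The graded pieces over \<open>R\<close>\<close>

lemma Gr_R_sel: "carrier (Gr_R I n) = carrier (Gr I n)" "ring.add (Gr_R I n) = ring.add (Gr I n)"
   "\<zero>\<^bsub>Gr_R I n\<^esub> = \<zero>\<^bsub>Gr I n\<^esub>"
  by (simp_all add: Gr_R_def over_quotient_def)

lemma Gr_R_presentation: "presentation (deg_ge n) (gr_class n) (Gr_R I n)"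
  using Gr_presentation[of n] unfolding presentation_def Gr_R_sel .

lemma Gr_R_smult: assumes f: "f \<in> deg_ge n" shows "to_R I b \<odot>\<^bsub>Gr_R I n\<^esub> gr_class n f = gr_class n (b * f)"
proof -
  have "a \<odot>\<^bsub>Gr I n\<^esub> gr_class n f = gr_class n (b * f)" if "a \<in> to_R I b" for a
  proof -
    have "a - b \<in> Jm I" using that by (simp add: to_R_def in_ideal_coset_iff)
    then have "(a - b) * f \<in> deg_ge (Suc n)" by (rule deg_ge_Jm_mult[OF f])
    then show ?thesis
      using f by (simp add: gr_class_smult gr_class_eq_iff deg_ge_mult left_diff_distrib)
  qed
  moreover have "b \<in> to_R I b" by (simp add: to_R_def in_ideal_coset_iff Jm_iff)
  ultimately have "(THE p. \<exists>a\<in>to_R I b. p = a \<odot>\<^bsub>Gr I n\<^esub> gr_class n f) = gr_class n (b * f)"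
    by (intro the_equality) auto
  then show ?thesis by (simp add: Gr_R_def over_quotient_def)
qed

lemma Gr_carrier: "carrier (Gr I n) = gr_class n ` deg_ge n"
  by (rule presentation.carrier_eq[OF Gr_presentation])

lemma gr_class_add: "f \<in> deg_ge n \<Longrightarrow> g \<in> deg_ge n \<Longrightarrow> gr_class n f \<oplus>\<^bsub>Gr I n\<^esub> gr_class n g = gr_class n (f + g)"
  by (rule presentation.add_eq[OF Gr_presentation])

section \<open>The Lie algebroid over \<open>R\<close> and its isotropy Lie algebra\<close>

lemma
  shows I_zero: "0 \<in> I" and I_add: "f \<in> I \<Longrightarrow> g \<in> I \<Longrightarrow> f + g \<in> I" and I_mult: "f \<in> I \<Longrightarrow> b * f \<in> I"
  using I_ideal unfolding ideal_poly_iff by blast+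

lemma
  shows Jm_zero: "0 \<in> Jm I" and Jm_add: "f \<in> Jm I \<Longrightarrow> g \<in> Jm I \<Longrightarrow> f + g \<in> Jm I"
    and Jm_mult: "f \<in> Jm I \<Longrightarrow> b * f \<in> Jm I"
  using Jm_ideal unfolding ideal_poly_iff by blast+

lemma TBI_sel:
  "D \<oplus>\<^bsub>TBI I\<^esub> E = (\<lambda>f. D f + E f)" "b \<odot>\<^bsub>TBI I\<^esub> D = (\<lambda>f. b * D f)" "\<zero>\<^bsub>TBI I\<^esub> = (\<lambda>f. 0)"
  by (simp_all add: TBI_def der_module_def restrict_UNIV)

lemma TBI_ders: "D \<in> carrier (TBI I) \<Longrightarrow> D \<in> ders"
  by (simp add: TBI_iff)

lemma TBI_add: "D \<in> carrier (TBI I) \<Longrightarrow> E \<in> carrier (TBI I) \<Longrightarrow> (\<lambda>f. D f + E f) \<in> carrier (TBI I)"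
  by (auto simp: TBI_iff add_der image_subset_iff I_add)

lemma TBI_mult: "D \<in> carrier (TBI I) \<Longrightarrow> (\<lambda>f. b * D f) \<in> carrier (TBI I)"
  by (auto simp: TBI_iff mult_der image_subset_iff I_mult)

lemma TBI_zero: "(\<lambda>f. 0) \<in> carrier (TBI I)"
  by (auto simp: TBI_iff ders_iff I_zero)

lemma TBI_abelian_group: "abelian_group (TBI I)"
proof (rule abelian_groupI)
  show "\<exists>E\<in>carrier (TBI I). E \<oplus>\<^bsub>TBI I\<^esub> D = \<zero>\<^bsub>TBI I\<^esub>" if "D \<in> carrier (TBI I)" for D
    using TBI_mult[OF that, of "- 1"] by (intro bexI[of _ "\<lambda>f. - 1 * D f"]) (simp_all add: TBI_sel)
qed (auto simp: TBI_sel TBI_add TBI_zero ac_simps)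

text \<open>The derivation of \<open>R\<close> induced by a derivation that preserves \<open>J\<close>.\<close>

definition der_R :: "(('v, 'k) mpoly \<Rightarrow> ('v, 'k) mpoly) \<Rightarrow> ('v, 'k) mpoly set \<Rightarrow> ('v, 'k) mpoly set" where
  "der_R D = (\<lambda>U\<in>carrier (Rring I). induced poly_ring (Jm I) D U)"

lemma der_R_to_R: assumes "D \<in> carrier (TBI I)" shows "der_R D (to_R I b) = to_R I (D b)"
proof -
  have "D ` Jm I \<subseteq> Jm I" using TBI_Jm[OF assms] by blast
  then show ?thesis
    using induced_coset[OF Jm_ideal TBI_ders[OF assms]] by (simp add: der_R_def carrier_Rring to_R_def)
qed

lemma TR_sel:
  "carrier (TR I) = derivations (to_R I ` range const) (Rring I)"
  "D \<oplus>\<^bsub>TR I\<^esub> E = (\<lambda>U\<in>carrier (Rring I). D U \<oplus>\<^bsub>Rring I\<^esub> E U)"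
  "r \<odot>\<^bsub>TR I\<^esub> D = (\<lambda>U\<in>carrier (Rring I). r \<otimes>\<^bsub>Rring I\<^esub> D U)"
  "\<zero>\<^bsub>TR I\<^esub> = (\<lambda>U\<in>carrier (Rring I). \<zero>\<^bsub>Rring I\<^esub>)"
  by (simp_all add: TR_def der_module_def)

lemma const_Rring: "to_R I ` range const \<subseteq> carrier (Rring I)"
  by (auto simp: carrier_Rring)

lemma TR_abelian_group: "abelian_group (TR I)"
  unfolding TR_def by (rule der_module_abelian_group[OF Rring_cring const_Rring])

lemma der_R_TR: assumes D: "D \<in> carrier (TBI I)" shows "der_R D \<in> carrier (TR I)"
proof -
  note der = TBI_ders[OF D]
  have "der_R D \<in> carrier (Rring I) \<rightarrow>\<^sub>E carrier (Rring I)"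
  proof (rule PiE_I)
    show "der_R D U \<in> carrier (Rring I)" if "U \<in> carrier (Rring I)" for U
      using that by (auto simp: carrier_Rring der_R_to_R[OF D])
    show "der_R D U = undefined" if "U \<notin> carrier (Rring I)" for U
      using that by (simp add: der_R_def)
  qed
  then show ?thesis
    by (auto simp: TR_sel derivations_def carrier_Rring der_R_to_R[OF D] to_R_simps
        der_add[OF der] der_mult[OF der] der_const[OF der])
qed

lemma RT_scalar_extension: "scalar_extension (to_R I) poly_ring (Rring I) (TBI I)"
  by (intro scalar_extension.intro scalar_extension_axioms.intro Rring_cring TBI_abelian_group)
    (auto simp: carrier_Rring TBI_sel TBI_mult)

text \<open>The element \<open>1 \<otimes> D\<close> of the extension to \<open>R\<close> of the Lie algebroid.\<close>

definition lie_class :: "(('v, 'k) mpoly \<Rightarrow> ('v, 'k) mpoly) \<Rightarrow> ('v, 'k) g_elt" where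
  "lie_class D = pure_tensor (to_R I) poly_ring (Rring I) (TBI I) \<one>\<^bsub>Rring I\<^esub> D"

lemma carrier_RT: "carrier (RT I) = lie_class ` carrier (TBI I)"
  unfolding RT_def lie_class_def[abs_def]
  by (rule scalar_extension.carrier_T_eq[OF RT_scalar_extension]) (simp add: carrier_Rring)

lemma lie_class_add: "D \<in> carrier (TBI I) \<Longrightarrow> E \<in> carrier (TBI I) \<Longrightarrow> lie_class D \<oplus>\<^bsub>RT I\<^esub> lie_class E = lie_class (\<lambda>f. D f + E f)"
  using scalar_extension.tens_add_right[OF RT_scalar_extension, of "\<one>\<^bsub>Rring I\<^esub>" D E]
  by (simp add: RT_def lie_class_def TBI_sel to_R_simps carrier_Rring)

lemma lie_class_smult: assumes "D \<in> carrier (TBI I)" shows "to_R I b \<odot>\<^bsub>RT I\<^esub> lie_class D = lie_class (\<lambda>f. b * D f)"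
proof -
  have "to_R I b \<odot>\<^bsub>RT I\<^esub> lie_class D = pure_tensor (to_R I) poly_ring (Rring I) (TBI I) (to_R I b) D"
    using scalar_extension.tens_smult[OF RT_scalar_extension, of "to_R I b" "\<one>\<^bsub>Rring I\<^esub>" D] assms
    by (simp add: RT_def lie_class_def to_R_simps carrier_Rring)
  also have "\<dots> = lie_class (\<lambda>f. b * D f)"
    using scalar_extension.tens_phi[OF RT_scalar_extension, of b D] assms by (simp add: lie_class_def TBI_sel)
  finally show ?thesis .
qed

lemma RT_to_TR_lie_class:
  assumes D: "D \<in> carrier (TBI I)"
  shows "RT_to_TR I (lie_class D) = der_R D"
proof -
  interpret R: cring "Rring I" by (rule Rring_cring)
  let ?f = "\<lambda>(r, D). r \<odot>\<^bsub>TR I\<^esub> der_R D"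
  have cl: "der_R D U \<in> carrier (Rring I)" if "D \<in> carrier (TBI I)" "U \<in> carrier (Rring I)" for D U
    using that by (auto simp: carrier_Rring der_R_to_R)
  have "tensor_lift (TR I) ?f (pure_tensor (to_R I) poly_ring (Rring I) (TBI I) \<one>\<^bsub>Rring I\<^esub> D) = ?f (\<one>\<^bsub>Rring I\<^esub>, D)"
  proof (rule scalar_extension.tensor_lift_tens[OF RT_scalar_extension TR_abelian_group])
    show "?f (s, x) \<in> carrier (TR I)" if "s \<in> carrier (Rring I)" "x \<in> carrier (TBI I)" for s x
      using der_module_closed(2)[OF Rring_cring const_Rring, of "der_R x" s] der_R_TR[of x] that
      by (simp add: TR_sel)
    show "?f (s \<oplus>\<^bsub>Rring I\<^esub> s', x) = ?f (s, x) \<oplus>\<^bsub>TR I\<^esub> ?f (s', x)"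
      if "s \<in> carrier (Rring I)" "s' \<in> carrier (Rring I)" "x \<in> carrier (TBI I)" for s s' x
      using that by (auto simp: TR_sel R.l_distr cl intro!: restrict_ext)
    show "?f (s, x \<oplus>\<^bsub>TBI I\<^esub> x') = ?f (s, x) \<oplus>\<^bsub>TR I\<^esub> ?f (s, x')"
      if "s \<in> carrier (Rring I)" "x \<in> carrier (TBI I)" "x' \<in> carrier (TBI I)" for s x x'
      using that by (auto simp: TR_sel TBI_sel carrier_Rring der_R_to_R TBI_add to_R_simps
          distrib_left intro!: restrict_ext)
    show "?f (s \<otimes>\<^bsub>Rring I\<^esub> to_R I a, x) = ?f (s, a \<odot>\<^bsub>TBI I\<^esub> x)"
      if "s \<in> carrier (Rring I)" "x \<in> carrier (TBI I)" for s a x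
      using that by (auto simp: TR_sel TBI_sel carrier_Rring der_R_to_R TBI_mult to_R_simps
          mult.assoc intro!: restrict_ext)
  qed (use D in auto)
  also have "?f (\<one>\<^bsub>Rring I\<^esub>, D) = der_R D"
  proof -
    have "?f (\<one>\<^bsub>Rring I\<^esub>, D) = (\<lambda>U\<in>carrier (Rring I). \<one>\<^bsub>Rring I\<^esub> \<otimes>\<^bsub>Rring I\<^esub> der_R D U)"
      by (simp only: TR_sel prod.case)
    also have "\<dots> = restrict (der_R D) (carrier (Rring I))"
      by (rule restrict_ext) (rule R.l_one[OF cl[OF D]])
    also have "\<dots> = der_R D" unfolding der_R_def by (simp only: restrict_restrict Int_absorb)
    finally show ?thesis .
  qed
  finally show ?thesis
    unfolding RT_to_TR_def lie_class_def der_R_def .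
qed

text \<open>
  The derivations in the Lie algebroid that induce zero on \<open>R\<close>; their classes \<open>1 \<otimes> D\<close> form \<open>\<gg>\<close>.
\<close>

definition iso_ders :: "(('v, 'k) mpoly \<Rightarrow> ('v, 'k) mpoly) set" where
  "iso_ders = {D \<in> carrier (TBI I). \<forall>b. D b \<in> Jm I}"

lemma iso_ders_TBI: "D \<in> iso_ders \<Longrightarrow> D \<in> carrier (TBI I)" by (simp add: iso_ders_def)

lemma iso_ders_add: "D \<in> iso_ders \<Longrightarrow> E \<in> iso_ders \<Longrightarrow> (\<lambda>f. D f + E f) \<in> iso_ders"
  by (simp add: iso_ders_def TBI_add Jm_add)

lemma iso_ders_mult: "D \<in> iso_ders \<Longrightarrow> (\<lambda>f. b * D f) \<in> iso_ders"
  by (simp add: iso_ders_def TBI_mult Jm_mult)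

lemma iso_ders_zero: "(\<lambda>f. 0) \<in> iso_ders"
  by (simp add: iso_ders_def TBI_zero Jm_zero)

lemma gLie_sel: "ring.add (gLie I) = ring.add (RT I)" "\<zero>\<^bsub>gLie I\<^esub> = \<zero>\<^bsub>RT I\<^esub>"
  "module.smult (gLie I) = module.smult (RT I)"
  by (simp_all add: gLie_def)

lemma carrier_gLie: "carrier (gLie I) = lie_class ` iso_ders"
proof -
  have "der_R D = \<zero>\<^bsub>TR I\<^esub> \<longleftrightarrow> D \<in> iso_ders" if D: "D \<in> carrier (TBI I)" for D
  proof
    assume z: "der_R D = \<zero>\<^bsub>TR I\<^esub>"
    have "to_R I (D b) = to_R I 0" for b
      using fun_cong[OF z, of "to_R I b"] by (simp add: der_R_to_R[OF D] TR_sel carrier_Rring to_R_simps)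
    then show "D \<in> iso_ders" using D by (simp add: iso_ders_def to_R_eq_iff)
  next
    assume "D \<in> iso_ders"
    then have "to_R I (D b) = to_R I 0" for b by (simp add: iso_ders_def to_R_eq_iff)
    then have "der_R D U = \<zero>\<^bsub>TR I\<^esub> U" if "U \<in> carrier (Rring I)" for U
      using that by (auto simp: carrier_Rring der_R_to_R[OF D] TR_sel to_R_simps)
    moreover have "der_R D U = \<zero>\<^bsub>TR I\<^esub> U" if "U \<notin> carrier (Rring I)" for U
      using that by (simp add: der_R_def TR_sel)
    ultimately have "der_R D U = \<zero>\<^bsub>TR I\<^esub> U" for U by blast
    then show "der_R D = \<zero>\<^bsub>TR I\<^esub>" by auto
  qed
  then show ?thesis
    unfolding gLie_def using carrier_RT RT_to_TR_lie_class iso_ders_TBI by auto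
qed

lemma gLie_abelian_group: "abelian_group (gLie I)"
proof (rule abelian_groupI)
  interpret RT: abelian_group "RT I"
    unfolding RT_def by (rule scalar_extension.T_abelian_group[OF RT_scalar_extension])
  have lie_class_zero: "\<zero>\<^bsub>RT I\<^esub> = lie_class (\<lambda>f. 0)"
  proof -
    have "lie_class (\<lambda>f. 0) \<oplus>\<^bsub>RT I\<^esub> lie_class (\<lambda>f. 0) = lie_class (\<lambda>f. 0)" by (simp add: lie_class_add TBI_zero)
    moreover have "lie_class (\<lambda>f. 0) \<in> carrier (RT I)" by (simp add: carrier_RT TBI_zero)
    ultimately show ?thesis by (metis RT.add.l_cancel_one' )
  qed
  have sub: "carrier (gLie I) \<subseteq> carrier (RT I)" by (auto simp: gLie_def)
  show "\<zero>\<^bsub>gLie I\<^esub> \<in> carrier (gLie I)" by (simp add: gLie_sel carrier_gLie lie_class_zero iso_ders_zero)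
  show "x \<oplus>\<^bsub>gLie I\<^esub> y \<in> carrier (gLie I)" if "x \<in> carrier (gLie I)" "y \<in> carrier (gLie I)" for x y
    using that by (auto simp: gLie_sel carrier_gLie lie_class_add iso_ders_TBI iso_ders_add)
  show "\<exists>y\<in>carrier (gLie I). y \<oplus>\<^bsub>gLie I\<^esub> x = \<zero>\<^bsub>gLie I\<^esub>" if x: "x \<in> carrier (gLie I)" for x
  proof -
    obtain D where D: "D \<in> iso_ders" "x = lie_class D" using x carrier_gLie by auto
    show ?thesis
    proof (rule bexI)
      show "lie_class (\<lambda>f. - 1 * D f) \<in> carrier (gLie I)"
        using iso_ders_mult[OF D(1)] by (simp only: carrier_gLie image_eqI)
      show "lie_class (\<lambda>f. - 1 * D f) \<oplus>\<^bsub>gLie I\<^esub> x = \<zero>\<^bsub>gLie I\<^esub>"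
        using lie_class_add[OF TBI_mult[OF iso_ders_TBI[OF D(1)], of "- 1"] iso_ders_TBI[OF D(1)]]
        by (simp add: gLie_sel D lie_class_zero)
    qed
  qed
  show "x \<oplus>\<^bsub>gLie I\<^esub> y \<oplus>\<^bsub>gLie I\<^esub> z = x \<oplus>\<^bsub>gLie I\<^esub> (y \<oplus>\<^bsub>gLie I\<^esub> z)"
    if "x \<in> carrier (gLie I)" "y \<in> carrier (gLie I)" "z \<in> carrier (gLie I)" for x y z
    using that sub RT.a_assoc[of x y z] by (simp add: gLie_sel subset_iff)
  show "x \<oplus>\<^bsub>gLie I\<^esub> y = y \<oplus>\<^bsub>gLie I\<^esub> x" if "x \<in> carrier (gLie I)" "y \<in> carrier (gLie I)" for x y
    using that sub RT.a_comm[of x y] by (simp add: gLie_sel subset_iff)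
  show "\<zero>\<^bsub>gLie I\<^esub> \<oplus>\<^bsub>gLie I\<^esub> x = x" if "x \<in> carrier (gLie I)" for x
    using that sub RT.l_zero[of x] by (simp add: gLie_sel subset_iff)
qed

lemma act_g_lie_class:
  assumes D: "D \<in> carrier (TBI I)" and f: "f \<in> deg_ge n"
  shows "act_g I n (lie_class D) (gr_class n f) = gr_class n (D f)"
proof -
  let ?f = "\<lambda>(r, D). r \<odot>\<^bsub>Gr_R I n\<^esub> act_Gr I n D (gr_class n f)"
  have G: "abelian_group (Gr_R I n)" by (rule presentation.abelian_group[OF Gr_R_presentation])
  have val: "?f (to_R I b, E) = gr_class n (b * E f)" if "E \<in> carrier (TBI I)" for b E
    using that f by (simp add: act_Gr_class Gr_R_smult deg_ge_der)
  have "tensor_lift (Gr_R I n) ?f (pure_tensor (to_R I) poly_ring (Rring I) (TBI I) \<one>\<^bsub>Rring I\<^esub> D) = ?f (\<one>\<^bsub>Rring I\<^esub>, D)"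
  proof (rule scalar_extension.tensor_lift_tens[OF RT_scalar_extension G], goal_cases)
    case (1 s x)
    then obtain b where "s = to_R I b" by (auto simp: carrier_Rring)
    with 1 show ?case
      using val[of x b] f by (simp only: Gr_R_sel Gr_carrier) (simp add: deg_ge_mult deg_ge_der)
  next
    case (2 s s' x)
    then obtain b b' where "s = to_R I b" "s' = to_R I b'" by (auto simp: carrier_Rring)
    with 2 show ?case
      using f by (simp only: to_R_simps val Gr_R_sel) (simp add: gr_class_add deg_ge_mult deg_ge_der distrib_right)
  next
    case (3 s x x')
    then obtain b where "s = to_R I b" by (auto simp: carrier_Rring)
    with 3 show ?case
      using f by (simp only: TBI_sel TBI_add val Gr_R_sel) (simp add: gr_class_add deg_ge_mult deg_ge_der distrib_left)
  next
    case (4 s a x)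
    then obtain b where "s = to_R I b" by (auto simp: carrier_Rring)
    with 4 show ?case
      by (simp only: TBI_sel TBI_mult val to_R_simps) (simp add: mult.assoc)
  next
    case 5
    then show ?case by (simp add: carrier_Rring to_R_simps)
  next
    case 6
    then show ?case by (rule D)
  qed
  also have "?f (\<one>\<^bsub>Rring I\<^esub>, D) = gr_class n (D f)"
    using val[OF D, of 1] by (simp add: to_R_simps)
  finally show ?thesis by (simp add: act_g_def lie_class_def)
qed

section \<open>Reduction to the residue field\<close>

lemma R_to_k_surj: "R_to_k ` carrier (Rring I) = carrier kring"
  by (auto simp: carrier_Rring carrier_kring R_to_k_to_R image_image)

lemma gk_scalar_extension: "scalar_extension R_to_k (Rring I) kring (gLie I)"
proof (intro scalar_extension.intro scalar_extension_axioms.intro kring_cring gLie_abelian_group)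
  show "R_to_k a \<in> carrier kring" if "a \<in> carrier (Rring I)" for a
    using that R_to_k_surj by blast
  show "a \<odot>\<^bsub>gLie I\<^esub> x \<in> carrier (gLie I)" if "a \<in> carrier (Rring I)" "x \<in> carrier (gLie I)" for a x
    using that by (auto simp: carrier_Rring carrier_gLie gLie_sel lie_class_smult iso_ders_TBI iso_ders_mult)
qed

lemma Gr_k_scalar_extension: "scalar_extension R_to_k (Rring I) kring (Gr_R I n)"
proof (intro scalar_extension.intro scalar_extension_axioms.intro kring_cring
    presentation.abelian_group[OF Gr_R_presentation])
  show "R_to_k a \<in> carrier kring" if "a \<in> carrier (Rring I)" for a
    using that R_to_k_surj by blast
  show "a \<odot>\<^bsub>Gr_R I n\<^esub> x \<in> carrier (Gr_R I n)" if "a \<in> carrier (Rring I)" "x \<in> carrier (Gr_R I n)" for a x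
    using that by (auto simp: carrier_Rring Gr_R_sel Gr_carrier Gr_R_smult deg_ge_mult)
qed

text \<open>The element \<open>1 \<otimes> (1 \<otimes> D)\<close> of the fibre Lie algebra.\<close>

definition fibre_lie_class :: "(('v, 'k) mpoly \<Rightarrow> ('v, 'k) mpoly) \<Rightarrow>
    ((('v, 'k) mpoly set \<times> ('v, 'k) g_elt) \<Rightarrow>\<^sub>0 int) set" where
  "fibre_lie_class D = pure_tensor R_to_k (Rring I) kring (gLie I) \<one>\<^bsub>kring\<^esub> (lie_class D)"

text \<open>The class in the fibre over \<open>k\<close> of the graded piece of degree \<open>n\<close>.\<close>

definition fibre_class :: "nat \<Rightarrow> ('v, 'k) mpoly \<Rightarrow>
    ((('v, 'k) mpoly set \<times> ('v, 'k) mpoly set set) \<Rightarrow>\<^sub>0 int) set" where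
  "fibre_class n f = pure_tensor R_to_k (Rring I) kring (Gr_R I n) \<one>\<^bsub>kring\<^esub> (gr_class n f)"

lemma carrier_gk: "carrier (gk I) = fibre_lie_class ` iso_ders"
  using scalar_extension.carrier_T_eq[OF gk_scalar_extension R_to_k_surj]
  by (simp add: gk_def fibre_lie_class_def[abs_def] carrier_gLie image_image)

lemma one_kring: "\<one>\<^bsub>kring\<^esub> \<in> carrier (kring :: ('v, 'k) mpoly set ring)"
  by (simp add: carrier_kring to_k_simps)

lemma pure_Gr_k:
  assumes "f \<in> deg_ge n"
  shows "pure_tensor R_to_k (Rring I) kring (Gr_R I n) (to_k b) (gr_class n f) = fibre_class n (b * f)"
  using scalar_extension.tens_phi[OF Gr_k_scalar_extension, of "to_R I b" "gr_class n f"] assms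
  by (simp add: carrier_Rring Gr_R_sel Gr_carrier R_to_k_to_R Gr_R_smult fibre_class_def)

lemma fibre_class_add: "f \<in> deg_ge n \<Longrightarrow> g \<in> deg_ge n \<Longrightarrow> fibre_class n f \<oplus>\<^bsub>Gr_k I n\<^esub> fibre_class n g = fibre_class n (f + g)"
  using scalar_extension.tens_add_right[OF Gr_k_scalar_extension one_kring, of "gr_class n f" n "gr_class n g"]
  by (simp add: Gr_k_def fibre_class_def Gr_R_sel Gr_carrier gr_class_add)

lemma carrier_Gr_k: "carrier (Gr_k I n) = fibre_class n ` deg_ge n"
  using scalar_extension.carrier_T_eq[OF Gr_k_scalar_extension R_to_k_surj]
  by (simp add: Gr_k_def fibre_class_def[abs_def] Gr_R_sel Gr_carrier image_image)

lemma Gr_k_abelian_group: "abelian_group (Gr_k I n)"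
  unfolding Gr_k_def by (rule scalar_extension.T_abelian_group[OF Gr_k_scalar_extension])

lemma Gr_k_presentation: "presentation (deg_ge n) (fibre_class n) (Gr_k I n)"
proof
  interpret A: abelian_group "Gr_k I n" by (rule Gr_k_abelian_group)
  have "fibre_class n 0 \<oplus>\<^bsub>Gr_k I n\<^esub> fibre_class n 0 = fibre_class n 0" using fibre_class_add[of 0 n 0] deg_ge_zero by simp
  moreover have "fibre_class n 0 \<in> carrier (Gr_k I n)" by (simp add: carrier_Gr_k deg_ge_zero)
  ultimately show "\<zero>\<^bsub>Gr_k I n\<^esub> = fibre_class n 0" by (metis A.add.l_cancel_one')
qed (auto intro: deg_ge_zero deg_ge_diff simp: carrier_Gr_k fibre_class_add)

lemma Gr_k_smult: assumes "f \<in> deg_ge n" shows "to_k b \<odot>\<^bsub>Gr_k I n\<^esub> fibre_class n f = fibre_class n (b * f)"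
  using scalar_extension.tens_smult[OF Gr_k_scalar_extension, of "to_k b" "\<one>\<^bsub>kring\<^esub>" "gr_class n f"]
    pure_Gr_k[OF assms, of b] assms
  by (simp add: Gr_k_def fibre_class_def carrier_kring to_k_simps Gr_R_sel Gr_carrier)

text \<open>
  The inner extension over \<open>d \<otimes> y\<close> is well defined because an isotropy derivation \<open>E\<close> acts
  \<open>R\<close>-linearly: \<open>E (c g) - c E g = E (c) g\<close> with \<open>E c \<in> J\<close>.
\<close>

lemma act_gk_fibre_lie_class:
  assumes D: "D \<in> iso_ders" and f: "f \<in> deg_ge n"
  shows "act_gk I n (fibre_lie_class D) (fibre_class n f) = fibre_class n (D f)"
proof -
  let ?pt = "pure_tensor R_to_k (Rring I) kring (Gr_R I n)"
  let ?in = "\<lambda>c \<gamma>. \<lambda>(d, y). ?pt (c \<otimes>\<^bsub>kring\<^esub> d) (act_g I n \<gamma> y)"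
  interpret k: cring "kring :: ('v, 'k) mpoly set ring" by (rule kring_cring)
  have ptval: "?in (to_k a) (lie_class E) (to_k b, gr_class n g) = fibre_class n (a * b * E g)"
    if "E \<in> iso_ders" "g \<in> deg_ge n" for a b E g
    using that by (simp add: to_k_simps act_g_lie_class iso_ders_TBI pure_Gr_k deg_ge_der)
  have kE: "\<exists>b. c = to_k b" if "c \<in> carrier kring" for c :: "('v, 'k) mpoly set"
    using that by (auto simp: carrier_kring)
  have GE: "\<exists>g\<in>deg_ge n. y = gr_class n g" if "y \<in> carrier (Gr_R I n)" for y
    using that by (auto simp: Gr_R_sel Gr_carrier)
  have gE: "\<exists>E\<in>iso_ders. \<gamma> = lie_class E" if "\<gamma> \<in> carrier (gLie I)" for \<gamma>
    using that by (auto simp: carrier_gLie)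
  have inner: "tensor_lift (Gr_k I n) (?in (to_k a) (lie_class E)) (fibre_class n f) = fibre_class n (a * E f)"
    if E: "E \<in> iso_ders" for a E
  proof -
    have "tensor_lift (Gr_k I n) (?in (to_k a) (lie_class E)) (?pt \<one>\<^bsub>kring\<^esub> (gr_class n f))
        = ?in (to_k a) (lie_class E) (\<one>\<^bsub>kring\<^esub>, gr_class n f)"
    proof (rule scalar_extension.tensor_lift_tens[OF Gr_k_scalar_extension Gr_k_abelian_group], goal_cases)
      case (1 s x)
      then obtain b g where "s = to_k b" "g \<in> deg_ge n" "x = gr_class n g" using kE GE by meson
      then show ?case using ptval[OF E, of g a b] by (simp only: carrier_Gr_k) (simp add: deg_ge_mult deg_ge_der iso_ders_TBI E)
    next
      case (2 s s' x)
      then obtain b b' g where "s = to_k b" "s' = to_k b'" "g \<in> deg_ge n" "x = gr_class n g" using kE GE by meson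
      then show ?case
        by (simp only: to_k_simps(1) ptval[OF E]) (simp add: fibre_class_add deg_ge_mult deg_ge_der iso_ders_TBI E algebra_simps)
    next
      case (3 s x x')
      then obtain b g g' where g: "s = to_k b" "g \<in> deg_ge n" "x = gr_class n g" "g' \<in> deg_ge n" "x' = gr_class n g'"
        using kE GE by meson
      then show ?case
        by (simp only: Gr_R_sel gr_class_add ptval[OF E] deg_ge_add)
          (simp add: fibre_class_add deg_ge_mult deg_ge_der iso_ders_TBI E der_add[OF TBI_ders[OF iso_ders_TBI[OF E]]] algebra_simps)
    next
      case (4 s r x)
      then obtain b c g where g: "s = to_k b" "r = to_R I c" "g \<in> deg_ge n" "x = gr_class n g"
        using kE GE carrier_Rring by (metis imageE)
      have "gr_class n (E (c * g)) = gr_class n (c * E g)"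
      proof -
        have "E (c * g) - c * E g = E c * g" by (simp add: der_mult[OF TBI_ders[OF iso_ders_TBI[OF E]]])
        also have "\<dots> \<in> deg_ge (Suc n)" using E by (intro deg_ge_Jm_mult g) (simp add: iso_ders_def)
        finally show ?thesis using g E by (simp add: gr_class_eq_iff deg_ge_mult deg_ge_der iso_ders_TBI)
      qed
      then have "act_g I n (lie_class E) (gr_class n (c * g)) = gr_class n (c * E g)"
        using g E by (simp add: act_g_lie_class iso_ders_TBI deg_ge_mult)
      then have "?in (to_k a) (lie_class E) (s, r \<odot>\<^bsub>Gr_R I n\<^esub> x) = fibre_class n (a * b * (c * E g))"
        using g E by (simp add: Gr_R_smult to_k_simps pure_Gr_k deg_ge_mult deg_ge_der iso_ders_TBI)
      moreover have "?in (to_k a) (lie_class E) (s \<otimes>\<^bsub>kring\<^esub> R_to_k r, x) = fibre_class n (a * (b * c) * E g)"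
        using g by (simp only: R_to_k_to_R to_k_simps(2) ptval[OF E])
      ultimately show ?case by (simp only: mult.assoc)
    qed (use f in \<open>auto simp: one_kring Gr_R_sel Gr_carrier\<close>)
    also have "\<dots> = fibre_class n (a * E f)"
      using ptval[OF E f, of a 1] by (simp only: to_k_simps(3) mult_1_right)
    finally show ?thesis by (simp add: fibre_class_def)
  qed
  let ?out = "\<lambda>(c, \<gamma>). tensor_lift (Gr_k I n) (?in c \<gamma>) (fibre_class n f)"
  have "tensor_lift (Gr_k I n) ?out (pure_tensor R_to_k (Rring I) kring (gLie I) \<one>\<^bsub>kring\<^esub> (lie_class D))
      = ?out (\<one>\<^bsub>kring\<^esub>, lie_class D)"
  proof (rule scalar_extension.tensor_lift_tens[OF gk_scalar_extension Gr_k_abelian_group], goal_cases)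
    case (1 s x)
    then obtain b E where "s = to_k b" "E \<in> iso_ders" "x = lie_class E" using kE gE by meson
    then show ?case using f by (simp only: carrier_Gr_k inner prod.case) (simp add: deg_ge_mult deg_ge_der iso_ders_TBI)
  next
    case (2 s s' x)
    then obtain b b' E where "s = to_k b" "s' = to_k b'" "E \<in> iso_ders" "x = lie_class E" using kE gE by meson
    then show ?case
      using f by (simp only: to_k_simps(1) inner prod.case) (simp add: fibre_class_add deg_ge_mult deg_ge_der iso_ders_TBI algebra_simps)
  next
    case (3 s x x')
    then obtain b E E' where E: "s = to_k b" "E \<in> iso_ders" "x = lie_class E" "E' \<in> iso_ders" "x' = lie_class E'"
      using kE gE by meson
    then show ?case
      using f by (simp only: gLie_sel lie_class_add iso_ders_TBI iso_ders_add inner prod.case)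
        (simp add: fibre_class_add deg_ge_mult deg_ge_der iso_ders_TBI algebra_simps)
  next
    case (4 s r x)
    then obtain b c E where E: "s = to_k b" "r = to_R I c" "E \<in> iso_ders" "x = lie_class E"
      using kE gE carrier_Rring by (metis imageE)
    then show ?case
      by (simp only: gLie_sel lie_class_smult iso_ders_TBI iso_ders_mult inner prod.case R_to_k_to_R to_k_simps(2))
        (simp add: mult.assoc)
  qed (use D in \<open>auto simp: one_kring carrier_gLie\<close>)
  also have "\<dots> = fibre_class n (D f)"
    using inner[OF D, of 1] by (simp add: to_k_simps(3))
  finally show ?thesis by (simp only: act_gk_def fibre_lie_class_def)
qed

end

section \<open>Bases of the graded pieces and of their fibres\<close>

text \<open>A coefficient of \<open>c f\<close> to which only the constant term of \<open>c\<close> contributes.\<close>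

lemma lookup_mult_isolated:
  fixes c f :: "('v, 'k::field) mpoly"
  assumes "\<And>u m. u \<in> keys c \<Longrightarrow> m \<in> keys f \<Longrightarrow> u + m = a \<Longrightarrow> u = 0"
  shows "lookup (c * f) a = lookup c 0 * lookup f a"
proof -
  define c' where "c' = c - const (lookup c 0)"
  have c': "lookup c' u = (if u = 0 then 0 else lookup c u)" for u
    by (simp add: c'_def const_def lookup_minus lookup_single when_def)
  have "lookup (c' * f) a = 0"
  proof (rule ccontr)
    assume "lookup (c' * f) a \<noteq> 0"
    then have "a \<in> keys (c' * f)" by (simp add: in_keys_iff)
    then obtain u m where "a = u + m" "u \<in> keys c'" "m \<in> keys f" using keys_mult[of c' f] by blast
    moreover from this have "u \<in> keys c" "u \<noteq> 0" by (auto simp: in_keys_iff c' split: if_splits)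
    ultimately show False using assms by blast
  qed
  moreover have "c * f = const (lookup c 0) * f + c' * f" by (simp add: c'_def algebra_simps)
  ultimately show ?thesis by (simp add: lookup_add)
qed

context stanley_reisner begin

text \<open>The exponents of the monomial basis of the graded piece of degree \<open>n\<close>, and of its fibre.\<close>

definition graded_exps :: "nat \<Rightarrow> ('v \<Rightarrow>\<^sub>0 nat) set" where
  "graded_exps n = {m. keys m \<in> \<Delta> \<and> mdeg \<Delta> m = n}"

definition noncone_exps :: "nat \<Rightarrow> ('v \<Rightarrow>\<^sub>0 nat) set" where
  "noncone_exps n = {m \<in> graded_exps n. keys m \<subseteq> noncone \<Delta>}"

lemma deg_ge_Suc_iff: "f \<in> deg_ge n \<Longrightarrow> f \<in> deg_ge (Suc n) \<longleftrightarrow> keys f \<inter> graded_exps n = {}"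
  by (fastforce simp: deg_ge_def graded_exps_def)

lemma gr_class_kernel: assumes "f \<in> deg_ge n" shows "gr_class n f = gr_class n 0 \<longleftrightarrow> keys f \<inter> graded_exps n = {}"
  using assms by (simp add: gr_class_eq_iff deg_ge_zero deg_ge_Suc_iff)

lemma fibre_class_kernel_if:
  assumes f: "f \<in> deg_ge n" and "keys f \<inter> noncone_exps n = {}"
  shows "fibre_class n f = fibre_class n 0"
proof -
  let ?P = "\<lambda>g. g \<in> deg_ge n \<and> fibre_class n g = fibre_class n 0"
  have "?P f"
  proof (rule poly_sum_induct[of ?P])
    show "?P (g + h)" if "?P g" "?P h" for g h
      using that fibre_class_add[of g n h] fibre_class_add[of 0 n 0] deg_ge_zero deg_ge_add by simp
  next
    fix m assume m: "m \<in> keys f"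
    let ?s = "single m (lookup f m)"
    have s: "?s \<in> deg_ge n" using f m by (auto simp: deg_ge_def)
    show "?P ?s"
    proof (cases "m \<in> graded_exps n")
      case False
      then have "keys ?s \<inter> graded_exps n = {}" by auto
      then have "gr_class n ?s = gr_class n 0" using s gr_class_kernel by blast
      then show ?thesis using s by (simp add: fibre_class_def)
    next
      case True
      then have "\<not> keys m \<subseteq> noncone \<Delta>" using m assms(2) by (auto simp: noncone_exps_def)
      then obtain j where j: "j \<in> keys m" "j \<notin> noncone \<Delta>" by blast
      define m0 where "m0 = m - unit_exp j"
      have m0: "m = unit_exp j + m0" using j unit_exp_le[of m j] by (simp add: m0_def in_keys_iff)
      then have "mdeg \<Delta> m0 = n" using True j by (simp add: graded_exps_def mdeg_add mdeg_unit_exp)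
      then have g: "single m0 (lookup f m) \<in> deg_ge n" by (auto simp: deg_ge_def split: if_splits)
      have "unit_exp j \<noteq> 0" by (metis lookup_single_eq lookup_zero zero_neq_one)
      then have "to_k (var j) = to_k 0" by (simp add: to_k_eq_iff var_def lookup_single when_def)
      then have "fibre_class n (var j * single m0 (lookup f m)) = fibre_class n (0 * single m0 (lookup f m))"
        using pure_Gr_k[OF g, of "var j"] pure_Gr_k[OF g, of 0] by (simp only:)
      moreover have "var j * single m0 (lookup f m) = ?s" by (subst (2) m0) (rule var_mult_single)
      ultimately show ?thesis using s by simp
    qed
  qed (simp add: deg_ge_zero)
  then show ?thesis by blast
qed

text \<open>
  The functional \<open>s \<otimes> g \<mapsto> s g\<^sub>a\<close>, where \<open>g\<^sub>a\<close> is the coefficient of \<open>x\<^sup>a\<close>, is well defined on the fibre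
  if \<open>a\<close> involves no cone point, so this coefficient can be read off the class.
\<close>

lemma fibre_class_kernel_only_if:
  assumes f: "f \<in> deg_ge n" and eq: "fibre_class n f = fibre_class n 0" and a: "a \<in> noncone_exps n"
  shows "lookup f a = 0"
proof -
  define \<epsilon> where "\<epsilon> s = lookup (SOME b. to_k b = s) 0" for s :: "('v, 'k) mpoly set"
  define \<kappa> where "\<kappa> y = lookup (SOME g. g \<in> deg_ge n \<and> gr_class n g = y) a" for y
  have eps: "\<epsilon> (to_k b) = lookup b 0" for b
    unfolding \<epsilon>_def by (rule someI2[of _ b]) (auto simp: to_k_eq_iff)
  have kap: "\<kappa> (gr_class n g) = lookup g a" if g: "g \<in> deg_ge n" for g
    unfolding \<kappa>_def
  proof (rule someI2[of _ g])
    fix h assume h: "h \<in> deg_ge n \<and> gr_class n h = gr_class n g"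
    then have "h - g \<in> deg_ge (Suc n)" using gr_class_eq_iff g by blast
    then have "a \<notin> keys (h - g)" using a by (auto simp: deg_ge_def noncone_exps_def graded_exps_def)
    then show "lookup h a = lookup g a" by (simp add: in_keys_iff lookup_minus)
  qed (use g in simp)
  have mult_a: "lookup (c * g) a = lookup c 0 * lookup g a" if g: "g \<in> deg_ge n" for c g
  proof (rule lookup_mult_isolated)
    fix u m assume um: "m \<in> keys g" "u + m = a"
    then have ka: "keys a = keys u \<union> keys m" by (auto simp: keys_add_nat)
    have "keys m \<in> \<Delta>" using a ka subface[OF complex, of "keys a" "keys m"]
      by (auto simp: noncone_exps_def graded_exps_def)
    then have "n \<le> mdeg \<Delta> m" using g um by (auto simp: deg_ge_def)
    then have "mdeg \<Delta> u = 0" using a um by (auto simp: noncone_exps_def graded_exps_def mdeg_add)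
    then have "keys u \<inter> noncone \<Delta> = {}" using mdeg_pos_iff[of \<Delta> u] by simp
    moreover have "keys u \<subseteq> noncone \<Delta>" using ka a by (auto simp: noncone_exps_def)
    ultimately have "keys u = {}" by blast
    then show "u = 0" by simp
  qed
  have mult_0: "lookup (b * c) 0 = lookup b 0 * lookup c 0" for b c :: "('v, 'k) mpoly"
  proof (rule lookup_mult_isolated)
    fix u m :: "'v \<Rightarrow>\<^sub>0 nat" assume "u + m = 0"
    then have "keys u \<union> keys m = {}" using keys_add_nat[of u m] by simp
    then show "u = 0" by simp
  qed
  let ?f = "\<lambda>(s, y). \<epsilon> s * \<kappa> y"
  have kE: "\<exists>b. c = to_k b" if "c \<in> carrier kring" for c :: "('v, 'k) mpoly set"
    using that by (auto simp: carrier_kring)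
  have GE: "\<exists>g\<in>deg_ge n. y = gr_class n g" if "y \<in> carrier (Gr_R I n)" for y
    using that by (auto simp: Gr_R_sel Gr_carrier)
  have lift: "tensor_lift (ring_of_type_algebra :: 'k ring) ?f (fibre_class n g) = ?f (\<one>\<^bsub>kring\<^esub>, gr_class n g)"
    if g: "g \<in> deg_ge n" for g
    unfolding fibre_class_def
  proof (rule scalar_extension.tensor_lift_tens[OF Gr_k_scalar_extension], goal_cases)
    case 1
    show ?case using ring_poly by (rule ring.is_abelian_group)
  next
    case (2 s x)
    show ?case by simp
  next
    case (3 s s' x)
    then obtain b b' where "s = to_k b" "s' = to_k b'" using kE by meson
    then show ?case by (simp add: to_k_simps eps lookup_add distrib_right)
  next
    case (4 s x x')
    then obtain g g' where "g \<in> deg_ge n" "x = gr_class n g" "g' \<in> deg_ge n" "x' = gr_class n g'" using GE by meson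
    then show ?case by (simp add: Gr_R_sel gr_class_add kap deg_ge_add lookup_add distrib_left)
  next
    case (5 s r x)
    then obtain b c g where "s = to_k b" "r = to_R I c" "g \<in> deg_ge n" "x = gr_class n g"
      using kE GE carrier_Rring by (metis imageE)
    then show ?case
      by (simp add: R_to_k_to_R to_k_simps eps Gr_R_smult kap deg_ge_mult mult_a mult_0)
  qed (use g in \<open>auto simp: one_kring Gr_R_sel Gr_carrier\<close>)
  have "lookup f a = lookup (0 :: ('v, 'k) mpoly) a"
    using lift[OF f] lift[OF deg_ge_zero] eq f by (simp add: kap deg_ge_zero to_k_simps eps)
  then show ?thesis by simp
qed

lemma fibre_class_kernel: assumes "f \<in> deg_ge n" shows "fibre_class n f = fibre_class n 0 \<longleftrightarrow> keys f \<inter> noncone_exps n = {}"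
  using fibre_class_kernel_if[OF assms] fibre_class_kernel_only_if[OF assms] by (auto simp: in_keys_iff)

end

section \<open>Lengths\<close>

lemma card_chain_le:
  assumes "finite Q" "\<And>T. T \<in> C \<Longrightarrow> T \<subseteq> Q" "\<And>S T. S \<in> C \<Longrightarrow> T \<in> C \<Longrightarrow> S \<subseteq> T \<or> T \<subseteq> S"
  shows "card C \<le> Suc (card Q)"
proof -
  have "inj_on card C"
  proof (rule inj_onI)
    fix S T assume "S \<in> C" "T \<in> C" "card S = card T"
    then show "S = T"
      using assms by (metis card_subset_eq finite_subset)
  qed
  moreover have "card ` C \<subseteq> {..card Q}"
    using assms by (auto intro: card_mono)
  ultimately have "card C \<le> card {..card Q}" by (metis card_inj_on_le finite_atMost)
  then show ?thesis by simp
qed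

text \<open>
  The common setting for the graded pieces and their fibres.  \<open>M\<close> is presented by the polynomials in
  \<open>J\<^sup>n + I\<close>, the monomials with exponent in \<open>E\<close> give a basis, and the stable submodules are those
  stable under multiplication by polynomials and under the derivations in \<open>Th\<close>.  These include the
  exchanges inside strata and, for every cone point \<open>j\<close> that the basis involves, \<open>\<partial>\<^sub>j\<close> and
  \<open>x\<^sub>j \<partial>\<^sub>j\<close>.
\<close>

locale length_count = stanley_reisner \<Delta> I + presentation "deg_ge n" \<pi> M
  for \<Delta> :: "'v::finite set set" and I :: "('v, 'k::field_char_0) mpoly set" and n :: nat
    and \<pi> :: "('v, 'k) mpoly \<Rightarrow> 'b" and M :: "('a, 'b) module" +
  fixes A :: "'a ring" and L :: "'l set" and act :: "'l \<Rightarrow> 'b \<Rightarrow> 'b"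
    and Th :: "(('v, 'k) mpoly \<Rightarrow> ('v, 'k) mpoly) set" and E :: "('v \<Rightarrow>\<^sub>0 nat) set"
  assumes kernel: "\<And>f. f \<in> deg_ge n \<Longrightarrow> \<pi> f = \<pi> 0 \<longleftrightarrow> keys f \<inter> E = {}"
    and stable: "\<And>W. W \<in> stable_submodules A M L act \<longleftrightarrow> subgroup W (add_monoid M) \<and>
      (\<forall>f\<in>deg_ge n. \<pi> f \<in> W \<longrightarrow> (\<forall>b. \<pi> (b * f) \<in> W) \<and> (\<forall>D\<in>Th. \<pi> (D f) \<in> W))"
    and Th_TBI: "Th \<subseteq> carrier (TBI I)"
    and Th_exchange: "\<And>i j. i \<in> noncone \<Delta> \<Longrightarrow> j \<in> noncone \<Delta> \<Longrightarrow> facets_at \<Delta> i = facets_at \<Delta> j \<Longrightarrow>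
      (\<lambda>f. var i * partial j f) \<in> Th"
    and Th_cone: "\<And>m j. m \<in> E \<Longrightarrow> j \<in> keys m \<Longrightarrow> j \<notin> noncone \<Delta> \<Longrightarrow>
      partial j \<in> Th \<and> (\<lambda>f. var j * partial j f) \<in> Th"
    and E_graded_exps: "E \<subseteq> graded_exps n" and noncone_E: "noncone_exps n \<subseteq> E"
    and E_step: "\<And>D d m m' j. D \<in> Th \<Longrightarrow> d \<in> keys (D (var j)) \<Longrightarrow> m' + unit_exp j = d + m \<Longrightarrow>
      lookup m j > 0 \<Longrightarrow> m' \<in> E \<Longrightarrow> m \<in> graded_exps n \<Longrightarrow> m \<in> E"
    and E_mult: "\<And>u m. u + m \<in> E \<Longrightarrow> m \<in> graded_exps n \<Longrightarrow> m \<in> E"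
begin

text \<open>
  The preimage of a submodule, the polynomials whose basis monomials have multidegree in a given set,
  and the multidegrees of the basis monomials in a submodule.
\<close>

definition preim :: "'b set \<Rightarrow> ('v, 'k) mpoly set" where
  "preim W = {f \<in> deg_ge n. \<pi> f \<in> W}"

definition mspan :: "('v set \<Rightarrow> nat) set \<Rightarrow> ('v, 'k) mpoly set" where
  "mspan T = {f \<in> deg_ge n. \<forall>m\<in>keys f \<inter> E. sdeg \<Delta> m \<in> T}"

definition degs :: "'b set \<Rightarrow> ('v set \<Rightarrow> nat) set" where
  "degs W = sdeg \<Delta> ` {m \<in> E. single m 1 \<in> preim W}"

lemma single_deg_ge: "m \<in> graded_exps n \<Longrightarrow> single m c \<in> deg_ge n"
  by (auto simp: deg_ge_def graded_exps_def)

lemma E_single_deg_ge: "m \<in> E \<Longrightarrow> single m c \<in> deg_ge n"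
  using single_deg_ge E_graded_exps by blast

lemma restr_deg_ge: "f \<in> deg_ge n \<Longrightarrow> restr B f \<in> deg_ge n"
  by (auto simp: deg_ge_def keys_restr)

lemma Th_der: "D \<in> Th \<Longrightarrow> D \<in> ders"
  using Th_TBI TBI_ders by blast

lemma Th_deg_ge: "D \<in> Th \<Longrightarrow> f \<in> deg_ge n \<Longrightarrow> D f \<in> deg_ge n"
  using Th_TBI deg_ge_der by blast

lemma noncone_part:
  assumes "m \<in> graded_exps n"
  shows "restr (noncone \<Delta>) m \<in> E" and "sdeg \<Delta> (restr (noncone \<Delta>) m) = sdeg \<Delta> m"
proof -
  have m: "keys m \<in> \<Delta>" "mdeg \<Delta> m = n" using assms by (auto simp: graded_exps_def)
  have "keys (restr (noncone \<Delta>) m) \<in> \<Delta>" using subface[OF complex m(1)] by (simp add: keys_restr)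
  moreover have "mdeg \<Delta> (restr (noncone \<Delta>) m) = n" using m by (simp add: mdeg_def lookup_restr)
  ultimately show "restr (noncone \<Delta>) m \<in> E" using noncone_E by (auto simp: noncone_exps_def graded_exps_def keys_restr)
  show "sdeg \<Delta> (restr (noncone \<Delta>) m) = sdeg \<Delta> m"
    by (auto simp: sdeg_def lookup_restr intro!: sum.cong)
qed

lemma sdeg_image_E: "sdeg \<Delta> ` E = sdegs \<Delta> n"
proof
  show "sdeg \<Delta> ` E \<subseteq> sdegs \<Delta> n" using E_graded_exps by (auto simp: sdegs_def graded_exps_def)
  show "sdegs \<Delta> n \<subseteq> sdeg \<Delta> ` E"
  proof
    fix d assume "d \<in> sdegs \<Delta> n"
    then obtain m where m: "d = sdeg \<Delta> m" "m \<in> graded_exps n" by (auto simp: sdegs_def graded_exps_def)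
    then show "d \<in> sdeg \<Delta> ` E" using noncone_part[OF m(2)] by (metis imageI)
  qed
qed

lemma degs_sub: "degs W \<subseteq> sdegs \<Delta> n"
  using sdeg_image_E by (auto simp: degs_def)

subsection \<open>Stable submodules are determined by strata degrees\<close>

context
  fixes W assumes W: "W \<in> stable_submodules A M L act"
begin

lemma W_sub: "subgroup W (add_monoid M)"
  using W stable by blast

lemma preim_zero: "0 \<in> preim W"
  using subgroup_preimage(1)[OF W_sub] deg_ge_zero by (simp add: preim_def)

lemma preim_diff: "f \<in> preim W \<Longrightarrow> g \<in> preim W \<Longrightarrow> f - g \<in> preim W"
  using subgroup_preimage(2)[OF W_sub] deg_ge_diff by (simp add: preim_def)

lemma preim_add: "f \<in> preim W \<Longrightarrow> g \<in> preim W \<Longrightarrow> f + g \<in> preim W"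
  using preim_diff[of f "- g"] preim_diff[OF preim_zero, of g] by simp

lemma preim_mult: "f \<in> preim W \<Longrightarrow> b * f \<in> preim W"
  using W stable deg_ge_mult by (auto simp: preim_def)

lemma preim_Th: "D \<in> Th \<Longrightarrow> f \<in> preim W \<Longrightarrow> D f \<in> preim W"
  using W stable Th_deg_ge by (auto simp: preim_def)

lemma preim_kernel: "f \<in> deg_ge n \<Longrightarrow> keys f \<inter> E = {} \<Longrightarrow> f \<in> preim W"
  using kernel[of f] preim_zero by (simp add: preim_def)

lemma preim_single: assumes "single m c \<in> preim W" "c \<noteq> 0" shows "single m d \<in> preim W"
  using preim_mult[OF assms(1), of "const (d / c)"] assms(2) by (simp add: const_mult_single)

lemma separating_der:
  assumes "m \<in> E" "m' \<in> E" "m \<noteq> m'"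
  obtains i where "lookup m i \<noteq> lookup m' i" "(\<lambda>f. var i * partial i f) \<in> Th"
proof -
  obtain i where i: "lookup m i \<noteq> lookup m' i"
    using assms(3) by (auto simp: poly_mapping_eq_iff fun_eq_iff)
  then have k: "i \<in> keys m \<or> i \<in> keys m'" by (metis in_keys_iff)
  have "(\<lambda>f. var i * partial i f) \<in> Th"
  proof (cases "i \<in> noncone \<Delta>")
    case True
    then show ?thesis by (intro Th_exchange) simp_all
  next
    case False
    then show ?thesis using k Th_cone[of m i] Th_cone[of m' i] assms(1,2) by blast
  qed
  with i show thesis by (rule that)
qed

lemma lookup_euler: "lookup (var i * partial i f) m = of_nat (lookup m i) * lookup f m"
proof (cases "lookup m i = 0")
  case True
  have "m \<noteq> unit_exp i + t" for t using True by (auto simp: lookup_add)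
  then show ?thesis using True by (simp add: var_def lookup_single_mult_0)
next
  case False
  then have m: "m = unit_exp i + (m - unit_exp i)" using unit_exp_le[of m i] by simp
  have "lookup (var i * partial i f) (unit_exp i + (m - unit_exp i)) = lookup (partial i f) (m - unit_exp i)"
    by (simp add: var_def lookup_single_mult)
  also have "\<dots> = of_nat (lookup m i) * lookup f m"
    using m False by (simp add: lookup_partial lookup_minus add.commute)
  finally show ?thesis using m by simp
qed

text \<open>
  The exponents in \<open>E\<close> are separated by the eigenvalues of the operators \<open>x\<^sub>i \<partial>\<^sub>i\<close>; subtracting an
  eigenvalue removes one monomial at a time.
\<close>

lemma separate:
  assumes "f \<in> preim W" "keys f \<subseteq> E" "m \<in> keys f"
  shows "single m 1 \<in> preim W"
  using assms
proof (induction "card (keys f)" arbitrary: f rule: less_induct)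
  case less
  show ?case
  proof (cases "keys f = {m}")
    case True
    have "f = single m (lookup f m)"
    proof (rule poly_mapping_eqI)
      fix u
      have "lookup f u = 0" if "u \<noteq> m"
        using True that by (metis in_keys_iff singletonD)
      then show "lookup f u = lookup (single m (lookup f m)) u"
        by (cases "u = m") (simp_all add: lookup_single)
    qed
    moreover have "lookup f m \<noteq> 0" using less.prems(3) by (simp add: in_keys_iff)
    ultimately show ?thesis using less.prems(1) preim_single[of m "lookup f m" 1] by metis
  next
    case False
    then obtain m' where m': "m' \<in> keys f" "m' \<noteq> m" using less.prems by blast
    then obtain i where i: "lookup m i \<noteq> lookup m' i" and D: "(\<lambda>f. var i * partial i f) \<in> Th"
      using separating_der[of m m'] less.prems by blast
    \<comment> \<open>the term at \<open>m'\<close> is killed, the one at \<open>m\<close> survives\<close>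
    define g where "g = var i * partial i f - const (of_nat (lookup m' i)) * f"
    have g: "lookup g u = (of_nat (lookup u i) - of_nat (lookup m' i)) * lookup f u" for u
      by (simp add: g_def lookup_minus lookup_euler left_diff_distrib)
    have "keys g \<subseteq> keys f - {m'}" by (auto simp: in_keys_iff g)
    then have "card (keys g) < card (keys f)"
      using m'(1) by (intro psubset_card_mono) auto
    moreover have "g \<in> preim W"
      unfolding g_def using preim_diff preim_Th[OF D] preim_mult less.prems(1) by blast
    moreover have "m \<in> keys g" using i less.prems(3) by (simp add: in_keys_iff g)
    moreover have "keys g \<subseteq> E" using \<open>keys g \<subseteq> keys f - {m'}\<close> less.prems(2) by blast
    ultimately show ?thesis using less.hyps by blast
  qed
qed

lemma monomial_in_preim:
  assumes f: "f \<in> preim W" and m: "m \<in> keys f" "m \<in> E"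
  shows "single m 1 \<in> preim W"
proof (rule separate)
  have "restr (- E) f \<in> preim W"
    using f by (intro preim_kernel restr_deg_ge) (auto simp: preim_def keys_restr)
  then have "f - restr (- E) f \<in> preim W" using f preim_diff by blast
  moreover have "restr E f = f - restr (- E) f" using restr_decomp[of f E] by (metis add_diff_cancel)
  ultimately show "restr E f \<in> preim W" by simp
qed (use m in \<open>auto simp: keys_restr\<close>)



text \<open>Differentiation removes the cone variables from a monomial.\<close>

lemma drop_cone:
  assumes "m \<in> E" "single m 1 \<in> preim W"
  shows "single (restr (noncone \<Delta>) m) 1 \<in> preim W"
  using assms
proof (induction "\<Sum>i\<in>UNIV. lookup m i" arbitrary: m rule: less_induct)
  case less
  show ?case
  proof (cases "keys m \<subseteq> noncone \<Delta>")
    case True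
    then have "restr (noncone \<Delta>) m = m"
      by (intro poly_mapping_eqI) (auto simp: lookup_restr in_keys_iff)
    then show ?thesis using less.prems by simp
  next
    case False
    then obtain j where j: "j \<in> keys m" "j \<notin> noncone \<Delta>" by blast
    define m0 where "m0 = m - unit_exp j"
    have m0: "m = unit_exp j + m0" using j unit_exp_le[of m j] by (simp add: m0_def in_keys_iff)
    have D: "partial j \<in> Th" using Th_cone[OF less.prems(1) j] by blast
    have "partial j (single m 1) = (single m0 (of_nat (lookup m j)) :: ('v, 'k) mpoly)"
      by (simp add: partial_single m0_def)
    then have "single m0 (of_nat (lookup m j)) \<in> preim W"
      using preim_Th[OF D less.prems(2)] by simp
    then have "single m0 1 \<in> preim W"
      using preim_single[of m0 "of_nat (lookup m j)" 1] j by (simp add: in_keys_iff)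
    moreover have "m0 \<in> E"
    proof (rule E_mult[of "unit_exp j"])
      have "m \<in> graded_exps n" using less.prems E_graded_exps by blast
      then show "m0 \<in> graded_exps n"
        using j subface[OF complex, of "keys m" "keys m0"] m0
        by (auto simp: graded_exps_def mdeg_add mdeg_unit_exp keys_add_nat)
    qed (use less.prems m0 in simp)
    moreover have "(\<Sum>i\<in>UNIV. lookup m0 i) < (\<Sum>i\<in>UNIV. lookup m i)"
    proof -
      have "(\<Sum>i\<in>UNIV. lookup m i) = 1 + (\<Sum>i\<in>UNIV. lookup m0 i)"
        unfolding m0 by (simp add: lookup_add sum.distrib lookup_single when_def)
      then show ?thesis by simp
    qed
    ultimately have "single (restr (noncone \<Delta>) m0) 1 \<in> preim W" using less.hyps by blast
    moreover have "restr (noncone \<Delta>) m0 = restr (noncone \<Delta>) m"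
      using j by (intro poly_mapping_eqI) (auto simp: lookup_restr m0 lookup_add lookup_single when_def)
    ultimately show ?thesis by simp
  qed
qed

lemma same_sdeg_in_preim:
  assumes "m \<in> E" "single m 1 \<in> preim W" "m' \<in> E" "sdeg \<Delta> m' = sdeg \<Delta> m"
  shows "single m' 1 \<in> preim W"
proof -
  let ?r = "restr (noncone \<Delta>)"
  let ?S = "{u. single u (1 :: 'k) \<in> preim W}"
  have "?r m' \<in> ?S"
  proof (rule exchange_connected[where m = "?r m" and \<Delta> = \<Delta>])
    show "unit_exp i + u \<in> ?S"
      if S: "unit_exp j + u \<in> ?S" and ij: "i \<in> noncone \<Delta>" "j \<in> noncone \<Delta>" "stratum_of \<Delta> i = stratum_of \<Delta> j"
      for u i j
    proof -
      have D: "(\<lambda>f. var i * partial j f) \<in> Th" using Th_exchange ij by (simp add: stratum_of_eq_iff)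
      have "var i * partial j (single (unit_exp j + u) (1 :: 'k)) = single (unit_exp i + u) (of_nat (1 + lookup u j))"
        by (simp add: partial_single var_mult_single lookup_add)
      then have "single (unit_exp i + u) (of_nat (1 + lookup u j)) \<in> preim W"
        using preim_Th[OF D, of "single (unit_exp j + u) 1"] S by simp
      \<comment> \<open>this coefficient is nonzero because the characteristic is 0\<close>
      moreover have "of_nat (1 + lookup u j) \<noteq> (0 :: 'k)" by (simp only: of_nat_eq_0_iff)
      ultimately show ?thesis using preim_single by blast
    qed
    show "?r m \<in> ?S" using drop_cone assms by blast
    show "sdeg \<Delta> (?r m) = sdeg \<Delta> (?r m')" using assms E_graded_exps noncone_part(2) by (simp add: subset_iff)
  qed (simp_all add: keys_restr)
  then have "single (m' - ?r m') 1 * single (?r m') 1 \<in> preim W" using preim_mult by blast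
  moreover have "(m' - ?r m') + ?r m' = m'"
    by (rule poly_mapping_eqI) (simp add: lookup_add lookup_minus lookup_restr)
  ultimately show ?thesis by (simp add: mult_single)
qed

lemma preim_eq_mspan: "preim W = mspan (degs W)"
proof
  show "preim W \<subseteq> mspan (degs W)"
    using monomial_in_preim by (auto simp: mspan_def degs_def) (simp add: preim_def)
  show "mspan (degs W) \<subseteq> preim W"
  proof
    fix f assume f: "f \<in> mspan (degs W)"
    show "f \<in> preim W"
    proof (rule poly_sum_induct[of "\<lambda>g. g \<in> preim W"])
      fix m assume m: "m \<in> keys f"
      show "single m (lookup f m) \<in> preim W"
      proof (cases "m \<in> E")
        case True
        then have "sdeg \<Delta> m \<in> degs W" using f m by (simp add: mspan_def)
        then obtain m0 where "m0 \<in> E" "single m0 1 \<in> preim W" "sdeg \<Delta> m = sdeg \<Delta> m0"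
          by (auto simp: degs_def)
        then have "single m 1 \<in> preim W" using same_sdeg_in_preim True by blast
        then show ?thesis using preim_single by (metis zero_neq_one)
      next
        case False
        have "single m (lookup f m) \<in> deg_ge n" using f m by (auto simp: mspan_def deg_ge_def)
        then show ?thesis using False by (intro preim_kernel) auto
      qed
    qed (simp_all add: preim_zero preim_add)
  qed
qed

end

lemma W_eq_preim: assumes "W \<in> stable_submodules A M L act" shows "W = \<pi> ` preim W"
proof -
  have "W \<subseteq> carrier M" using subgroup.subset[OF W_sub[OF assms]] by simp
  then show ?thesis by (auto simp: preim_def carrier_eq)
qed

subsection \<open>Filtration by weight\<close>

lemma mspan_diff: "f \<in> mspan T \<Longrightarrow> g \<in> mspan T \<Longrightarrow> f - g \<in> mspan T"
  using keys_diff[of f g] deg_ge_diff by (auto simp: mspan_def)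

lemma preim_image_mspan: "preim (\<pi> ` mspan T) = mspan T"
proof
  show "mspan T \<subseteq> preim (\<pi> ` mspan T)" by (auto simp: preim_def mspan_def)
  show "preim (\<pi> ` mspan T) \<subseteq> mspan T"
  proof
    fix f assume f: "f \<in> preim (\<pi> ` mspan T)"
    then obtain g where g: "f \<in> deg_ge n" "g \<in> mspan T" "\<pi> f = \<pi> g" by (auto simp: preim_def)
    then have gP: "g \<in> deg_ge n" by (simp add: mspan_def)
    have "\<pi> (f - g) = \<pi> (g - g)" using g gP by (simp only: pi_diff)
    then have "keys (f - g) \<inter> E = {}" using kernel[of "f - g"] deg_ge_diff g gP by simp
    then have "lookup f m = lookup g m" if "m \<in> E" for m
      using that by (auto simp: in_keys_iff lookup_minus disjoint_iff)
    then show "f \<in> mspan T" using g by (auto simp: mspan_def in_keys_iff)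
  qed
qed

text \<open>
  A set of multidegrees that contains with each multidegree all those of smaller weight spans a stable
  submodule.
\<close>

lemma mspan_stable:
  assumes T: "\<And>q q'. q \<in> T \<Longrightarrow> q' \<in> sdegs \<Delta> n \<Longrightarrow> weight \<Delta> q' < weight \<Delta> q \<Longrightarrow> q' \<in> T"
  shows "\<pi> ` mspan T \<in> stable_submodules A M L act"
  unfolding stable
proof (intro conjI ballI impI allI)
  show "subgroup (\<pi> ` mspan T) (add_monoid M)"
    by (rule subgroup_image) (auto simp: mspan_diff, auto simp: mspan_def deg_ge_zero)
  fix f assume "f \<in> deg_ge n" "\<pi> f \<in> \<pi> ` mspan T"
  then have f: "f \<in> mspan T" using preim_image_mspan[of T] by (auto simp: preim_def)
  show "\<pi> (b * f) \<in> \<pi> ` mspan T" for b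
  proof (rule imageI)
    have "sdeg \<Delta> m' \<in> T" if m': "m' \<in> keys (b * f)" "m' \<in> E" for m'
    proof -
      obtain u m where um: "m' = u + m" "m \<in> keys f" using keys_mult[of b f] m'(1) by blast
      have R: "keys m' \<in> \<Delta>" "mdeg \<Delta> m' = n" using m'(2) E_graded_exps by (auto simp: graded_exps_def)
      then have "keys m \<in> \<Delta>" using subface[OF complex, of "keys m'" "keys m"] by (auto simp: um keys_add_nat)
      moreover from this have "n \<le> mdeg \<Delta> m" using f um by (auto simp: mspan_def deg_ge_def)
      then have deg: "mdeg \<Delta> m = n" "mdeg \<Delta> u = 0" using R um by (auto simp: mdeg_add)
      ultimately have "m \<in> E" using E_mult[of u m] m'(2) um by (auto simp: graded_exps_def)
      then have "sdeg \<Delta> m \<in> T" using f um by (auto simp: mspan_def)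
      moreover have "sdeg \<Delta> m' = sdeg \<Delta> m" using deg(2) by (auto simp: um sdeg_add sdeg_eq_0)
      ultimately show ?thesis by simp
    qed
    then show "b * f \<in> mspan T" using f by (auto simp: mspan_def deg_ge_mult)
  qed
  show "\<pi> (D f) \<in> \<pi> ` mspan T" if D: "D \<in> Th" for D
  proof (rule imageI)
    have TD: "D \<in> carrier (TBI I)" using D Th_TBI by blast
    have "sdeg \<Delta> m' \<in> T" if m': "m' \<in> keys (D f)" "m' \<in> E" for m'
    proof -
      obtain m j d where md: "m \<in> keys f" "lookup m j > 0" "d \<in> keys (D (var j))" "m' + unit_exp j = d + m"
        using keys_der[OF Th_der[OF D] m'(1)] by blast
      note step = TBI_step[OF TD md(3,4)]
      have R: "keys m' \<in> \<Delta>" "mdeg \<Delta> m' = n" using m'(2) E_graded_exps by (auto simp: graded_exps_def)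
      then have km: "keys m \<in> \<Delta>" using step(1) md(2) by blast
      then have "n \<le> mdeg \<Delta> m" using f md(1) by (auto simp: mspan_def deg_ge_def)
      then have deg: "mdeg \<Delta> m = n" using step(2) R by simp
      then have "m \<in> E" using E_step[OF D md(3,4,2) m'(2)] km by (auto simp: graded_exps_def)
      then have mT: "sdeg \<Delta> m \<in> T" using f md(1) by (auto simp: mspan_def)
      have "sdeg \<Delta> m' \<in> sdegs \<Delta> n" using m'(2) sdeg_image_E by blast
      moreover have "sdeg \<Delta> m' = sdeg \<Delta> m \<or> weight \<Delta> (sdeg \<Delta> m') < weight \<Delta> (sdeg \<Delta> m)"
        using step(3) deg R by simp
      ultimately show ?thesis using T mT by metis
    qed
    then show "D f \<in> mspan T" using f Th_deg_ge[OF D] by (auto simp: mspan_def)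
  qed
qed

lemma mspan_mono_iff:
  assumes "T \<subseteq> sdegs \<Delta> n"
  shows "mspan T \<subseteq> mspan T' \<longleftrightarrow> T \<subseteq> T'"
proof
  assume sub: "mspan T \<subseteq> mspan T'"
  show "T \<subseteq> T'"
  proof
    fix q assume q: "q \<in> T"
    then obtain m where m: "m \<in> E" "q = sdeg \<Delta> m" using assms sdeg_image_E by blast
    then have "single m 1 \<in> mspan T" using q E_single_deg_ge by (auto simp: mspan_def)
    then have "single m 1 \<in> mspan T'" using sub by blast
    then show "q \<in> T'" using m by (auto simp: mspan_def)
  qed
qed (auto simp: mspan_def)

lemma length_eq: "lie_length A M L act = enat (card (sdegs \<Delta> n))"
  unfolding lie_length_def
proof (rule antisym)
  let ?Q = "sdegs \<Delta> n"
  let ?Ch = "{C. C \<subseteq> stable_submodules A M L act \<and> finite C \<and> C \<noteq> {} \<and> (\<forall>U\<in>C. \<forall>V\<in>C. U \<subseteq> V \<or> V \<subseteq> U)}"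
  show "(SUP C\<in>?Ch. enat (card C - 1)) \<le> enat (card ?Q)"
  proof (rule SUP_least)
    fix C assume C: "C \<in> ?Ch"
    have eq: "U = \<pi> ` mspan (degs U)" if "U \<in> C" for U
      using that C W_eq_preim[of U] preim_eq_mspan[of U] by auto
    then have "inj_on degs C" by (metis inj_onI)
    then have "card C = card (degs ` C)" by (simp add: card_image)
    also have "\<dots> \<le> Suc (card ?Q)"
    proof (rule card_chain_le[OF finite_sdegs])
      have mono: "degs U \<subseteq> degs V" if "U \<subseteq> V" for U V
        using that by (auto simp: degs_def preim_def)
      fix S T assume ST: "S \<in> degs ` C" "T \<in> degs ` C"
      from ST obtain U V where UV: "S = degs U" "T = degs V" "U \<in> C" "V \<in> C" by blast
      then have "U \<subseteq> V \<or> V \<subseteq> U" using C by simp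
      then show "S \<subseteq> T \<or> T \<subseteq> S" using mono UV by metis
    qed (use degs_sub in blast)
    finally show "enat (card C - 1) \<le> enat (card ?Q)" by simp
  qed
  obtain xs0 where xs0: "set xs0 = ?Q" "distinct xs0" using finite_distinct_list[OF finite_sdegs] by blast
  \<comment> \<open>the multidegrees by increasing weight; every initial segment \<open>Tk k\<close> spans a stable submodule\<close>
  define xs where "xs = sort_key (weight \<Delta>) xs0"
  have xs: "set xs = ?Q" "distinct xs" "sorted (map (weight \<Delta>) xs)" "length xs = card ?Q"
    using xs0 distinct_card[OF xs0(2)] by (simp_all add: xs_def)
  define Tk where "Tk k = set (take k xs)" for k
  have Tk_sub: "Tk k \<subseteq> ?Q" for k using xs(1) set_take_subset[of k xs] by (simp add: Tk_def)
  have Tk_card: "card (Tk k) = k" if "k \<le> card ?Q" for k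
    using that xs(2,4) by (simp add: Tk_def distinct_card)
  have Tk_mono: "Tk k \<subseteq> Tk l" if "k \<le> l" for k l
    using that by (simp add: Tk_def set_take_subset_set_take)
  have Tk_down: "q' \<in> Tk k" if "q \<in> Tk k" "q' \<in> ?Q" "weight \<Delta> q' < weight \<Delta> q" for q q' k
  proof -
    from that(1) obtain i where i: "i < length xs" "i < k" "xs ! i = q"
      by (auto simp: Tk_def in_set_conv_nth)
    from that(2) obtain l where l: "l < length xs" "xs ! l = q'"
      by (metis in_set_conv_nth xs(1))
    have "l < i"
    proof (rule ccontr)
      assume "\<not> l < i"
      then have "weight \<Delta> q \<le> weight \<Delta> q'"
        using sorted_nth_mono[OF xs(3), of i l] i l by simp
      then show False using that(3) by simp
    qed
    then show ?thesis using i l by (auto simp: Tk_def in_set_conv_nth intro!: exI[of _ l])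
  qed
  define Ck where "Ck = (\<lambda>k. \<pi> ` mspan (Tk k)) ` {..card ?Q}"
  have "inj_on (\<lambda>k. \<pi> ` mspan (Tk k)) {..card ?Q}"
  proof (rule inj_onI)
    fix k l assume kl: "k \<in> {..card ?Q}" "l \<in> {..card ?Q}" and "\<pi> ` mspan (Tk k) = \<pi> ` mspan (Tk l)"
    then have "mspan (Tk k) = mspan (Tk l)" using preim_image_mspan by metis
    then have "Tk k = Tk l" using mspan_mono_iff[OF Tk_sub] by blast
    then show "k = l" using Tk_card kl by (metis atMost_iff)
  qed
  then have "card Ck = Suc (card ?Q)" by (simp add: Ck_def card_image)
  moreover have "Ck \<in> ?Ch"
  proof (intro CollectI conjI ballI)
    have "\<pi> ` mspan (Tk k) \<in> stable_submodules A M L act" for k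
      by (rule mspan_stable) (rule Tk_down)
    then show "Ck \<subseteq> stable_submodules A M L act" by (auto simp: Ck_def)
    fix U V assume "U \<in> Ck" "V \<in> Ck"
    then obtain k l where kl: "U = \<pi> ` mspan (Tk k)" "V = \<pi> ` mspan (Tk l)" by (auto simp: Ck_def)
    have "k \<le> l \<or> l \<le> k" by linarith
    then have "mspan (Tk k) \<subseteq> mspan (Tk l) \<or> mspan (Tk l) \<subseteq> mspan (Tk k)"
      using mspan_mono_iff[OF Tk_sub] Tk_mono by blast
    then show "U \<subseteq> V \<or> V \<subseteq> U" using kl by blast
  qed (auto simp: Ck_def)
  ultimately show "enat (card ?Q) \<le> (SUP C\<in>?Ch. enat (card C - 1))"
    by (intro SUP_upper2[of Ck]) auto
qed

end

context stanley_reisner begin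

lemma length_T_eq: "length_T I n = enat (card (sdegs \<Delta> n))"
proof -
  interpret Gr: presentation "deg_ge n" "gr_class n" "Gr I n" by (rule Gr_presentation)
  have stable: "W \<in> stable_submodules poly_ring (Gr I n) (carrier (TBI I)) (act_Gr I n) \<longleftrightarrow>
      subgroup W (add_monoid (Gr I n)) \<and> (\<forall>f\<in>deg_ge n. gr_class n f \<in> W \<longrightarrow>
        (\<forall>b. gr_class n (b * f) \<in> W) \<and> (\<forall>D\<in>carrier (TBI I). gr_class n (D f) \<in> W))" for W
  proof (cases "subgroup W (add_monoid (Gr I n))")
    case True
    then have "W \<subseteq> gr_class n ` deg_ge n" using subgroup.subset Gr_carrier by force
    then have ball: "(\<forall>w\<in>W. P w) \<longleftrightarrow> (\<forall>f\<in>deg_ge n. gr_class n f \<in> W \<longrightarrow> P (gr_class n f))" for P by blast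
    have "W \<in> stable_submodules poly_ring (Gr I n) (carrier (TBI I)) (act_Gr I n) \<longleftrightarrow>
        (\<forall>w\<in>W. (\<forall>b. b \<odot>\<^bsub>Gr I n\<^esub> w \<in> W) \<and> (\<forall>D\<in>carrier (TBI I). act_Gr I n D w \<in> W))"
      using True by (auto simp: stable_submodules_def submodule_def submodule_axioms_def)
    also have "\<dots> \<longleftrightarrow> (\<forall>f\<in>deg_ge n. gr_class n f \<in> W \<longrightarrow>
        (\<forall>b. b \<odot>\<^bsub>Gr I n\<^esub> gr_class n f \<in> W) \<and> (\<forall>D\<in>carrier (TBI I). act_Gr I n D (gr_class n f) \<in> W))"
      by (rule ball)
    also have "\<dots> \<longleftrightarrow> (\<forall>f\<in>deg_ge n. gr_class n f \<in> W \<longrightarrow>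
        (\<forall>b. gr_class n (b * f) \<in> W) \<and> (\<forall>D\<in>carrier (TBI I). gr_class n (D f) \<in> W))"
      by (simp add: gr_class_smult act_Gr_class cong: ball_cong)
    finally show ?thesis using True by blast
  qed (auto simp: stable_submodules_def submodule_def)
  interpret length_count \<Delta> I n "gr_class n" "Gr I n" poly_ring "carrier (TBI I)" "act_Gr I n" "carrier (TBI I)" "graded_exps n"
  proof (unfold_locales, goal_cases)
    case (1 f)
    then show ?case by (rule gr_class_kernel)
  next
    case (2 W)
    show ?case by (rule stable)
  next
    case (4 i j)
    then show ?case by (simp add: euler_partial_TBI)
  next
    case (5 m j)
    then show ?case by (simp add: euler_partial_TBI partial_TBI)
  qed (auto simp: noncone_exps_def)
  show ?thesis unfolding length_T_def by (rule length_eq)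
qed

lemma length_gk_eq: "length_gk I n = enat (card (sdegs \<Delta> n))"
proof -
  interpret Gr: presentation "deg_ge n" "fibre_class n" "Gr_k I n" by (rule Gr_k_presentation)
  have stable: "W \<in> stable_submodules kring (Gr_k I n) (carrier (gk I)) (act_gk I n) \<longleftrightarrow>
      subgroup W (add_monoid (Gr_k I n)) \<and> (\<forall>f\<in>deg_ge n. fibre_class n f \<in> W \<longrightarrow>
        (\<forall>b. fibre_class n (b * f) \<in> W) \<and> (\<forall>D\<in>iso_ders. fibre_class n (D f) \<in> W))" for W
  proof (cases "subgroup W (add_monoid (Gr_k I n))")
    case True
    then have "W \<subseteq> fibre_class n ` deg_ge n" using subgroup.subset carrier_Gr_k by force
    then have ball: "(\<forall>w\<in>W. P w) \<longleftrightarrow> (\<forall>f\<in>deg_ge n. fibre_class n f \<in> W \<longrightarrow> P (fibre_class n f))" for P by blast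
    have "W \<in> stable_submodules kring (Gr_k I n) (carrier (gk I)) (act_gk I n) \<longleftrightarrow>
        (\<forall>w\<in>W. (\<forall>b. to_k b \<odot>\<^bsub>Gr_k I n\<^esub> w \<in> W) \<and> (\<forall>D\<in>iso_ders. act_gk I n (fibre_lie_class D) w \<in> W))"
      using True by (auto simp: stable_submodules_def submodule_def submodule_axioms_def
          carrier_kring carrier_gk)
    also have "\<dots> \<longleftrightarrow> (\<forall>f\<in>deg_ge n. fibre_class n f \<in> W \<longrightarrow>
        (\<forall>b. to_k b \<odot>\<^bsub>Gr_k I n\<^esub> fibre_class n f \<in> W) \<and> (\<forall>D\<in>iso_ders. act_gk I n (fibre_lie_class D) (fibre_class n f) \<in> W))"
      by (rule ball)
    also have "\<dots> \<longleftrightarrow> (\<forall>f\<in>deg_ge n. fibre_class n f \<in> W \<longrightarrow>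
        (\<forall>b. fibre_class n (b * f) \<in> W) \<and> (\<forall>D\<in>iso_ders. fibre_class n (D f) \<in> W))"
      by (simp add: Gr_k_smult act_gk_fibre_lie_class cong: ball_cong)
    finally show ?thesis using True by blast
  qed (auto simp: stable_submodules_def submodule_def)
  interpret length_count \<Delta> I n "fibre_class n" "Gr_k I n" kring "carrier (gk I)" "act_gk I n" iso_ders "noncone_exps n"
  proof (unfold_locales, goal_cases)
    case (1 f)
    then show ?case by (rule fibre_class_kernel)
  next
    case (2 W)
    show ?case by (rule stable)
  next
    case 3
    show ?case using iso_ders_TBI by blast
  next
    case (4 i j)
    then have "var i \<in> Jm I" by (simp add: Jm_iff var_def mdeg_unit_exp)
    then have "var i * partial j b \<in> Jm I" for b
      using Jm_mult[of "var i" "partial j b"] by (simp add: mult.commute)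
    then show ?case using 4 by (simp add: iso_ders_def euler_partial_TBI)
  next
    case (8 D d m m' j)
    have m': "keys m' \<subseteq> noncone \<Delta>" "mdeg \<Delta> m' = n" using 8 by (auto simp: noncone_exps_def graded_exps_def)
    have "D (var j) \<in> Jm I" using 8 by (simp add: iso_ders_def)
    then have "mdeg \<Delta> d > 0" using 8 unfolding Jm_iff by blast
    moreover have "mdeg \<Delta> m' + mdeg \<Delta> (unit_exp j) = mdeg \<Delta> d + mdeg \<Delta> m"
      using arg_cong[OF 8(3), of "mdeg \<Delta>"] by (simp add: mdeg_add)
    ultimately have "j \<in> noncone \<Delta>" using m' 8 by (auto simp: mdeg_unit_exp graded_exps_def split: if_splits)
    moreover have "keys m' \<union> {j} = keys d \<union> keys m"
      using arg_cong[OF 8(3), of keys] by (simp add: keys_add_nat)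
    ultimately show ?case using m' 8 by (auto simp: noncone_exps_def)
  qed (auto simp: noncone_exps_def keys_add_nat)
  show ?thesis unfolding length_gk_def by (rule length_eq)
qed

end

theorem theorem4p17:
  fixes \<Delta> :: "'v::finite set set"
    and I :: "('v, 'k::{alg_closed_field, field_char_0}) mpoly set"
  assumes "simplicial_complex \<Delta>"
    and "I = sr_ideal \<Delta>"
  shows "(\<forall>n. length_T I n \<noteq> \<infinity> \<and> length_gk I n \<noteq> \<infinity>) \<and>
    H_Lie I = length_series (length_gk I) \<and>
    (\<Inter>(facets \<Delta>) = {} \<longrightarrow>
      H_Lie I = 1 / (1 - fps_X) ^ card (strata \<Delta>) *
        (\<Sum>i\<le>card (strata \<Delta>). of_nat (face_number (essential_complex \<Delta>) (int i - 1)) *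
            fps_X ^ i * (1 - fps_X) ^ (card (strata \<Delta>) - i))) \<and>
    (\<forall>i. face_number (essential_complex \<Delta>) i \<le> face_number \<Delta> i)"
proof -
  interpret stanley_reisner \<Delta> I by unfold_locales (rule assms)+
  have series: "H_Lie I = Abs_fps (\<lambda>n. of_nat (card (sdegs \<Delta> n)))"
    by (simp add: length_series_def length_T_eq)
  have "length_series (length_gk I) = Abs_fps (\<lambda>n. of_nat (card (sdegs \<Delta> n)))"
    by (simp add: length_series_def length_gk_eq)
  then show ?thesis
    using series length_series_sdegs[OF assms(1)] face_number_essential_le[OF assms(1)]
    by (simp add: length_T_eq length_gk_eq)
qed

end
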